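(* Let $a,b\in\mathbb{Q}$ with $a\neq 0$, let $f(x)=x^8+ax^6+bx^4+ax^2+1\in\mathbb{Q}[x]$ be irreducible over $\mathbb{Q}$, and let $g(x)=x^4+ax^3+bx^2+ax+1$, so that $f(x)=g(x^2)$. (1) If $\mathrm{Gal}(g)$ is $E_4$, then $\mathrm{Gal}(f)$ is 8T2, 8T3, 8T4 or 8T9. (2) If $\mathrm{Gal}(g)$ is $C_4$, then $\mathrm{Gal}(f)$ is 8T2 or 8T10. (3) If $\mathrm{Gal}(g)$ is $D_4$, then $\mathrm{Gal}(f)$ is 8T4, 8T9, 8T10 or 8T18. Moreover, each of the possibilities above does occur: for each listed pair consisting of a group for $\mathrm{Gal}(g)$ and a group for $\mathrm{Gal}(f)$, there exist $a,b\in\mathbb{Q}$ with $a\neq0$ and $f$ irreducible realizing that pair.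
   Context: $\mathrm{Gal}(h)$ is the Galois group over $\mathbb{Q}$ of (the splitting field of) $h$; for the octic $f$ it is viewed as a transitive permutation group on the eight roots of $f$, i.e. as a transitive subgroup of $S_8$ up to conjugacy. $C_4$ is the cyclic group of order 4, $E_4$ the elementary abelian group of order 4, $D_4$ the dihedral group of order 8. 8Tj denotes the $j$-th conjugacy class of transitive subgroups of $S_8$ in the Butler–McKay (LMFDB) numbering. The classes used here are identified as follows; each consists of exactly the transitive subgroups of $S_8$ that are isomorphic, as abstract groups, to the indicated group: 8T2: $C_4\times C_2$ (order 8); 8T3: $C_2^3$ (order 8); 8T4: $D_4$ (order 8); 8T9: $C_2\times D_4$ (order 16); 8T10: the semidirect product $C_2^2\rtimes C_4$ of order 16 in which a generator of $C_4$ acts on $C_2^2=C_2\times C_2$ by swapping the two factors; 8T18: the wreath product $C_2^2\wr C_2$ (order 32). *)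

theory Defs
  imports
    "HOL-Computational_Algebra.Computational_Algebra"
    "HOL-Algebra.Algebra"
    "HOL-Algebra.Algebraic_Closure_Type"
begin

section \<open>The polynomials\<close>

definition quartic :: "rat \<Rightarrow> rat \<Rightarrow> rat poly" where
  "quartic a b = [:1, a, b, a, 1:]"

definition octic :: "rat \<Rightarrow> rat \<Rightarrow> rat poly" where
  "octic a b = [:1, 0, a, 0, b, 0, a, 0, 1:]"

lemma octic_eq_quartic_square: "octic a b = pcompose (quartic a b) [:0, 0, 1:]"
  by (simp add: octic_def quartic_def pcompose_pCons)


section \<open>Galois groups over the rationals\<close>

definition complex_roots :: "rat poly \<Rightarrow> complex set" where
  "complex_roots p = {z. poly (map_poly of_rat p) z = 0}"

text \<open>A subfield of the complex numbers contains the rationals, so no base field has to be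
  adjoined.\<close>

definition splitting_field :: "rat poly \<Rightarrow> complex ring" where
  "splitting_field p =
     ring_of_type_algebra \<lparr>carrier := generate_field ring_of_type_algebra (complex_roots p)\<rparr>"

definition galois_group :: "rat poly \<Rightarrow> (complex \<Rightarrow> complex) monoid" where
  "galois_group p = BijGroup (carrier (splitting_field p))
     \<lparr>carrier := {\<sigma> \<in> Bij (carrier (splitting_field p)).
        \<sigma> \<in> ring_iso (splitting_field p) (splitting_field p) \<and> (\<forall>q. \<sigma> (of_rat q) = of_rat q)}\<rparr>"

text \<open>The permutations of the indices that the Galois group induces when the roots of \<open>p\<close>
  are labelled by \<open>\<beta> 1, \<dots>, \<beta> n\<close>.\<close>

definition galois_perms :: "rat poly \<Rightarrow> nat \<Rightarrow> (nat \<Rightarrow> complex) \<Rightarrow> (nat \<Rightarrow> nat) set" where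
  "galois_perms p n \<beta> = {\<pi>. \<pi> permutes {1..n} \<and>
     (\<exists>\<sigma> \<in> carrier (galois_group p). \<forall>i \<in> {1..n}. \<beta> (\<pi> i) = \<sigma> (\<beta> i))}"

text \<open>Relabelling the roots conjugates the permutation group; for a class \<open>T\<close> closed under
  conjugation it therefore does not matter which labelling is used.\<close>

definition galois_type :: "rat poly \<Rightarrow> nat \<Rightarrow> (nat \<Rightarrow> nat) set set \<Rightarrow> bool" where
  "galois_type p n T \<longleftrightarrow>
     (\<exists>\<beta>. bij_betw \<beta> {1..n} (complex_roots p) \<and> galois_perms p n \<beta> \<in> T)"


section \<open>The abstract groups\<close>

text \<open>\<open>(n, h) (n', h') = (n \<cdot> \<phi> h n', h h')\<close>\<close>

definition semidirect ::
  "('a, 'c) monoid_scheme \<Rightarrow> ('b, 'd) monoid_scheme \<Rightarrow> ('b \<Rightarrow> 'a \<Rightarrow> 'a) \<Rightarrow> ('a \<times> 'b) monoid" where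
  "semidirect N H \<phi> =
     \<lparr>carrier = carrier N \<times> carrier H,
      monoid.mult = (\<lambda>(n, h) (n', h'). (n \<otimes>\<^bsub>N\<^esub> \<phi> h n', h \<otimes>\<^bsub>H\<^esub> h')),
      one = (\<one>\<^bsub>N\<^esub>, \<one>\<^bsub>H\<^esub>)\<rparr>"

abbreviation (input) C2 :: "int monoid" where "C2 \<equiv> integer_mod_group 2"

abbreviation (input) C4 :: "int monoid" where "C4 \<equiv> integer_mod_group 4"

definition E4 :: "(int \<times> int) monoid" where
  "E4 = C2 \<times>\<times> C2"

text \<open>In the three semidirect products below, the residue class of \<open>k\<close> acts by the \<open>k\<close>-th
  iterate of an involution (inversion, respectively the swap of two factors).\<close>

definition D4 :: "(int \<times> int) monoid" where
  "D4 = semidirect C4 C2 (\<lambda>k. m_inv C4 ^^ nat k)"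

definition E4_semidirect_C4 :: "((int \<times> int) \<times> int) monoid" where
  "E4_semidirect_C4 = semidirect E4 C4 (\<lambda>k. prod.swap ^^ nat k)"

definition E4_wreath_C2 :: "(((int \<times> int) \<times> (int \<times> int)) \<times> int) monoid" where
  "E4_wreath_C2 = semidirect (E4 \<times>\<times> E4) C2 (\<lambda>k. prod.swap ^^ nat k)"


section \<open>Classes of transitive subgroups of \<open>S\<^sub>8\<close>\<close>

definition transitive_class :: "nat \<Rightarrow> ('a, 'b) monoid_scheme \<Rightarrow> (nat \<Rightarrow> nat) set set" where
  "transitive_class n G =
     {H. subgroup H (sym_group n) \<and> (\<forall>i \<in> {1..n}. \<forall>j \<in> {1..n}. \<exists>\<pi> \<in> H. \<pi> i = j) \<and>
         (sym_group n \<lparr>carrier := H\<rparr>) \<cong> G}"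

text \<open>Each of these Butler--McKay classes consists of all the transitive subgroups of \<open>S\<^sub>8\<close>
  of its isomorphism type; for a general class this fails.\<close>

definition T8_2 :: "(nat \<Rightarrow> nat) set set" where
  "T8_2 = transitive_class 8 (C4 \<times>\<times> C2)"

definition T8_3 :: "(nat \<Rightarrow> nat) set set" where
  "T8_3 = transitive_class 8 (C2 \<times>\<times> C2 \<times>\<times> C2)"

definition T8_4 :: "(nat \<Rightarrow> nat) set set" where
  "T8_4 = transitive_class 8 D4"

definition T8_9 :: "(nat \<Rightarrow> nat) set set" where
  "T8_9 = transitive_class 8 (C2 \<times>\<times> D4)"

definition T8_10 :: "(nat \<Rightarrow> nat) set set" where
  "T8_10 = transitive_class 8 E4_semidirect_C4"

definition T8_18 :: "(nat \<Rightarrow> nat) set set" where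
  "T8_18 = transitive_class 8 E4_wreath_C2"

end

theory Submission
  imports Defs "HOL-Library.Z2" "HOL-Library.Product_Plus"
begin

text \<open>
  The octic is closed under \<open>x \<mapsto> -x\<close> and \<open>x \<mapsto> 1/x\<close>, so Klein's four-group \<open>V\<close> acts on its roots. Writing
  \<open>u(x) = x\<^sup>2 + x\<^sup>-\<^sup>2\<close>, one has \<open>f(x) = x\<^sup>4 (u(x) - u\<^sub>1) (u(x) - u\<^sub>2)\<close>, where \<open>u\<^sub>1, u\<^sub>2\<close> are the
  roots of \<open>y\<^sup>2 + a y + b - 2\<close>; the roots of \<open>f\<close> are therefore the two orbits \<open>V \<alpha>\<close> and \<open>V \<beta>\<close> with
  \<open>u(\<alpha>) = u\<^sub>1\<close> and \<open>u(\<beta>) = u\<^sub>2\<close>. Field automorphisms commute with \<open>V\<close>, so the Galois group of \<open>f\<close> is a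
  transitive subgroup \<open>H\<close> of the wreath product of \<open>V\<close> by \<open>C\<^sub>2\<close>, a group of order 32 with elements
  \<open>(v, w, s)\<close>: the bit \<open>s\<close> tells whether the two orbits are exchanged.

  The map \<open>\<delta>(v, w, s) = v + w\<close> is a homomorphism to \<open>V\<close>, and the type of \<open>H\<close> depends on the subgroup \<open>D\<close> of
  the sums \<open>\<delta>\<close> of the elements with \<open>s = 0\<close>, on the coset \<open>c + D\<close> of the sums of those with \<open>s = 1\<close>, and
  in one case on one more bit. The group is 8T18 for \<open>D = V\<close>; for \<open>D = {0, k}\<close> it is 8T10 if
  \<open>c \<notin> D\<close>, and otherwise 8T9 or 8T4 according to whether \<open>(k, 0, 0)\<close> lies in \<open>H\<close>; for \<open>D = 0\<close> it is
  8T3 if \<open>c = 0\<close> and 8T2 if not. The Galois group of \<open>g\<close> is the image of \<open>H\<close> in the wreath product of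
  \<open>V / \<langle>m\<rangle>\<close> by \<open>C\<^sub>2\<close>, where \<open>m\<close> is negation: it is \<open>D\<^sub>4\<close> unless \<open>D\<close> lies in \<open>\<langle>m\<rangle>\<close>, and then it is
  \<open>E\<^sub>4\<close> or \<open>C\<^sub>4\<close> according to whether \<open>c\<close> lies in \<open>\<langle>m\<rangle>\<close>. Running through the cases gives exactly the
  ten listed pairs (lemma \<open>transitive_subgroup_pairs\<close>), and hence the three implications.

  For the examples the invariants are read off from squares. Put \<open>A(x) = x + 1/x\<close> and
  \<open>B(x) = x - 1/x\<close>, on which \<open>V\<close> acts by signs, and \<open>k = \<rat>(r)\<close> with \<open>r = u\<^sub>1 - u\<^sub>2\<close>, so that \<open>r\<^sup>2\<close> is
  the discriminant \<open>a\<^sup>2 - 4 b + 8\<close>. The splitting field arises from \<open>k\<close> by adjoining the square roots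
  \<open>A(\<alpha>), B(\<alpha>), A(\<beta>), B(\<beta>)\<close> of \<open>u\<^sub>1 + 2, u\<^sub>1 - 2, u\<^sub>2 + 2, u\<^sub>2 - 2\<close>. The products \<open>A(\<alpha>) A(\<beta>)\<close> and
  \<open>B(\<alpha>) B(\<beta>)\<close> are square roots of the rational numbers \<open>g(-1)\<close> and \<open>g(1)\<close>, and automorphisms multiply
  them by signs that depend only on \<open>\<delta>\<close>. So \<open>D\<close> and \<open>c\<close> are determined by which of
  \<open>g(-1), g(1), g(-1) g(1)\<close> are rational squares, or become so after multiplication by \<open>r\<^sup>2\<close>, and the
  remaining bit by whether one more element is a square in \<open>k\<close>.

  Both directions rest on a single fact of Galois theory, proved by adjoining one square root after
  another (lemmas \<open>extend_hom_sqrt\<close> and \<open>extend_to_galois_group\<close>): an embedding of a subfield of the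
  splitting field extends to an automorphism of the splitting field. It yields an automorphism that negates a given square root
  which is not yet in the base field, and with it transitivity, hence irreducibility, as soon as \<open>r\<close> is
  irrational and none of \<open>A(\<alpha>), B(\<alpha>), A(\<alpha>) B(\<alpha>)\<close> lies in \<open>k\<close>. Conversely, if one of these
  conditions fails, \<open>\<alpha>\<close> is a root of a rational quartic.
\<close>

section \<open>Subfields of the complex numbers and their homomorphisms\<close>

definition complex_subfield :: "complex set \<Rightarrow> bool" where
  "complex_subfield F \<longleftrightarrow> 1 \<in> F \<and> (\<forall>x\<in>F. \<forall>y\<in>F. x - y \<in> F \<and> x * y \<in> F) \<and> (\<forall>x\<in>F. inverse x \<in> F)"

lemma
  assumes "complex_subfield F"
  shows subfield_one: "1 \<in> F"
    and subfield_zero: "0 \<in> F"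
    and subfield_diff: "x \<in> F \<Longrightarrow> y \<in> F \<Longrightarrow> x - y \<in> F"
    and subfield_mult: "x \<in> F \<Longrightarrow> y \<in> F \<Longrightarrow> x * y \<in> F"
    and subfield_inverse: "x \<in> F \<Longrightarrow> inverse x \<in> F"
    and subfield_uminus: "x \<in> F \<Longrightarrow> - x \<in> F"
    and subfield_add: "x \<in> F \<Longrightarrow> y \<in> F \<Longrightarrow> x + y \<in> F"
    and subfield_divide: "x \<in> F \<Longrightarrow> y \<in> F \<Longrightarrow> x / y \<in> F"
    and subfield_power: "x \<in> F \<Longrightarrow> x ^ n \<in> F"
    and subfield_of_rat: "of_rat q \<in> F"
proof -
  note F = assms[unfolded complex_subfield_def]
  show one: "1 \<in> F" and diff: "x \<in> F \<Longrightarrow> y \<in> F \<Longrightarrow> x - y \<in> F"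
    and mult: "x \<in> F \<Longrightarrow> y \<in> F \<Longrightarrow> x * y \<in> F" and inv: "x \<in> F \<Longrightarrow> inverse x \<in> F" for x y
    using F by auto
  show zero: "0 \<in> F" using diff[OF one one] by simp
  show neg: "x \<in> F \<Longrightarrow> - x \<in> F" for x using diff[OF zero, of x] by simp
  show add: "x \<in> F \<Longrightarrow> y \<in> F \<Longrightarrow> x + y \<in> F" for x y using diff[OF _ neg, of x y] by simp
  show divide: "x \<in> F \<Longrightarrow> y \<in> F \<Longrightarrow> x / y \<in> F" for x y using mult inv by (simp add: divide_inverse)
  show "x \<in> F \<Longrightarrow> x ^ n \<in> F" by (induction n) (auto simp: one mult)
  have nat: "of_nat n \<in> F" for n by (induction n) (auto simp: zero one add)
  have int: "of_int i \<in> F" for i by (cases i) (auto intro: nat neg simp del: of_nat_Suc)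
  obtain m n where "quotient_of q = (m, n)" by fastforce
  then have "q = of_int m / of_int n" by (rule quotient_of_div)
  then show "of_rat q \<in> F" by (simp add: of_rat_divide divide int)
qed

lemma subfield_numeral: "complex_subfield F \<Longrightarrow> numeral n \<in> F"
  using subfield_of_rat[of F "numeral n"] by simp

lemmas subfield_closed = subfield_one subfield_zero subfield_diff subfield_mult subfield_inverse
  subfield_uminus subfield_add subfield_divide subfield_power subfield_of_rat subfield_numeral

definition adjoin :: "complex set \<Rightarrow> complex set" where
  "adjoin S = \<Inter> {F. complex_subfield F \<and> S \<subseteq> F}"

lemma adjoin_subfield: "complex_subfield (adjoin S)"
  unfolding adjoin_def complex_subfield_def by blast

lemma adjoin_superset: "S \<subseteq> adjoin S"
  unfolding adjoin_def by blast

lemma adjoin_least: "complex_subfield F \<Longrightarrow> S \<subseteq> F \<Longrightarrow> adjoin S \<subseteq> F"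
  unfolding adjoin_def by blast

lemma adjoin_mono: "S \<subseteq> adjoin T \<Longrightarrow> adjoin S \<subseteq> adjoin T"
  by (rule adjoin_least[OF adjoin_subfield])

definition field_hom :: "complex set \<Rightarrow> (complex \<Rightarrow> complex) \<Rightarrow> bool" where
  "field_hom F \<sigma> \<longleftrightarrow> \<sigma> 1 = 1 \<and> (\<forall>x\<in>F. \<forall>y\<in>F. \<sigma> (x + y) = \<sigma> x + \<sigma> y \<and> \<sigma> (x * y) = \<sigma> x * \<sigma> y)"

lemma field_hom_id: "field_hom F (\<lambda>x. x)"
  by (simp add: field_hom_def)

lemma field_hom_subset: "field_hom F \<sigma> \<Longrightarrow> E \<subseteq> F \<Longrightarrow> field_hom E \<sigma>"
  unfolding field_hom_def by blast

lemma field_hom_cong: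
  assumes "complex_subfield F" "field_hom F \<sigma>" "\<And>x. x \<in> F \<Longrightarrow> \<tau> x = \<sigma> x"
  shows "field_hom F \<tau>"
  using assms(2,3) subfield_closed[OF assms(1)] unfolding field_hom_def by simp

lemma
  assumes F: "complex_subfield F" and \<sigma>: "field_hom F \<sigma>"
  shows field_hom_one: "\<sigma> 1 = 1"
    and field_hom_add: "x \<in> F \<Longrightarrow> y \<in> F \<Longrightarrow> \<sigma> (x + y) = \<sigma> x + \<sigma> y"
    and field_hom_mult: "x \<in> F \<Longrightarrow> y \<in> F \<Longrightarrow> \<sigma> (x * y) = \<sigma> x * \<sigma> y"
    and field_hom_zero: "\<sigma> 0 = 0"
    and field_hom_uminus: "x \<in> F \<Longrightarrow> \<sigma> (- x) = - \<sigma> x"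
    and field_hom_diff: "x \<in> F \<Longrightarrow> y \<in> F \<Longrightarrow> \<sigma> (x - y) = \<sigma> x - \<sigma> y"
    and field_hom_inverse: "x \<in> F \<Longrightarrow> \<sigma> (inverse x) = inverse (\<sigma> x)"
    and field_hom_divide: "x \<in> F \<Longrightarrow> y \<in> F \<Longrightarrow> \<sigma> (x / y) = \<sigma> x / \<sigma> y"
    and field_hom_power: "x \<in> F \<Longrightarrow> \<sigma> (x ^ n) = \<sigma> x ^ n"
    and field_hom_of_rat: "\<sigma> (of_rat q) = of_rat q"
    and field_hom_inj: "inj_on \<sigma> F"
proof -
  note c = subfield_closed[OF F]
  show one: "\<sigma> 1 = 1" and add: "x \<in> F \<Longrightarrow> y \<in> F \<Longrightarrow> \<sigma> (x + y) = \<sigma> x + \<sigma> y"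
    and mult: "x \<in> F \<Longrightarrow> y \<in> F \<Longrightarrow> \<sigma> (x * y) = \<sigma> x * \<sigma> y" for x y
    using \<sigma> by (auto simp: field_hom_def)
  show zero: "\<sigma> 0 = 0" using add[of 0 0] c by simp
  show neg: "x \<in> F \<Longrightarrow> \<sigma> (- x) = - \<sigma> x" for x
    using add[of x "- x"] c(6)[of x] zero by (simp add: eq_neg_iff_add_eq_0 add.commute)
  show diff: "x \<in> F \<Longrightarrow> y \<in> F \<Longrightarrow> \<sigma> (x - y) = \<sigma> x - \<sigma> y" for x y
    using add[of x "- y"] neg[of y] c(6)[of y] by simp
  have inv: "\<sigma> (inverse x) * \<sigma> x = 1" if "x \<in> F" "x \<noteq> 0" for x
    using mult[of "inverse x" x] c(5)[of x] one that by simp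
  show inverse: "x \<in> F \<Longrightarrow> \<sigma> (inverse x) = inverse (\<sigma> x)" for x
  proof (cases "x = 0")
    case False
    assume "x \<in> F"
    then show ?thesis
      using inv[of x] False inverse_unique[of "\<sigma> x" "\<sigma> (inverse x)"] by (simp add: mult.commute)
  qed (simp add: zero)
  show divide: "x \<in> F \<Longrightarrow> y \<in> F \<Longrightarrow> \<sigma> (x / y) = \<sigma> x / \<sigma> y" for x y
    by (simp add: divide_inverse mult inverse c(5))
  show "x \<in> F \<Longrightarrow> \<sigma> (x ^ n) = \<sigma> x ^ n"
    by (induction n) (simp_all add: one mult c(9))
  have nat: "\<sigma> (of_nat n) = of_nat n" for n
  proof (induction n)
    case (Suc n)
    have "of_nat n \<in> F" using c(10)[of "of_nat n"] by simp
    then show ?case using Suc add[of 1 "of_nat n"] one c(1) by simp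
  qed (simp add: zero)
  have int: "\<sigma> (of_int i) = of_int i" for i
  proof (cases i)
    case (neg n)
    have "of_nat (Suc n) \<in> F" using c(10)[of "of_nat (Suc n)"] by (simp del: of_nat_Suc)
    then show ?thesis using neg nat[of "Suc n"] \<open>\<And>x. x \<in> F \<Longrightarrow> \<sigma> (- x) = - \<sigma> x\<close>
      by (simp del: of_nat_Suc)
  qed (simp add: nat)
  obtain m n where "quotient_of q = (m, n)" by fastforce
  then have q: "q = of_int m / of_int n" by (rule quotient_of_div)
  have "of_int m \<in> F" "of_int n \<in> F" using c(10)[of "of_int m"] c(10)[of "of_int n"] by simp_all
  then show "\<sigma> (of_rat q) = of_rat q" unfolding q by (simp add: of_rat_divide divide int)
  show "inj_on \<sigma> F"
  proof (rule inj_onI)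
    fix x y assume xy: "x \<in> F" "y \<in> F" "\<sigma> x = \<sigma> y"
    then have "\<sigma> (x - y) = 0" using diff by simp
    then show "x = y" using inv[of "x - y"] c(3)[OF xy(1,2)] by fastforce
  qed
qed

lemma field_hom_numeral: "complex_subfield F \<Longrightarrow> field_hom F \<sigma> \<Longrightarrow> \<sigma> (numeral n) = numeral n"
  using field_hom_of_rat[of F \<sigma> "numeral n"] by simp

lemmas field_hom_simps = field_hom_one field_hom_add field_hom_mult field_hom_zero field_hom_uminus field_hom_diff field_hom_inverse field_hom_divide
  field_hom_power field_hom_of_rat field_hom_numeral

text \<open>The elements on which two homomorphisms agree form a subfield.\<close>

lemma hom_eq_on_adjoin:
  assumes F: "complex_subfield F" "S \<subseteq> F" and h: "field_hom F \<sigma>" "field_hom F \<tau>"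
    and eq: "\<And>x. x \<in> S \<Longrightarrow> \<sigma> x = \<tau> x" and x: "x \<in> adjoin S"
  shows "\<sigma> x = \<tau> x"
proof -
  have "complex_subfield {x \<in> F. \<sigma> x = \<tau> x}"
    unfolding complex_subfield_def
    using F(1) by (auto simp: field_hom_simps[OF F(1) h(1)] field_hom_simps[OF F(1) h(2)] subfield_closed[OF F(1)])
  moreover have "S \<subseteq> {x \<in> F. \<sigma> x = \<tau> x}" using F eq by auto
  ultimately show ?thesis using adjoin_least x by blast
qed

text \<open>Both inclusions are minimality of a generated field: preimages and images of subfields are subfields.\<close>

lemma image_hom_adjoin:
  assumes h: "field_hom (adjoin S) \<sigma>"
  shows "\<sigma> ` adjoin S = adjoin (\<sigma> ` S)"
proof
  note F = adjoin_subfield[of S] note hs = field_hom_simps[OF F h] note c = subfield_closed[OF F]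
  have "complex_subfield {x \<in> adjoin S. \<sigma> x \<in> adjoin (\<sigma> ` S)}"
    unfolding complex_subfield_def
    by (auto simp: hs c subfield_closed[OF adjoin_subfield])
  moreover have "S \<subseteq> {x \<in> adjoin S. \<sigma> x \<in> adjoin (\<sigma> ` S)}"
    using adjoin_superset[of S] adjoin_superset[of "\<sigma> ` S"] by auto
  ultimately show "\<sigma> ` adjoin S \<subseteq> adjoin (\<sigma> ` S)" using adjoin_least by blast
  have "complex_subfield (\<sigma> ` adjoin S)"
    unfolding complex_subfield_def
  proof (intro conjI ballI)
    show "1 \<in> \<sigma> ` adjoin S" by (intro rev_image_eqI[of 1]) (simp_all add: hs(1) c(1))
  next
    fix u v assume "u \<in> \<sigma> ` adjoin S" "v \<in> \<sigma> ` adjoin S"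
    then obtain x y where xy: "x \<in> adjoin S" "y \<in> adjoin S" "u = \<sigma> x" "v = \<sigma> y" by auto
    show "u - v \<in> \<sigma> ` adjoin S"
      by (rule rev_image_eqI[of "x - y"]) (use xy c(3) hs(6) in auto)
    show "u * v \<in> \<sigma> ` adjoin S"
      by (rule rev_image_eqI[of "x * y"]) (use xy c(4) hs(3) in auto)
  next
    fix u assume "u \<in> \<sigma> ` adjoin S"
    then obtain x where x: "x \<in> adjoin S" "u = \<sigma> x" by auto
    show "inverse u \<in> \<sigma> ` adjoin S"
      by (rule rev_image_eqI[of "inverse x"]) (use x c(5) hs(7) in auto)
  qed
  then show "adjoin (\<sigma> ` S) \<subseteq> \<sigma> ` adjoin S"
    using adjoin_superset[of S] by (intro adjoin_least) auto
qed

text \<open>In inverting \<open>x + y z \<noteq> 0\<close> the norm \<open>x\<^sup>2 - y\<^sup>2 z\<^sup>2\<close> cannot vanish, because otherwise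
  \<open>z\<close> would be a quotient of elements of \<open>F\<close>.\<close>

lemma
  assumes F: "complex_subfield F" and z: "z\<^sup>2 \<in> F" "z \<notin> F"
  shows sqrt_coordinates: "x \<in> F \<Longrightarrow> y \<in> F \<Longrightarrow> x' \<in> F \<Longrightarrow> y' \<in> F \<Longrightarrow>
      x + y * z = x' + y' * z \<longleftrightarrow> x = x' \<and> y = y'"
    and adjoin_sqrt: "adjoin (insert z F) = {x + y * z |x y. x \<in> F \<and> y \<in> F}"
proof -
  note c = subfield_closed[OF F]
  define E where "E = {x + y * z |x y. x \<in> F \<and> y \<in> F}"
  have uniq: "x = x' \<and> y = y'"
    if "x \<in> F" "y \<in> F" "x' \<in> F" "y' \<in> F" "x + y * z = x' + y' * z" for x y x' y'
  proof -
    have eq: "(y - y') * z = x' - x" using that(5) by (simp add: algebra_simps)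
    have "y = y'"
    proof (rule ccontr)
      assume "y \<noteq> y'"
      then have "z = (x' - x) / (y - y')" using eq by (simp add: field_simps)
      then show False using z that c by auto
    qed
    then show ?thesis using that(5) by simp
  qed
  have EI: "x \<in> F \<Longrightarrow> y \<in> F \<Longrightarrow> u = x + y * z \<Longrightarrow> u \<in> E" for u x y unfolding E_def by auto
  have mult: "(x + y * z) * (x' + y' * z) = (x * x' + y * y' * z\<^sup>2) + (x * y' + y * x') * z" for x y x' y' z :: complex
    by (simp add: algebra_simps power2_eq_square)
  have subE: "complex_subfield E"
    unfolding complex_subfield_def
  proof (intro conjI ballI)
    show "1 \<in> E" using EI[of 1 0 1] c by simp
    fix u v assume "u \<in> E" "v \<in> E"
    then obtain x y x' y' where u: "x \<in> F" "y \<in> F" "u = x + y * z" and v: "x' \<in> F" "y' \<in> F" "v = x' + y' * z"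
      unfolding E_def by auto
    show "u - v \<in> E" using u v c by (intro EI[of "x - x'" "y - y'"]) (auto simp: algebra_simps)
    show "u * v \<in> E" unfolding u v mult using u v c z by (intro EI[OF _ _ refl]) auto
  next
    fix u assume "u \<in> E"
    then obtain x y where u: "x \<in> F" "y \<in> F" "u = x + y * z" unfolding E_def by auto
    show "inverse u \<in> E"
    proof (cases "u = 0")
      case True
      then show ?thesis using EI[of 0 0 0] c by simp
    next
      case False
      define n where "n = x\<^sup>2 - y\<^sup>2 * z\<^sup>2"
      have n: "u * (x - y * z) = n" unfolding u n_def by (simp add: algebra_simps power2_eq_square)
      have "x - y * z \<noteq> 0"
        using uniq[of x "-y" 0 0] u c False by auto
      then have "n \<noteq> 0" using n False by auto
      then have "inverse u = (x - y * z) / n" using n by (intro inverse_unique) simp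
      also have "\<dots> = x / n + (- y / n) * z" by (simp add: diff_divide_distrib)
      finally have inv: "inverse u = x / n + (- y / n) * z" .
      have "n \<in> F" unfolding n_def using u c(3,4,9) z by simp
      then show ?thesis using u c(6,8) by (intro EI[OF _ _ inv]) simp_all
    qed
  qed
  have "adjoin (insert z F) \<subseteq> E"
    using EI[of 0 1 z] EI[of _ 0] c by (intro adjoin_least[OF subE]) auto
  moreover have "E \<subseteq> adjoin (insert z F)"
  proof
    fix u assume "u \<in> E"
    then obtain x y where u: "x \<in> F" "y \<in> F" "u = x + y * z" unfolding E_def by auto
    have "x \<in> adjoin (insert z F)" "y \<in> adjoin (insert z F)" "z \<in> adjoin (insert z F)"
      using adjoin_superset[of "insert z F"] u by auto
    then show "u \<in> adjoin (insert z F)"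
      unfolding u(3) by (intro subfield_add[OF adjoin_subfield] subfield_mult[OF adjoin_subfield])
  qed
  ultimately show "adjoin (insert z F) = {x + y * z |x y. x \<in> F \<and> y \<in> F}" unfolding E_def by blast
  show "x \<in> F \<Longrightarrow> y \<in> F \<Longrightarrow> x' \<in> F \<Longrightarrow> y' \<in> F \<Longrightarrow> x + y * z = x' + y' * z \<longleftrightarrow> x = x' \<and> y = y'"
    using uniq by blast
qed

text \<open>Every homomorphism used below is built by adjoining square roots one at a time. Here
  \<open>x + y z\<close> has to go to \<open>\<sigma> x + \<sigma> y w\<close>, and this is well defined because \<open>1, z\<close> are
  independent over \<open>F\<close> unless \<open>z\<close> already lies in \<open>F\<close>.\<close>

lemma extend_hom_sqrt:
  assumes F: "complex_subfield F" and \<sigma>: "field_hom F \<sigma>"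
    and z: "z\<^sup>2 \<in> F" and w: "w\<^sup>2 = \<sigma> (z\<^sup>2)" and zF: "z \<in> F \<Longrightarrow> w = \<sigma> z"
  obtains \<tau> where "field_hom (adjoin (insert z F)) \<tau>" "\<And>x. x \<in> F \<Longrightarrow> \<tau> x = \<sigma> x" "\<tau> z = w"
proof (cases "z \<in> F")
  case True
  then have "adjoin (insert z F) \<subseteq> F" using F by (intro adjoin_least) auto
  then show ?thesis using that[of \<sigma>] field_hom_subset[OF \<sigma>] True zF by auto
next
  case False
  note c = subfield_closed[OF F] note hs = field_hom_simps[OF F \<sigma>]
  define E where "E = {x + y * z |x y. x \<in> F \<and> y \<in> F}"
  note uniq = sqrt_coordinates[OF F z False]
  have sub: "adjoin (insert z F) \<subseteq> E" unfolding E_def using adjoin_sqrt[OF F z False] by simp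
  have mult: "(x + y * z) * (x' + y' * z) = (x * x' + y * y' * z\<^sup>2) + (x * y' + y * x') * z" for x y x' y' z :: complex
    by (simp add: algebra_simps power2_eq_square)
  \<comment> \<open>The description picks a value that does not depend on the coordinates, as these are unique.\<close>
  define \<tau> where "\<tau> u = (THE t. \<exists>x\<in>F. \<exists>y\<in>F. u = x + y * z \<and> t = \<sigma> x + \<sigma> y * w)" for u
  have \<tau>: "\<tau> (x + y * z) = \<sigma> x + \<sigma> y * w" if "x \<in> F" "y \<in> F" for x y
    unfolding \<tau>_def using that uniq by (intro the_equality) blast+
  have hom: "field_hom E \<tau>"
    unfolding field_hom_def
  proof (intro conjI ballI)
    show "\<tau> 1 = 1" using \<tau>[of 1 0] hs c by simp
    fix u v assume "u \<in> E" "v \<in> E"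
    then obtain x y x' y' where u: "x \<in> F" "y \<in> F" "u = x + y * z" and v: "x' \<in> F" "y' \<in> F" "v = x' + y' * z"
      unfolding E_def by auto
    have tau: "\<tau> u = \<sigma> x + \<sigma> y * w" "\<tau> v = \<sigma> x' + \<sigma> y' * w" using u v \<tau> by auto
    have "u + v = (x + x') + (y + y') * z" by (simp add: u v algebra_simps)
    then have "\<tau> (u + v) = \<sigma> (x + x') + \<sigma> (y + y') * w" using \<tau> u(1,2) v(1,2) c(7) by metis
    then show "\<tau> (u + v) = \<tau> u + \<tau> v"
      unfolding tau using u(1,2) v(1,2) by (simp add: hs(2) algebra_simps)
    have "u * v = (x * x' + y * y' * z\<^sup>2) + (x * y' + y * x') * z" unfolding u v by (rule mult)
    then have "\<tau> (u * v) = \<sigma> (x * x' + y * y' * z\<^sup>2) + \<sigma> (x * y' + y * x') * w"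
      using \<tau>[of "x * x' + y * y' * z\<^sup>2" "x * y' + y * x'"] u(1,2) v(1,2) c(4,7) z by simp
    also have "\<dots> = (\<sigma> x * \<sigma> x' + \<sigma> y * \<sigma> y' * w\<^sup>2) + (\<sigma> x * \<sigma> y' + \<sigma> y * \<sigma> x') * w"
      using u(1,2) v(1,2) c(4,7) z by (simp add: hs(2,3) w)
    finally show "\<tau> (u * v) = \<tau> u * \<tau> v" unfolding tau by (simp add: mult)
  qed
  show ?thesis
    using that[of \<tau>] field_hom_subset[OF hom sub] \<tau>[of 0 1] \<tau>[of _ 0] c hs by simp
qed

text \<open>Over an algebraically closed target a square root always has an image, so no condition is left.\<close>

lemma extend_hom_sqrts:
  assumes "complex_subfield F" "field_hom F \<sigma>" "\<forall>z\<in>set zs. z\<^sup>2 \<in> F"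
  shows "\<exists>\<tau>. field_hom (adjoin (F \<union> set zs)) \<tau> \<and> (\<forall>x\<in>F. \<tau> x = \<sigma> x)"
  using assms
proof (induction zs arbitrary: F \<sigma>)
  case Nil
  then show ?case using adjoin_least[of F F] field_hom_subset[of F \<sigma>] by auto
next
  case (Cons z zs)
  obtain w where w: "w\<^sup>2 = \<sigma> (z\<^sup>2)" "z \<in> F \<Longrightarrow> w = \<sigma> z"
  proof (cases "z \<in> F")
    case True
    then show ?thesis using that[of "\<sigma> z"] field_hom_power[OF Cons.prems(1,2)] by simp
  next
    case False
    then show ?thesis using that[of "csqrt (\<sigma> (z\<^sup>2))"] by simp
  qed
  from Cons.prems extend_hom_sqrt[OF Cons.prems(1,2) _ w] obtain \<rho>
    where \<rho>: "field_hom (adjoin (insert z F)) \<rho>" "\<And>x. x \<in> F \<Longrightarrow> \<rho> x = \<sigma> x" by (metis list.set_intros(1))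
  have "\<forall>z'\<in>set zs. z'\<^sup>2 \<in> adjoin (insert z F)"
    using Cons.prems(3) adjoin_superset[of "insert z F"] by auto
  from Cons.IH[OF adjoin_subfield \<rho>(1) this] obtain \<tau>
    where \<tau>: "field_hom (adjoin (adjoin (insert z F) \<union> set zs)) \<tau>"
      "\<forall>x\<in>adjoin (insert z F). \<tau> x = \<rho> x" by blast
  have "adjoin (F \<union> set (z # zs)) \<subseteq> adjoin (adjoin (insert z F) \<union> set zs)"
    using adjoin_superset[of "insert z F"] adjoin_superset[of "adjoin (insert z F) \<union> set zs"]
    by (intro adjoin_mono) auto
  then have "field_hom (adjoin (F \<union> set (z # zs))) \<tau>" using field_hom_subset[OF \<tau>(1)] by blast
  moreover have "\<forall>x\<in>F. \<tau> x = \<sigma> x"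
    using \<tau>(2) \<rho>(2) adjoin_superset[of "insert z F"] by auto
  ultimately show ?case by blast
qed

lemma rational_subfield: "complex_subfield (range of_rat)"
  unfolding complex_subfield_def
  by (auto simp: image_iff simp flip: of_rat_diff of_rat_mult of_rat_inverse intro: exI[of _ 1])

text \<open>Membership is proved along with the equation, since the induction step evaluates
  \<open>\<sigma>\<close> at the value of the shorter polynomial.\<close>

lemma hom_root:
  assumes F: "complex_subfield F" "field_hom F \<sigma>" and x: "x \<in> F"
  shows "\<sigma> (poly (map_poly of_rat p) x) = poly (map_poly of_rat p) (\<sigma> x) \<and> poly (map_poly of_rat p) x \<in> F"
proof (induction p)
  case 0
  then show ?case using field_hom_zero[OF F] subfield_zero[OF F(1)] by simp
next
  case (pCons a p)
  have "map_poly of_rat (pCons a p) = pCons (of_rat a :: complex) (map_poly of_rat p)"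
    by (simp add: map_poly_pCons)
  then show ?case using pCons.IH field_hom_simps[OF F] subfield_closed[OF F(1)] x by simp
qed

section \<open>Galois groups as groups of labelled roots\<close>

lemma inv_complex_ring: "x \<noteq> 0 \<Longrightarrow> inv\<^bsub>ring_of_type_algebra\<^esub> (x::complex) = inverse x"
  unfolding ring_of_type_algebra_def m_inv_def
  by (rule the_equality) (auto simp: field_simps)

lemma minus_complex_ring: "\<ominus>\<^bsub>ring_of_type_algebra\<^esub> (x::complex) = - x"
  unfolding ring_of_type_algebra_def a_inv_def m_inv_def
  by (rule the_equality) (auto simp: eq_neg_iff_add_eq_0 add.commute)

lemma generate_field_complex: "generate_field ring_of_type_algebra S = adjoin S"
proof
  let ?R = "ring_of_type_algebra :: complex ring"
  have ops: "\<one>\<^bsub>?R\<^esub> = 1" "\<zero>\<^bsub>?R\<^esub> = 0" "x \<oplus>\<^bsub>?R\<^esub> y = x + y" "x \<otimes>\<^bsub>?R\<^esub> y = x * y" for x y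
    by (auto simp: ring_of_type_algebra_def)
  show "generate_field ?R S \<subseteq> adjoin S"
  proof
    fix x assume "x \<in> generate_field ?R S"
    then show "x \<in> adjoin S"
      using adjoin_superset subfield_closed[OF adjoin_subfield[of S]]
      by induction (auto simp: ops inv_complex_ring minus_complex_ring)
  qed
  have neg: "- x \<in> generate_field ?R S" if "x \<in> generate_field ?R S" for x
    using generate_field.a_inv[OF that] by (simp add: minus_complex_ring)
  have zero: "0 \<in> generate_field ?R S"
    using generate_field.eng_add[OF generate_field.one[of ?R S] neg[OF generate_field.one[of ?R S]]]
    by (simp add: ops)
  have "complex_subfield (generate_field ?R S)"
    unfolding complex_subfield_def
  proof (intro conjI ballI)
    show "1 \<in> generate_field ?R S" using generate_field.one[of ?R S] by (simp add: ops)
    fix x y assume xy: "x \<in> generate_field ?R S" "y \<in> generate_field ?R S"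
    show "x - y \<in> generate_field ?R S"
      using generate_field.eng_add[OF xy(1) neg[OF xy(2)]] by (simp add: ops)
    show "x * y \<in> generate_field ?R S"
      using generate_field.eng_mult[OF xy] by (simp add: ops)
  next
    fix x assume x: "x \<in> generate_field ?R S"
    show "inverse x \<in> generate_field ?R S"
    proof (cases "x = 0")
      case False
      then show ?thesis using generate_field.m_inv[OF x] by (simp add: ops inv_complex_ring)
    qed (simp add: zero)
  qed
  then show "adjoin S \<subseteq> generate_field ?R S"
    by (rule adjoin_least) (auto intro: generate_field.incl)
qed

abbreviation root_field :: "rat poly \<Rightarrow> complex set" where
  "root_field p \<equiv> adjoin (complex_roots p)"

lemma carrier_splitting_field: "carrier (splitting_field p) = root_field p"
  by (simp add: splitting_field_def generate_field_complex)

text \<open>Fixing the rational numbers is automatic for a homomorphism of fields of characteristic 0.\<close>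

lemma galois_group_carrier:
  "carrier (galois_group p) = {\<sigma> \<in> Bij (root_field p). field_hom (root_field p) \<sigma>}"
proof -
  let ?L = "root_field p"
  note F = adjoin_subfield[of "complex_roots p"]
  have "\<sigma> \<in> ring_iso (splitting_field p) (splitting_field p) \<and> (\<forall>q. \<sigma> (of_rat q) = of_rat q)
    \<longleftrightarrow> field_hom ?L \<sigma>" if "\<sigma> \<in> Bij ?L" for \<sigma>
  proof -
    have ring: "splitting_field p = \<lparr>carrier = ?L, monoid.mult = (*), one = 1, ring.zero = 0, add = (+)\<rparr>"
      unfolding splitting_field_def generate_field_complex by (simp add: ring_of_type_algebra_def)
    have "bij_betw \<sigma> ?L ?L" using that by (simp add: Bij_def)
    moreover from this have "\<sigma> x \<in> ?L" if "x \<in> ?L" for x using that by (auto simp: bij_betw_def)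
    ultimately have "\<sigma> \<in> ring_iso (splitting_field p) (splitting_field p) \<longleftrightarrow> field_hom ?L \<sigma>"
      unfolding ring ring_iso_def ring_hom_def field_hom_def by auto
    then show ?thesis using field_hom_of_rat[OF F] by blast
  qed
  then show ?thesis by (auto simp: galois_group_def carrier_splitting_field)
qed

lemma galois_group_mult:
  assumes "\<sigma> \<in> carrier (galois_group p)" "\<tau> \<in> carrier (galois_group p)"
  shows "\<sigma> \<otimes>\<^bsub>galois_group p\<^esub> \<tau> = compose (root_field p) \<sigma> \<tau>"
  using assms unfolding galois_group_carrier
  by (simp add: galois_group_def carrier_splitting_field BijGroup_def)

lemma group_galois_group: "group (galois_group p)"
proof -
  let ?L = "root_field p"
  let ?B = "BijGroup ?L"
  let ?A = "{\<sigma> \<in> Bij ?L. field_hom ?L \<sigma>}"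
  note F = adjoin_subfield[of "complex_roots p"]
  note c = subfield_closed[OF F]
  have "galois_group p = ?B\<lparr>carrier := ?A\<rparr>"
    using galois_group_carrier[of p] by (simp add: galois_group_def carrier_splitting_field)
  moreover have "subgroup ?A ?B"
  proof (rule group.subgroupI[OF group_BijGroup])
    show "?A \<subseteq> carrier ?B" by (auto simp: BijGroup_def)
    have "(\<lambda>x\<in>?L. x) \<in> ?A"
      using id_Bij field_hom_cong[OF F field_hom_id, of "\<lambda>x\<in>?L. x"] by auto
    then show "?A \<noteq> {}" by blast
  next
    fix \<sigma> assume \<sigma>: "\<sigma> \<in> ?A"
    let ?i = "\<lambda>x\<in>?L. inv_into ?L \<sigma> x"
    have B: "\<sigma> \<in> Bij ?L" and h: "field_hom ?L \<sigma>" using \<sigma> by auto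
    have "inv_into ?L \<sigma> 1 = 1"
      using inv_into_f_f[of \<sigma> ?L 1] B c(1) field_hom_one[OF F h] by (auto simp: Bij_def bij_betw_def)
    moreover have "inv_into ?L \<sigma> (x + y) = inv_into ?L \<sigma> x + inv_into ?L \<sigma> y"
      if "x \<in> ?L" "y \<in> ?L" for x y
      using Bij_inv_into_lemma[of ?L \<sigma> "(+)", OF field_hom_add[OF F h] B _ that] c(7) by auto
    moreover have "inv_into ?L \<sigma> (x * y) = inv_into ?L \<sigma> x * inv_into ?L \<sigma> y"
      if "x \<in> ?L" "y \<in> ?L" for x y
      using Bij_inv_into_lemma[of ?L \<sigma> "(*)", OF field_hom_mult[OF F h] B _ that] c(4) by auto
    ultimately have "field_hom ?L ?i"
      unfolding field_hom_def using c(1,4,7) by simp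
    then show "inv\<^bsub>?B\<^esub> \<sigma> \<in> ?A"
      using restrict_inv_into_Bij[OF B] by (simp add: inv_BijGroup[OF B])
  next
    fix \<sigma> \<tau> assume \<sigma>: "\<sigma> \<in> ?A" and \<tau>: "\<tau> \<in> ?A"
    have "\<tau> x \<in> ?L" if "x \<in> ?L" for x using \<tau> that Bij_imp_funcset by auto
    then have "field_hom ?L (compose ?L \<sigma> \<tau>)"
      using \<sigma> \<tau> c(1,4,7) by (auto simp: field_hom_def compose_def)
    then show "\<sigma> \<otimes>\<^bsub>?B\<^esub> \<tau> \<in> ?A"
      using \<sigma> \<tau> compose_Bij[of \<sigma> ?L \<tau>] by (simp add: BijGroup_def)
  qed
  ultimately show ?thesis using group.subgroup_imp_group[OF group_BijGroup] by metis
qed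

lemma complex_roots_finite: "p \<noteq> 0 \<Longrightarrow> finite (complex_roots p)"
  unfolding complex_roots_def by (rule poly_roots_finite) (simp add: map_poly_eq_0_iff)

lemma hom_maps_roots:
  assumes "complex_subfield F" "field_hom F \<sigma>" "x \<in> F" "x \<in> complex_roots p"
  shows "\<sigma> x \<in> complex_roots p"
  using hom_root[OF assms(1-3), of p] field_hom_zero[OF assms(1,2)] assms(4) by (simp add: complex_roots_def)

text \<open>An embedding of a splitting field is automatically an automorphism, because it permutes
  the finitely many roots that generate the field.\<close>

lemma restrict_hom_in_galois_group:
  assumes "p \<noteq> 0" "complex_subfield F" "root_field p \<subseteq> F" "field_hom F \<sigma>"
  shows "restrict \<sigma> (root_field p) \<in> carrier (galois_group p)"
proof -
  let ?L = "root_field p" and ?S = "complex_roots p"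
  note L = adjoin_subfield[of ?S]
  have h: "field_hom ?L \<sigma>" using field_hom_subset assms by blast
  have "\<sigma> ` ?S \<subseteq> ?S" using hom_maps_roots[OF L h] adjoin_superset by blast
  moreover have inj: "inj_on \<sigma> ?L" by (rule field_hom_inj[OF L h])
  then have "inj_on \<sigma> ?S" using adjoin_superset inj_on_subset by blast
  ultimately have "\<sigma> ` ?S = ?S" using endo_inj_surj complex_roots_finite assms(1) by blast
  then have "\<sigma> ` ?L = ?L" using image_hom_adjoin[OF h] by simp
  then have "restrict \<sigma> ?L \<in> Bij ?L" using inj by (simp add: Bij_def bij_betw_def)
  moreover have "field_hom ?L (restrict \<sigma> ?L)" using field_hom_cong[OF L h] by simp
  ultimately show ?thesis unfolding galois_group_carrier by simp
qed

lemma
  assumes "\<sigma> \<in> carrier (galois_group p)"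
  shows galois_hom: "field_hom (root_field p) \<sigma>"
    and galois_root: "x \<in> complex_roots p \<Longrightarrow> \<sigma> x \<in> complex_roots p"
proof -
  show h: "field_hom (root_field p) \<sigma>" using assms unfolding galois_group_carrier by auto
  show "x \<in> complex_roots p \<Longrightarrow> \<sigma> x \<in> complex_roots p"
    using hom_maps_roots[OF adjoin_subfield h] adjoin_superset by blast
qed

text \<open>If the roots carry labels on which a group \<open>W\<close> acts faithfully, and every automorphism
  acts on the roots like an element of \<open>W\<close>, these elements form a copy of the Galois group
  inside \<open>W\<close>. With \<open>W\<close> a symmetric group this describes permutation groups of roots;
  with \<open>W\<close> a wreath product it exploits the structure of the roots.\<close>

definition galois_image ::
  "rat poly \<Rightarrow> 'i set \<Rightarrow> ('i \<Rightarrow> complex) \<Rightarrow> ('g, 'x) monoid_scheme \<Rightarrow> ('g \<Rightarrow> 'i \<Rightarrow> 'i) \<Rightarrow> 'g set" where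
  "galois_image p I lab W act =
     {g \<in> carrier W. \<exists>\<sigma> \<in> carrier (galois_group p). \<forall>i\<in>I. \<sigma> (lab i) = lab (act g i)}"

lemma
  fixes W (structure)
  assumes "group W"
    and lab: "bij_betw lab I (complex_roots p)"
    and act_in: "\<And>g i. g \<in> carrier W \<Longrightarrow> i \<in> I \<Longrightarrow> act g i \<in> I"
    and act_mult: "\<And>g h i. g \<in> carrier W \<Longrightarrow> h \<in> carrier W \<Longrightarrow> i \<in> I \<Longrightarrow> act (g \<otimes> h) i = act g (act h i)"
    and faithful: "\<And>g h. g \<in> carrier W \<Longrightarrow> h \<in> carrier W \<Longrightarrow> (\<And>i. i \<in> I \<Longrightarrow> act g i = act h i) \<Longrightarrow> g = h"
    and realise: "\<And>\<sigma>. \<sigma> \<in> carrier (galois_group p) \<Longrightarrow> \<exists>g\<in>carrier W. \<forall>i\<in>I. \<sigma> (lab i) = lab (act g i)"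
  shows galois_image_subgroup: "subgroup (galois_image p I lab W act) W"
    and galois_image_iso: "galois_group p \<cong> W\<lparr>carrier := galois_image p I lab W act\<rparr>"
proof -
  let ?G = "galois_group p" and ?L = "root_field p" and ?H = "galois_image p I lab W act"
  interpret W: group W by fact
  interpret G: group ?G by (rule group_galois_group)
  have inj_lab: "lab i = lab j \<longleftrightarrow> i = j" if "i \<in> I" "j \<in> I" for i j
    using lab that by (auto simp: bij_betw_def inj_on_def)
  have labL: "lab i \<in> ?L" if "i \<in> I" for i
    using that lab adjoin_superset by (auto simp: bij_betw_def)
  obtain \<Phi> where \<Phi>: "\<And>\<sigma>. \<sigma> \<in> carrier ?G \<Longrightarrow> \<Phi> \<sigma> \<in> carrier W"
    "\<And>\<sigma> i. \<sigma> \<in> carrier ?G \<Longrightarrow> i \<in> I \<Longrightarrow> \<sigma> (lab i) = lab (act (\<Phi> \<sigma>) i)"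
    using realise by metis
  have hom: "\<Phi> \<in> hom ?G W"
  proof (rule homI)
    fix \<sigma> \<tau> assume s: "\<sigma> \<in> carrier ?G" "\<tau> \<in> carrier ?G"
    let ?r = "\<sigma> \<otimes>\<^bsub>?G\<^esub> \<tau>"
    show "\<Phi> ?r = \<Phi> \<sigma> \<otimes> \<Phi> \<tau>"
    proof (rule faithful)
      fix i assume i: "i \<in> I"
      have "lab (act (\<Phi> ?r) i) = ?r (lab i)" using \<Phi>(2)[OF _ i] s by simp
      also have "\<dots> = \<sigma> (\<tau> (lab i))" using galois_group_mult[OF s] labL[OF i] by (simp add: compose_def)
      also have "\<dots> = lab (act (\<Phi> \<sigma> \<otimes> \<Phi> \<tau>) i)" using \<Phi> s i act_in act_mult by simp
      finally show "act (\<Phi> ?r) i = act (\<Phi> \<sigma> \<otimes> \<Phi> \<tau>) i"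
        using inj_lab act_in i \<Phi>(1) s by simp
    qed (use s \<Phi>(1) in auto)
  qed (rule \<Phi>(1))
  have img: "\<Phi> ` carrier ?G = ?H"
  proof
    show "\<Phi> ` carrier ?G \<subseteq> ?H" unfolding galois_image_def using \<Phi> by blast
    show "?H \<subseteq> \<Phi> ` carrier ?G"
    proof
      fix g assume "g \<in> ?H"
      then obtain \<sigma> where g: "g \<in> carrier W" "\<sigma> \<in> carrier ?G" "\<forall>i\<in>I. \<sigma> (lab i) = lab (act g i)"
        unfolding galois_image_def by blast
      have "g = \<Phi> \<sigma>"
      proof (rule faithful)
        fix i assume i: "i \<in> I"
        have "lab (act g i) = lab (act (\<Phi> \<sigma>) i)" using g(3) \<Phi>(2)[OF g(2) i] i by simp
        then show "act g i = act (\<Phi> \<sigma>) i" using inj_lab act_in i g(1) \<Phi>(1)[OF g(2)] by simp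
      qed (use g \<Phi> in auto)
      then show "g \<in> \<Phi> ` carrier ?G" using g by blast
    qed
  qed
  have inj: "inj_on \<Phi> (carrier ?G)"
  proof (rule inj_onI)
    fix \<sigma> \<tau> assume s: "\<sigma> \<in> carrier ?G" "\<tau> \<in> carrier ?G" "\<Phi> \<sigma> = \<Phi> \<tau>"
    have "\<sigma> z = \<tau> z" if z: "z \<in> complex_roots p" for z
    proof -
      obtain i where "i \<in> I" "z = lab i" using z lab by (auto simp: bij_betw_def)
      then show ?thesis using \<Phi>(2)[OF s(1)] \<Phi>(2)[OF s(2)] s(3) by simp
    qed
    then have "\<sigma> z = \<tau> z" if "z \<in> ?L" for z
      using hom_eq_on_adjoin[OF adjoin_subfield adjoin_superset galois_hom galois_hom] s that by blast
    then show "\<sigma> = \<tau>"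
      using s unfolding galois_group_carrier by (auto intro: extensionalityI simp: Bij_def)
  qed
  interpret group_hom ?G W \<Phi> using hom by unfold_locales
  show "subgroup ?H W" using img_is_subgroup img by simp
  have "\<Phi> \<in> iso ?G (W\<lparr>carrier := ?H\<rparr>)"
    using hom inj img by (auto simp: iso_def hom_def bij_betw_def)
  then show "?G \<cong> W\<lparr>carrier := ?H\<rparr>" by (rule is_isoI)
qed

text \<open>Any labelling of the roots may be used: the permutation group is transitive because the Galois
  group is, and it is isomorphic to the Galois group by the preceding lemma.\<close>

lemma galois_typeI:
  assumes p: "p \<noteq> 0" and card: "card (complex_roots p) = n"
    and trans: "\<And>x y. x \<in> complex_roots p \<Longrightarrow> y \<in> complex_roots p \<Longrightarrow> \<exists>\<sigma>\<in>carrier (galois_group p). \<sigma> x = y"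
    and iso: "galois_group p \<cong> G"
  shows "galois_type p n (transitive_class n G)"
proof -
  let ?I = "{1..n}"
  obtain \<beta> where \<beta>: "bij_betw \<beta> ?I (complex_roots p)"
    using complex_roots_finite[OF p] card finite_same_card_bij[of ?I] by auto
  note inj = bij_betw_imp_inj_on[OF \<beta>] and rng = bij_betw_imp_surj_on[OF \<beta>]
  let ?H = "galois_perms p n \<beta>"
  have real: "\<exists>\<pi>\<in>carrier (sym_group n). \<forall>i\<in>?I. \<sigma> (\<beta> i) = \<beta> (\<pi> i)"
    if \<sigma>: "\<sigma> \<in> carrier (galois_group p)" for \<sigma>
  proof -
    \<comment> \<open>Outside the index set a permutation has to be the identity.\<close>
    define \<pi> where "\<pi> i = (if i \<in> ?I then inv_into ?I \<beta> (\<sigma> (\<beta> i)) else i)" for i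
    have \<pi>: "\<pi> i \<in> ?I \<and> \<beta> (\<pi> i) = \<sigma> (\<beta> i)" if "i \<in> ?I" for i
    proof -
      have "\<sigma> (\<beta> i) \<in> \<beta> ` ?I" using galois_root[OF \<sigma>] rng that by blast
      then show ?thesis using that by (simp only: \<pi>_def if_True inv_into_into f_inv_into_f)
    qed
    have "inj_on \<pi> ?I"
    proof (rule inj_onI)
      fix i j assume ij: "i \<in> ?I" "j \<in> ?I" "\<pi> i = \<pi> j"
      then have "\<sigma> (\<beta> i) = \<sigma> (\<beta> j)" using \<pi> by metis
      moreover have "\<beta> i \<in> root_field p" "\<beta> j \<in> root_field p" using ij rng adjoin_superset by blast+
      ultimately have "\<beta> i = \<beta> j"
        using field_hom_inj[OF adjoin_subfield galois_hom[OF \<sigma>]] by (auto dest: inj_onD)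
      then show "i = j" using inj ij by (auto dest: inj_onD)
    qed
    moreover have "\<pi> ` ?I \<subseteq> ?I" using \<pi> by blast
    ultimately have "bij_betw \<pi> ?I ?I" using endo_inj_surj[of ?I \<pi>] by (simp add: bij_betw_def)
    then have "\<pi> permutes ?I" by (rule bij_imp_permutes) (simp add: \<pi>_def del: atLeastAtMost_iff)
    then show ?thesis using \<pi> by (intro bexI[of _ \<pi>]) (auto simp: sym_group_carrier)
  qed
  have H: "?H = galois_image p ?I \<beta> (sym_group n) (\<lambda>\<pi>. \<pi>)"
    unfolding galois_perms_def galois_image_def sym_group_carrier
    by (intro Collect_cong conj_cong bex_cong ball_cong refl eq_commute)
  have perm_in: "\<pi> i \<in> ?I" if "\<pi> \<in> carrier (sym_group n)" "i \<in> ?I" for \<pi> i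
    using that permutes_in_image[of \<pi> ?I i] by (simp only: sym_group_carrier)
  have perm_eq: "\<pi> = \<rho>" if "\<pi> \<in> carrier (sym_group n)" "\<rho> \<in> carrier (sym_group n)" "\<And>i. i \<in> ?I \<Longrightarrow> \<pi> i = \<rho> i" for \<pi> \<rho>
  proof
    fix i show "\<pi> i = \<rho> i"
      using that unfolding sym_group_carrier by (metis permutes_not_in)
  qed
  have sub: "subgroup ?H (sym_group n)" and isoH: "galois_group p \<cong> sym_group n\<lparr>carrier := ?H\<rparr>"
  proof -
    have mult: "(\<pi> \<otimes>\<^bsub>sym_group n\<^esub> \<rho>) i = \<pi> (\<rho> i)" for \<pi> \<rho> i by (simp add: sym_group_mult)
    show "subgroup ?H (sym_group n)" unfolding H
      by (rule galois_image_subgroup[OF sym_group_is_group \<beta>];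
          (rule perm_in | rule mult | rule perm_eq | rule real); blast)
    show "galois_group p \<cong> sym_group n\<lparr>carrier := ?H\<rparr>" unfolding H
      by (rule galois_image_iso[OF sym_group_is_group \<beta>];
          (rule perm_in | rule mult | rule perm_eq | rule real); blast)
  qed
  have "\<exists>\<pi>\<in>?H. \<pi> i = j" if ij: "i \<in> ?I" "j \<in> ?I" for i j
  proof -
    obtain \<sigma> where \<sigma>: "\<sigma> \<in> carrier (galois_group p)" "\<sigma> (\<beta> i) = \<beta> j"
      using trans[of "\<beta> i" "\<beta> j"] ij rng by blast
    obtain \<pi> where \<pi>: "\<pi> \<in> carrier (sym_group n)" "\<forall>i\<in>?I. \<sigma> (\<beta> i) = \<beta> (\<pi> i)" using real[OF \<sigma>(1)] by blast
    from this have "\<pi> i = j" using \<sigma>(2) ij inj perm_in[OF \<pi>(1) ij(1)] by (metis inj_onD)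
    moreover have "\<pi> \<in> ?H" unfolding H galois_image_def using \<pi> \<sigma>(1) by blast
    ultimately show ?thesis by blast
  qed
  moreover have "sym_group n\<lparr>carrier := ?H\<rparr> \<cong> G"
    using iso_trans[OF group.iso_sym[OF group_galois_group isoH] iso] .
  ultimately show ?thesis
    unfolding galois_type_def transitive_class_def using \<beta> sub by blast
qed

section \<open>A wreath product and its transitive subgroups\<close>

text \<open>The third component has type \<open>bit\<close>: a one exchanges the two coordinates of the factor to its
  right. The points \<open>(u, i)\<close> of the action below stand for the root \<open>u \<gamma>\<^sub>i\<close> where \<open>\<gamma>\<^sub>0, \<gamma>\<^sub>1\<close> represent the
  two orbits. The first two components belong to the target orbit: \<open>(v, w, s)\<close> sends \<open>\<gamma>\<^sub>i\<close> to
  \<open>v \<gamma>\<^sub>0\<close> if \<open>i + s = 0\<close> and to \<open>w \<gamma>\<^sub>1\<close> otherwise.\<close>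

definition wreath :: "('v::ab_group_add \<times> 'v \<times> bit) monoid" where
  "wreath = \<lparr>carrier = UNIV,
     monoid.mult = (\<lambda>(v, w, s) (v', w', s').
       if s = 0 then (v + v', w + w', s + s') else (v + w', w + v', s + s')),
     one = (0, 0, 0)\<rparr>"

definition wreath_act :: "('v::ab_group_add \<times> 'v \<times> bit) \<Rightarrow> 'v \<times> bit \<Rightarrow> 'v \<times> bit" where
  "wreath_act = (\<lambda>(v, w, s) (u, i). (u + (if i + s = 0 then v else w), i + s))"

lemma wreath_simps [simp]:
  "carrier wreath = UNIV" "\<one>\<^bsub>wreath\<^esub> = (0, 0, 0)"
  "(v, w, 0) \<otimes>\<^bsub>wreath\<^esub> (v', w', s') = (v + v', w + w', s')"
  "(v, w, 1) \<otimes>\<^bsub>wreath\<^esub> (v', w', s') = (v + w', w + v', 1 + s')"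
  by (simp_all add: wreath_def)

lemma group_wreath: "group (wreath :: ('v::ab_group_add \<times> 'v \<times> bit) monoid)"
proof (rule groupI)
  fix x y z :: "'v \<times> 'v \<times> bit"
  obtain v w s v' w' s' v'' w'' s'' where [simp]: "x = (v, w, s)" "y = (v', w', s')" "z = (v'', w'', s'')"
    by (metis prod_cases3)
  show "x \<otimes>\<^bsub>wreath\<^esub> y \<otimes>\<^bsub>wreath\<^esub> z = x \<otimes>\<^bsub>wreath\<^esub> (y \<otimes>\<^bsub>wreath\<^esub> z)"
    by (cases s; cases s'; cases s'') (simp_all add: add.assoc)
  show "\<one>\<^bsub>wreath\<^esub> \<otimes>\<^bsub>wreath\<^esub> x = x" by simp
  have "(if s = 0 then (-v, -w, 0) else (-w, -v, 1)) \<otimes>\<^bsub>wreath\<^esub> x = \<one>\<^bsub>wreath\<^esub>"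
    by (cases s) simp_all
  then show "\<exists>y\<in>carrier wreath. y \<otimes>\<^bsub>wreath\<^esub> x = \<one>\<^bsub>wreath\<^esub>"
    by (rule bexI) simp
qed simp_all

lemma wreath_act_mult: "wreath_act (g \<otimes>\<^bsub>wreath\<^esub> h) i = wreath_act g (wreath_act h i)"
proof -
  obtain v w s v' w' s' u j where [simp]: "g = (v, w, s)" "h = (v', w', s')" "i = (u, j)"
    by (metis prod_cases3 surj_pair)
  show ?thesis
    by (cases s; cases s'; cases j) (simp_all add: wreath_act_def algebra_simps)
qed

lemma wreath_act_faithful:
  assumes "\<And>i. wreath_act g i = wreath_act h i"
  shows "g = h"
proof -
  obtain v w s v' w' s' where [simp]: "g = (v, w, s)" "h = (v', w', s')"
    by (metis prod_cases3)
  show ?thesis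
    using assms[of "(0, 0)"] assms[of "(0, 1)"]
    by (cases s; cases s') (simp_all add: wreath_act_def)
qed

text \<open>Klein's four-group \<open>V\<close> is \<open>bit \<times> bit\<close>; the first bit will be the sign and the second one
  inversion.\<close>

lemma add_self_V [simp]: "(v :: bit \<times> bit) + v = 0" "v + (v + w) = w"
  and minus_V [simp]: "- v = v"
proof -
  show *: "v + v = 0" for v :: "bit \<times> bit"
    by (cases v; cases "fst v"; cases "snd v") (auto simp: zero_prod_def)
  show "v + (v + w) = w" by (simp add: * flip: add.assoc)
  show "- v = v" using * by (metis add_eq_0_iff)
qed

lemma add_eq_0_V: "v + w = 0 \<longleftrightarrow> w = (v :: bit \<times> bit)"
  by (metis add_self_V)

definition transitive_subgroup :: "('v::ab_group_add \<times> 'v \<times> bit) set \<Rightarrow> bool" where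
  "transitive_subgroup H \<longleftrightarrow> subgroup H wreath \<and> (\<forall>i j. \<exists>h\<in>H. wreath_act h i = j)"

text \<open>The group \<open>D\<close> of the introduction.\<close>

definition block_sums :: "('v::ab_group_add \<times> 'v \<times> bit) set \<Rightarrow> 'v set" where
  "block_sums H = {v + w |v w. (v, w, 0) \<in> H}"

lemma block_sumsI: "(v, w, 0) \<in> H \<Longrightarrow> v + w \<in> block_sums H"
  unfolding block_sums_def by blast

lemma
  assumes "transitive_subgroup H"
  shows trans_base: "\<exists>w. (v, w, 0) \<in> H"
    and trans_swap: "\<exists>x y. (x, y, 1) \<in> H"
    and trans_mult: "g \<in> H \<Longrightarrow> h \<in> H \<Longrightarrow> g \<otimes>\<^bsub>wreath\<^esub> h \<in> H"
    and trans_zero: "(0, 0, 0) \<in> H"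
proof -
  have tr: "\<exists>h\<in>H. wreath_act h i = j" and sub: "subgroup H wreath" for i j
    using assms unfolding transitive_subgroup_def by blast+
  from tr[of "(0, 0)" "(v, 0)"] obtain a b c where "(a, b, c) \<in> H" "wreath_act (a, b, c) (0, 0) = (v, 0)"
    by (metis prod_cases3)
  then show "\<exists>w. (v, w, 0) \<in> H" by (auto simp: wreath_act_def)
  from tr[of "(0, 0)" "(0, 1)"] obtain a b c where "(a, b, c) \<in> H" "wreath_act (a, b, c) (0, 0) = (0, 1)"
    by (metis prod_cases3)
  then show "\<exists>x y. (x, y, 1) \<in> H" by (auto simp: wreath_act_def)
  show "g \<in> H \<Longrightarrow> h \<in> H \<Longrightarrow> g \<otimes>\<^bsub>wreath\<^esub> h \<in> H" using subgroup.m_closed[OF sub] .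
  show "(0, 0, 0) \<in> H" using subgroup.one_closed[OF sub] by simp
qed

lemma
  fixes H :: "((bit \<times> bit) \<times> (bit \<times> bit) \<times> bit) set"
  assumes H: "transitive_subgroup H"
  shows trans_add: "(v, w, 0) \<in> H \<Longrightarrow> (v', w', s) \<in> H \<Longrightarrow> (v + v', w + w', s) \<in> H"
    and trans_swap_base: "(v, w, 0) \<in> H \<Longrightarrow> (w, v, 0) \<in> H"
    and trans_square: "(x, y, 1) \<in> H \<Longrightarrow> (x + y, x + y, 0) \<in> H"
    and trans_coset: "(x, y, 1) \<in> H \<Longrightarrow> (v, w, 1) \<in> H \<longleftrightarrow> (v + x, w + y, 0) \<in> H"
    and trans_diag: "d \<in> block_sums H \<Longrightarrow> (d, d, 0) \<in> H"
proof -
  note m = trans_mult[OF H]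
  show add: "(v, w, 0) \<in> H \<Longrightarrow> (v', w', s) \<in> H \<Longrightarrow> (v + v', w + w', s) \<in> H" for v w v' w' s
    using m[of "(v, w, 0)" "(v', w', s)"] by simp
  show sq: "(x, y, 1) \<in> H \<Longrightarrow> (x + y, x + y, 0) \<in> H" for x y
    using m[of "(x, y, 1)" "(x, y, 1)"] by (simp add: add.commute)
  have inv: "(y, x, 1) \<in> H" if "(x, y, 1) \<in> H" for x y
    using add[OF sq[OF that] that] by (simp add: ac_simps)
  show swap: "(v, w, 0) \<in> H \<Longrightarrow> (w, v, 0) \<in> H" for v w
  proof -
    assume vw: "(v, w, 0) \<in> H"
    obtain x y where xy: "(x, y, 1) \<in> H" using trans_swap[OF H] by blast
    have "(x, y, 1) \<otimes>\<^bsub>wreath\<^esub> (v, w, 0) \<otimes>\<^bsub>wreath\<^esub> (y, x, 1) \<in> H"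
      using m[OF m[OF xy vw] inv[OF xy]] .
    then show "(w, v, 0) \<in> H" by (simp add: ac_simps)
  qed
  show "(v, w, 1) \<in> H \<longleftrightarrow> (v + x, w + y, 0) \<in> H" if xy: "(x, y, 1) \<in> H" for x y
  proof
    assume "(v, w, 1) \<in> H"
    then show "(v + x, w + y, 0) \<in> H" using m[OF _ inv[OF xy], of "(v, w, 1)"] by simp
  next
    assume "(v + x, w + y, 0) \<in> H"
    from add[OF this xy] show "(v, w, 1) \<in> H" by (simp add: add.assoc)
  qed
  show "(d, d, 0) \<in> H" if d: "d \<in> block_sums H"
  proof -
    obtain v w where vw: "d = v + w" "(v, w, 0) \<in> H" using d unfolding block_sums_def by blast
    from add[OF vw(2) swap[OF vw(2)]] show ?thesis by (simp add: vw(1) add.commute)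
  qed
qed

text \<open>The linear map that sends the standard basis to \<open>k, l\<close>.\<close>

definition combination :: "bit \<times> bit \<Rightarrow> bit \<times> bit \<Rightarrow> bit \<times> bit \<Rightarrow> bit \<times> bit" where
  "combination k l v = (if fst v = 1 then k else 0) + (if snd v = 1 then l else 0)"

lemma combination_simps [simp]:
  "combination k l (v + w) = combination k l v + combination k l w"
  "combination k l 0 = 0" "combination k l (1, 0) = k" "combination k l (0, 1) = l"
proof -
  show "combination k l (v + w) = combination k l v + combination k l w"
    by (cases "fst v"; cases "snd v"; cases "fst w"; cases "snd w")
      (simp_all add: combination_def ac_simps)
qed (simp_all add: combination_def)

lemma bij_combination:
  assumes "k \<noteq> 0" "l \<noteq> 0" "l \<noteq> k"
  shows "bij (combination k l)"
proof -
  have inj: "v = 0" if "combination k l v = 0" for v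
  proof -
    obtain k1 k2 l1 l2 v1 v2 where "k = (k1, k2)" "l = (l1, l2)" "v = (v1, v2)" by (metis surj_pair)
    then show ?thesis
      using assms that
      by (cases k1; cases k2; cases l1; cases l2; cases v1; cases v2)
        (auto simp: combination_def zero_prod_def)
  qed
  have "inj (combination k l)"
  proof (rule injI)
    fix v w assume "combination k l v = combination k l w"
    then have "combination k l (v + w) = 0" by simp
    then show "v = w" using inj add_eq_0_V by metis
  qed
  moreover have "finite (UNIV :: (bit \<times> bit) set)"
  proof -
    have "(UNIV :: bit set) = {0, 1}" using bit.exhaust by auto
    then have "finite (UNIV :: bit set)" by (metis finite.emptyI finite_insert)
    then show ?thesis by (simp flip: UNIV_Times_UNIV)
  qed
  ultimately show ?thesis by (simp add: finite_UNIV_inj_surj bij_def)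
qed

text \<open>A choice of basis \<open>k, l\<close> of \<open>V\<close> induces an automorphism of the wreath product, which is composed
  here with conjugation by \<open>(x, 0, 0)\<close>. That moves the standard element \<open>(0, c, 1)\<close> to
  \<open>(x, x + c', 1)\<close>, where \<open>c'\<close> is the image of \<open>c\<close>. So it suffices to identify one standard subgroup
  \<open>S\<close> in each orbit of these automorphisms, and to compare the elements that do not exchange the
  blocks.\<close>

lemma change_basis_iso:
  assumes H: "transitive_subgroup H" and kl: "k \<noteq> 0" "l \<noteq> 0" "l \<noteq> k"
    and base: "\<And>v w. (v, w, 0) \<in> S \<longleftrightarrow> (combination k l v, combination k l w, 0) \<in> H"
    and coset: "\<And>v w. (v, w, 1) \<in> S \<longleftrightarrow> (v, w + c, 0) \<in> S"
    and swap: "(x, x + combination k l c, 1) \<in> H"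
    and iso: "wreath\<lparr>carrier := S\<rparr> \<cong> G"
  shows "wreath\<lparr>carrier := H\<rparr> \<cong> G"
proof -
  let ?c = "combination k l"
  define F where "F = (\<lambda>(v, w, s :: bit). if s = 0 then (?c v, ?c w, 0::bit) else (?c v + x, ?c w + x, 1))"
  have F: "F p \<in> H \<longleftrightarrow> p \<in> S" for p
  proof -
    obtain v w s where p: "p = (v, w, s)" by (metis prod_cases3)
    show ?thesis
    proof (cases "s = 0")
      case True
      then show ?thesis using base by (simp add: p F_def)
    next
      case False
      have "F p \<in> H \<longleftrightarrow> (?c v, ?c (w + c), 0) \<in> H"
        using trans_coset[OF H swap] False by (simp add: p F_def ac_simps)
      then show ?thesis using coset base False by (simp add: p)
    qed
  qed
  have F_mult: "F (p \<otimes>\<^bsub>wreath\<^esub> q) = F p \<otimes>\<^bsub>wreath\<^esub> F q" for p q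
  proof -
    obtain v w s v' w' s' where pq: "p = (v, w, s)" "q = (v', w', s')" by (metis prod_cases3)
    show ?thesis by (cases s; cases s') (simp_all add: pq F_def ac_simps)
  qed
  note bij = bij_combination[OF kl]
  have "inj F"
    by (rule injI) (use bij_is_inj[OF bij] in \<open>auto simp: F_def inj_def split: if_splits\<close>)
  moreover have "surj F"
    unfolding surj_def
  proof
    fix q :: "(bit \<times> bit) \<times> (bit \<times> bit) \<times> bit"
    obtain v w s where q: "q = (v, w, s)" by (metis prod_cases3)
    obtain v' w' where "?c v' = (if s = 0 then v else v + x)" "?c w' = (if s = 0 then w else w + x)"
      using bij_is_surj[OF bij] by (metis surjD)
    then have "F (v', w', s) = q" by (cases s) (simp_all add: q F_def ac_simps)
    then show "\<exists>p. q = F p" by blast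
  qed
  moreover have "F ` S = H"
  proof (intro equalityI subsetI)
    fix h assume h: "h \<in> H"
    obtain p where p: "h = F p" using \<open>surj F\<close> by blast
    then show "h \<in> F ` S" using h F[of p] by simp
  qed (use F in blast)
  ultimately have bij_F: "bij_betw F S H"
    unfolding bij_betw_def by (blast intro: inj_on_subset)
  then have bij_inv: "bij_betw (inv_into S F) H S" by (rule bij_betw_inv_into)
  have "inv_into S F (g \<otimes>\<^bsub>wreath\<^esub> h) = inv_into S F g \<otimes>\<^bsub>wreath\<^esub> inv_into S F h"
    if gh: "g \<in> H" "h \<in> H" for g h
  proof -
    obtain p q where pq: "p \<in> S" "q \<in> S" "g = F p" "h = F q"
      using bij_F gh unfolding bij_betw_def by blast
    then have "p \<otimes>\<^bsub>wreath\<^esub> q \<in> S" using trans_mult[OF H gh] F F_mult by metis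
    then show ?thesis
      using bij_F pq inv_into_f_f[of F S] by (simp add: bij_betw_def flip: F_mult)
  qed
  then have "inv_into S F \<in> iso (wreath\<lparr>carrier := H\<rparr>) (wreath\<lparr>carrier := S\<rparr>)"
    using bij_inv by (auto simp: iso_def hom_def bij_betw_def)
  then show ?thesis using iso_trans[OF is_isoI iso] by blast
qed

section \<open>The abstract groups inside the wreath product\<close>

text \<open>Keep \<open>bit\<close> as a field: rewriting its operations to Boolean connectives would hide the linear
  algebra.\<close>

declare add_bit_eq_xor [simp del] mult_bit_eq_and [simp del]

lemma bit_add_self [simp]: "(a :: bit) + a = 0" "a + (a + b) = b"
  by (cases a; cases b; simp)+

lemma carrier_C2: "x \<in> carrier C2 \<longleftrightarrow> x = 0 \<or> x = 1"
  and carrier_C4: "x \<in> carrier C4 \<longleftrightarrow> x = 0 \<or> x = 1 \<or> x = 2 \<or> x = 3"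
  by (auto simp: carrier_integer_mod_group)

lemma inv_C4: "x = 0 \<or> x = 1 \<or> x = 2 \<or> x = 3 \<Longrightarrow> m_inv C4 x = (- x) mod 4"
  by (simp add: carrier_C4)

text \<open>The target groups consist of integers; \<open>residue\<close> and \<open>of_int\<close> translate between bits and residues
  modulo 2.\<close>

definition residue :: "bit \<Rightarrow> int" where
  "residue b = (if b = 0 then 0 else 1)"

lemma residue_simps [simp]: "residue 0 = 0" "residue 1 = 1"
  by (simp_all add: residue_def)

lemmas target_simps = carrier_C2 carrier_C4 inv_C4 E4_def D4_def E4_semidirect_C4_def E4_wreath_C2_def
  semidirect_def

lemma wreath_isoI:
  assumes "\<And>p. p \<in> S \<Longrightarrow> f p \<in> carrier G" "\<And>g. g \<in> carrier G \<Longrightarrow> f' g \<in> S"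
    and "\<And>p. p \<in> S \<Longrightarrow> f' (f p) = p" "\<And>g. g \<in> carrier G \<Longrightarrow> f (f' g) = g"
    and "\<And>p q. p \<in> S \<Longrightarrow> q \<in> S \<Longrightarrow> f (p \<otimes>\<^bsub>wreath\<^esub> q) = f p \<otimes>\<^bsub>G\<^esub> f q"
  shows "wreath\<lparr>carrier := S\<rparr> \<cong> G"
proof -
  have "bij_betw f S (carrier G)"
    using assms(1-4) by (intro bij_betw_byWitness[where f' = f']) auto
  then have "f \<in> iso (wreath\<lparr>carrier := S\<rparr>) G"
    using assms(1,5) by (auto simp: iso_def hom_def)
  then show ?thesis by (rule is_isoI)
qed

lemma residue_add: "residue (a + b) = (residue a + residue b) mod 2"
  by (cases a; cases b) simp_all

lemma residue_of_int: "x = 0 \<or> x = 1 \<Longrightarrow> residue (of_int x) = x"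
  by auto

lemma of_int_residue: "of_int (residue b) = b"
  by (cases b) simp_all

lemma residue_mod: "residue b mod 2 = residue b"
  by (cases b) simp_all

lemma residue_iff: "residue b = 0 \<longleftrightarrow> b = 0" "residue b = 1 \<longleftrightarrow> b = 1"
  by (cases b; simp)+

lemmas residue_rules = residue_mod residue_add residue_of_int of_int_residue residue_iff

lemma std_wreath:
  "wreath\<lparr>carrier := UNIV :: ((bit \<times> bit) \<times> (bit \<times> bit) \<times> bit) set\<rparr> \<cong> E4_wreath_C2"
proof (rule wreath_isoI[where
    f = "\<lambda>((v1, v2), (w1, w2), s). (((residue v1, residue v2), (residue w1, residue w2)), residue s)" and
    f' = "\<lambda>(((v1, v2), (w1, w2)), s). ((of_int v1, of_int v2), (of_int w1, of_int w2), of_int s)"], goal_cases)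
  case (5 p q)
  obtain v1 v2 w1 w2 s v1' v2' w1' w2' s'
    where "p = ((v1, v2), (w1, w2), s)" "q = ((v1', v2'), (w1', w2'), s')" by (metis surj_pair)
  then show ?case by (cases s) (simp_all add: target_simps residue_rules)
qed (auto simp: target_simps residue_rules)

text \<open>The factor \<open>C\<^sub>4\<close> is generated by \<open>\<tau> = (0, (0, 1), 1)\<close>, with \<open>\<tau>\<^sup>2 = ((0, 1), (0, 1), 0)\<close>; the first
  bits of the two blocks form the normal subgroup. An element with second bits \<open>v2, w2\<close> has
  \<open>C\<^sub>4\<close>-component \<open>s + 2 v2\<close>.\<close>

lemma std_semidirect:
  "wreath\<lparr>carrier := {((v1 :: bit, v2), (w1, w2), s). w2 = v2 + s}\<rparr> \<cong> E4_semidirect_C4"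
proof (rule wreath_isoI[where
    f = "\<lambda>((v1, v2), (w1, w2), s). ((residue v1, residue w1), residue s + 2 * residue v2)" and
    f' = "\<lambda>((i, j), h). ((of_int i, of_int (h div 2)), (of_int j, of_int ((h + 1) div 2)), of_int h)"], goal_cases)
  case (5 p q)
  then obtain v1 v2 w1 s v1' v2' w1' s'
    where "p = ((v1, v2), (w1, v2 + s), s)" "q = ((v1', v2'), (w1', v2' + s'), s')"
    by auto
  then show ?case
    by (cases s; cases s'; cases v2; cases v2')
      (simp_all add: target_simps residue_rules numeral_2_eq_2 numeral_3_eq_3)
next
  case (1 p)
  then obtain v1 v2 w1 s where "p = ((v1, v2), (w1, v2 + s), s)" by auto
  then show ?case by (cases s; cases v2) (simp_all add: target_simps residue_def)
next
  case (3 p)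
  then obtain v1 v2 w1 s where "p = ((v1, v2), (w1, v2 + s), s)" by auto
  then show ?case by (cases s; cases v2) (simp_all add: target_simps residue_rules)
qed (auto simp: target_simps residue_rules)

text \<open>The wreath product of \<open>C\<^sub>2\<close> by \<open>C\<^sub>2\<close> is dihedral: the rotation is \<open>\<rho> = (1, 0, 1)\<close> with
  \<open>\<rho>\<^sup>2 = (1, 1, 0)\<close> and \<open>\<rho>\<^sup>3 = (0, 1, 1)\<close>, the reflection is the swap \<open>(0, 0, 1)\<close>. The map gives the
  exponents \<open>i, h\<close> of \<open>\<rho>\<^sup>i (0, 0, 1)\<^sup>h\<close>.\<close>

definition dihedral :: "bit \<times> bit \<times> bit \<Rightarrow> int \<times> int" where
  "dihedral = (\<lambda>(v, w, s). (if w = 0 then residue v else 3 - residue v, residue (s + v + w)))"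

definition dihedral_inv :: "int \<times> int \<Rightarrow> bit \<times> bit \<times> bit" where
  "dihedral_inv = (\<lambda>(i, h). (of_int ((i + 1) div 2), of_int (i div 2), of_int (i + h)))"

lemma dihedral_in: "dihedral (v, w, s) \<in> carrier D4"
  and dihedral_inv: "dihedral_inv (dihedral (v, w, s)) = (v, w, s)"
  by (cases v; cases w; cases s; simp add: target_simps dihedral_def dihedral_inv_def)+

lemma dihedral_surj: "g \<in> carrier D4 \<Longrightarrow> dihedral (dihedral_inv g) = g"
  by (auto simp: target_simps dihedral_def dihedral_inv_def)

lemma dihedral_mult:
  "dihedral ((v, w, s) \<otimes>\<^bsub>wreath\<^esub> (v', w', s')) = dihedral (v, w, s) \<otimes>\<^bsub>D4\<^esub> dihedral (v', w', s')"
  by (cases v; cases w; cases s; cases v'; cases w'; cases s') (simp_all add: target_simps dihedral_def)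

lemma std_D4: "wreath\<lparr>carrier := UNIV :: (bit \<times> bit \<times> bit) set\<rparr> \<cong> D4"
  by (rule wreath_isoI[where f = dihedral and f' = dihedral_inv])
    (auto simp: dihedral_in dihedral_inv dihedral_surj dihedral_mult)

lemma std_C2_D4:
  "wreath\<lparr>carrier := {((v1 :: bit, v2), (w1, w2), s :: bit). v2 = (w2 :: bit)}\<rparr> \<cong> C2 \<times>\<times> D4"
proof (rule wreath_isoI[where
    f = "\<lambda>((v, n), (w, _), s). (residue n, dihedral (v, w, s))" and
    f' = "\<lambda>(n, g). case dihedral_inv g of (v, w, s) \<Rightarrow> ((v, of_int n), (w, of_int n), s)"], goal_cases)
  case (4 g)
  then obtain n i h where g: "g = (n, (i, h))" "n \<in> carrier C2" "(i, h) \<in> carrier D4" by auto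
  obtain v w s where d: "dihedral_inv (i, h) = (v, w, s)" by (metis surj_pair)
  show ?case using g d dihedral_surj[OF g(3)] by (auto simp: carrier_C2)
next
  case (5 p q)
  then obtain v n w s v' n' w' s' where "p = ((v, n), (w, n), s)" "q = ((v', n'), (w', n'), s')" by auto
  then show ?case
    using dihedral_mult[of v w s v' w' s'] by (cases s) (simp_all add: residue_rules)
next
  case (3 p)
  then show ?case by (auto simp: dihedral_inv residue_rules)
qed (auto simp: dihedral_in carrier_C2 residue_rules split: prod.splits)

text \<open>Here the rotation is \<open>((0, 1), (1, 1), 1)\<close> with square \<open>((1, 0), (1, 0), 0)\<close>, the reflection again
  the swap.\<close>

lemma std_D4_diagonal:
  "wreath\<lparr>carrier := {((v1, v2), w, s :: bit). w = (v1 + v2, v2 :: bit)}\<rparr> \<cong> D4"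
proof (rule wreath_isoI[where
    f = "\<lambda>((v1, v2), w, s). (2 * residue v1 + residue v2, residue (v2 + s))" and
    f' = "\<lambda>(i, h). ((of_int (i div 2), of_int i), (of_int (i div 2 + i), of_int i), of_int (i + h))"], goal_cases)
  case (5 p q)
  then obtain v1 v2 s v1' v2' s' where "p = ((v1, v2), (v1 + v2, v2), s)" "q = ((v1', v2'), (v1' + v2', v2'), s')"
    by auto
  then show ?case
    by (cases v1; cases v2; cases s; cases v1'; cases v2'; cases s') (simp_all add: target_simps zero_prod_def)
next
  case (1 p)
  then obtain v1 v2 s where "p = ((v1, v2), (v1 + v2, v2), s)" by auto
  then show ?case by (cases v1; cases v2; cases s) (simp_all add: target_simps zero_prod_def)
next
  case (3 p)
  then obtain v1 v2 s where "p = ((v1, v2), (v1 + v2, v2), s)" by auto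
  then show ?case by (cases v1; cases v2; cases s) (simp_all add: target_simps zero_prod_def)
qed (auto simp: target_simps residue_rules)

lemma std_C2_C2_C2:
  "wreath\<lparr>carrier := {(v :: bit \<times> bit, w, s :: bit). v = w}\<rparr> \<cong> C2 \<times>\<times> C2 \<times>\<times> C2"
proof (rule wreath_isoI[where
    f = "\<lambda>((v1, v2), w, s). (residue v1, residue v2, residue s)" and
    f' = "\<lambda>(v1, v2, s). ((of_int v1, of_int v2), (of_int v1, of_int v2), of_int s)"], goal_cases)
  case (5 p q)
  then obtain v1 v2 s v1' v2' s' where "p = ((v1, v2), (v1, v2), s)" "q = ((v1', v2'), (v1', v2'), s')" by auto
  then show ?case by (cases s) (simp_all add: target_simps residue_rules)
qed (auto simp: target_simps residue_rules)

text \<open>The discrete logarithm to the base \<open>(0, 1, 1)\<close>, whose square is \<open>(1, 1, 0)\<close>.\<close>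

definition cyclic :: "bit \<times> bit \<times> bit \<Rightarrow> int" where
  "cyclic = (\<lambda>(v, w, s). residue s + 2 * residue v)"

definition cyclic_inv :: "int \<Rightarrow> bit \<times> bit \<times> bit" where
  "cyclic_inv h = (of_int (h div 2), of_int (h div 2) + of_int h, of_int h)"

lemma cyclic_in: "cyclic (v, w, s) \<in> carrier C4"
  and cyclic_inv: "cyclic_inv (cyclic (v, v + s, s)) = (v, v + s, s)"
  by (cases v; cases s; simp add: carrier_C4 cyclic_def cyclic_inv_def)+

lemma cyclic_surj: "h \<in> carrier C4 \<Longrightarrow> cyclic (cyclic_inv h) = h"
  by (auto simp: carrier_C4 cyclic_def cyclic_inv_def)

lemma cyclic_mult:
  "cyclic ((v, v + s, s) \<otimes>\<^bsub>wreath\<^esub> (v', v' + s', s')) = cyclic (v, v + s, s) \<otimes>\<^bsub>C4\<^esub> cyclic (v', v' + s', s')"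
  by (cases v; cases s; cases v'; cases s') (simp_all add: cyclic_def)

lemma std_C4: "wreath\<lparr>carrier := {(v :: bit, w, s :: bit). w = v + s}\<rparr> \<cong> C4"
  by (rule wreath_isoI[where f = cyclic and f' = cyclic_inv])
    (auto simp: cyclic_in cyclic_inv cyclic_surj cyclic_mult, simp add: cyclic_inv_def)

lemma std_C4_C2:
  "wreath\<lparr>carrier := {((n :: bit, v), w, s :: bit). w = (n, v + s)}\<rparr> \<cong> C4 \<times>\<times> C2"
proof (rule wreath_isoI[where
    f = "\<lambda>((n, v), (_, w), s). (cyclic (v, w, s), residue n)" and
    f' = "\<lambda>(h, n). case cyclic_inv h of (v, w, s) \<Rightarrow> ((of_int n, v), (of_int n, w), s)"], goal_cases)
  case (2 g)
  then show ?case by (auto simp: cyclic_inv_def)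
next
  case (4 g)
  then obtain h n where g: "g = (h, n)" "h \<in> carrier C4" "n \<in> carrier C2" by auto
  obtain v w s where d: "cyclic_inv h = (v, w, s)" by (metis surj_pair)
  show ?case using g d cyclic_surj[OF g(2)] by (auto simp: carrier_C2)
next
  case (5 p q)
  then obtain n v s n' v' s' where "p = ((n, v), (n, v + s), s)" "q = ((n', v'), (n', v' + s'), s')" by auto
  then show ?case
    using cyclic_mult[of v s v' s'] by (cases s) (simp_all add: residue_rules)
next
  case (3 p)
  then show ?case by (auto simp: cyclic_inv residue_rules)
qed (auto simp: cyclic_in carrier_C2 residue_iff)

lemma std_E4: "wreath\<lparr>carrier := {(v :: bit, w, s :: bit). v = w}\<rparr> \<cong> E4"
proof (rule wreath_isoI[where f = "\<lambda>(v, w, s). (residue v, residue s)" and f' = "\<lambda>(v, s). (of_int v, of_int v, of_int s)"], goal_cases)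
  case (5 p q)
  then obtain v s v' s' where "p = (v, v, s)" "q = (v', v', s')" by auto
  then show ?case by (cases s) (simp_all add: target_simps residue_rules)
qed (auto simp: target_simps residue_rules)

section \<open>Classification of the transitive subgroups\<close>

lemma bit_pair_cases: "(v :: bit \<times> bit) = 0 \<or> v = (1, 0) \<or> v = (0, 1) \<or> v = (1, 1)"
  by (cases v; cases "fst v"; cases "snd v") (auto simp: zero_prod_def)

lemma independent_span:
  assumes "k \<noteq> 0" "l \<noteq> 0" "l \<noteq> (k :: bit \<times> bit)"
  shows "v = 0 \<or> v = k \<or> v = l \<or> v = k + l"
  using assms bit_pair_cases[of k] bit_pair_cases[of l] bit_pair_cases[of v] by (auto simp: zero_prod_def)

lemma exists_other: "\<exists>k. k \<noteq> 0 \<and> k \<noteq> (l :: bit \<times> bit)"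
  using bit_pair_cases[of l] by (metis Pair_inject zero_neq_one zero_prod_def)

lemma combination_eq_iff:
  assumes "k \<noteq> 0" "l \<noteq> 0" "l \<noteq> k"
  shows "combination k l v = combination k l w \<longleftrightarrow> v = w"
  using bij_is_inj[OF bij_combination[OF assms]] by (simp add: inj_eq)

context
  fixes H :: "((bit \<times> bit) \<times> (bit \<times> bit) \<times> bit) set"
  assumes H: "transitive_subgroup H"
begin

text \<open>For every \<open>d\<close> in \<open>D\<close> the diagonal element \<open>(d, d, 0)\<close> is in \<open>H\<close>. If \<open>D = V\<close>, subtracting diagonal
  elements leaves \<open>(d, 0, 0)\<close> for every \<open>d\<close>, so \<open>H\<close> is everything.\<close>

lemma all_sums_iso:
  assumes "block_sums H = UNIV"
  shows "wreath\<lparr>carrier := H\<rparr> \<cong> E4_wreath_C2"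
proof -
  have left: "(d, 0, 0) \<in> H" for d
  proof -
    obtain v w where "d = v + w" "(v, w, 0) \<in> H" using assms unfolding block_sums_def by blast
    moreover have "(w, w, 0) \<in> H" using trans_diag[OF H] assms by blast
    ultimately show ?thesis using trans_add[OF H, of v w w w 0] by simp
  qed
  have base: "(v, w, 0) \<in> H" for v w
    using trans_add[OF H left[of v] trans_swap_base[OF H left[of w]]] by simp
  obtain x y where "(x, y, 1) \<in> H" using trans_swap[OF H] by blast
  then have "(v, w, 1) \<in> H" for v w using trans_coset[OF H] base by blast
  then have "(v, w, s) \<in> H" for v w s using base by (cases s) auto
  then have "p \<in> H" for p by (metis prod_cases3)
  then have "H = UNIV" by blast
  then show ?thesis using std_wreath by simp
qed

lemma zero_sum_iff:
  assumes "block_sums H = {0}"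
  shows "(v, w, 0) \<in> H \<longleftrightarrow> v = w"
proof -
  have eq: "v = w" if "(v, w, 0) \<in> H" for v w
    using block_sumsI[OF that] assms add_eq_0_V[of v w] by simp
  then show ?thesis using trans_base[OF H, of v] by blast
qed

lemma no_sums_iso:
  assumes D: "block_sums H = {0}" and x: "(x, x, 1) \<in> H"
  shows "wreath\<lparr>carrier := H\<rparr> \<cong> C2 \<times>\<times> C2 \<times>\<times> C2"
proof (rule change_basis_iso[OF H _ _ _ _ _ _ std_C2_C2_C2, where k = "(1, 0)" and l = "(0, 1)" and c = 0 and x = x])
  show "(x, x + combination (1, 0) (0, 1) 0, 1) \<in> H" using x by simp
  show "(v, w, 0) \<in> {(v, w, s). v = w} \<longleftrightarrow> (combination (1, 0) (0, 1) v, combination (1, 0) (0, 1) w, 0) \<in> H" for v w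
    unfolding zero_sum_iff[OF D] by (simp add: combination_eq_iff zero_prod_def)
qed (auto simp: zero_prod_def)

lemma no_sums_twisted_iso:
  assumes D: "block_sums H = {0}" and x: "(x, y, 1) \<in> H" "x \<noteq> y"
  shows "wreath\<lparr>carrier := H\<rparr> \<cong> C4 \<times>\<times> C2"
proof -
  obtain k where k: "k \<noteq> 0" "x + y \<noteq> k" using exists_other by metis
  have l: "x + y \<noteq> 0" using x add_eq_0_V by metis
  show ?thesis
  proof (rule change_basis_iso[OF H k(1) l k(2) _ _ _ std_C4_C2, where c = "(0, 1)" and x = x])
    show "(x, x + combination k (x + y) (0, 1), 1) \<in> H" using x by simp
    fix v w :: "bit \<times> bit"
    show "(v, w, 0) \<in> {((n, v), w, s). w = (n, v + s)} \<longleftrightarrow> (combination k (x + y) v, combination k (x + y) w, 0) \<in> H"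
      unfolding zero_sum_iff[OF D] combination_eq_iff[OF k(1) l k(2)] by (cases v) auto
    show "(v, w, 1) \<in> {((n, v), w, s). w = (n, v + s)} \<longleftrightarrow> (v, w + (0, 1), 0) \<in> {((n, v), w, s). w = (n, v + s)}"
      by (cases v; cases w; cases "snd v"; cases "snd w") auto
  qed
qed

lemma one_sum_diag:
  assumes "\<And>d. (d, d, 0) \<in> H" "k \<in> block_sums H"
  shows "(k, 0, 0) \<in> H"
proof -
  obtain v w where "k = v + w" "(v, w, 0) \<in> H" using assms(2) unfolding block_sums_def by blast
  then show ?thesis using trans_add[OF H, of v w w w 0] assms(1) by simp
qed

text \<open>Transitivity provides \<open>(v, u, 0)\<close> for some \<open>u\<close>, which is determined up to adding \<open>k\<close>.\<close>

lemma one_sum_base_iff: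
  assumes D: "block_sums H = {0, k}" and k: "(k, 0, 0) \<in> H"
  shows "(v, w, 0) \<in> H \<longleftrightarrow> v + w \<in> {0, k}"
proof
  assume "(v, w, 0) \<in> H"
  then show "v + w \<in> {0, k}" using block_sumsI D by blast
next
  assume vw: "v + w \<in> {0, k}"
  obtain u where u: "(v, u, 0) \<in> H" using trans_base[OF H] by blast
  then have "v + u \<in> {0, k}" using block_sumsI D by blast
  then have "w = u \<or> w = u + k" using vw by (metis add_self_V add.assoc add.commute insertE singletonD)
  moreover have "(v, u + k, 0) \<in> H" using trans_add[OF H u trans_swap_base[OF H k]] by simp
  ultimately show "(v, w, 0) \<in> H" using u by blast
qed

lemma combination_first_axis:
  assumes "k \<noteq> 0" "l \<noteq> 0" "l \<noteq> k"
  shows "combination k l v \<in> {0, k} \<longleftrightarrow> snd v = 0"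
proof -
  have "combination k l v \<in> {combination k l 0, combination k l (1, 0)} \<longleftrightarrow> snd v = 0"
    unfolding insert_iff combination_eq_iff[OF assms] using bit_pair_cases[of v] by (auto simp: zero_prod_def)
  then show ?thesis by simp
qed

text \<open>The square of \<open>(x, y, 1)\<close> is diagonal with entry \<open>x + y\<close>. Together with \<open>(k, k, 0)\<close> it generates all
  diagonal elements, so \<open>(k, 0, 0)\<close> lies in \<open>H\<close>.\<close>

lemma one_sum_twisted_iso:
  assumes D: "block_sums H = {0, k}" and k: "k \<noteq> 0" and x: "(x, y, 1) \<in> H" "x + y \<notin> {0, k}"
  shows "wreath\<lparr>carrier := H\<rparr> \<cong> E4_semidirect_C4"
proof -
  let ?l = "x + y"
  have l: "?l \<noteq> 0" "?l \<noteq> k" using x(2) by auto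
  have dk: "(k, k, 0) \<in> H" using trans_diag[OF H] D by blast
  have dl: "(?l, ?l, 0) \<in> H" using trans_square[OF H x(1)] .
  have "(d, d, 0) \<in> H" for d
    using independent_span[OF k l, of d] dk dl trans_zero[OF H] trans_add[OF H dk dl] by auto
  then have K: "(k, 0, 0) \<in> H" using one_sum_diag D by blast
  show ?thesis
  proof (rule change_basis_iso[OF H k l _ _ _ std_semidirect, where c = "(0, 1)" and x = x])
    show "(x, x + combination k ?l (0, 1), 1) \<in> H" using x by simp
    fix v w :: "bit \<times> bit"
    show "(v, w, 0) \<in> {((v1, v2), (w1, w2), s). w2 = v2 + s} \<longleftrightarrow> (combination k ?l v, combination k ?l w, 0) \<in> H"
      unfolding one_sum_base_iff[OF D K] combination_simps(1)[symmetric] combination_first_axis[OF k l]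
      by (cases v; cases w; cases "snd v"; cases "snd w") auto
    show "(v, w, 1) \<in> {((v1, v2), (w1, w2), s). w2 = v2 + s} \<longleftrightarrow> (v, w + (0, 1), 0) \<in> {((v1, v2), (w1, w2), s). w2 = v2 + s}"
      by (cases v; cases w; cases "snd v"; cases "snd w") auto
  qed
qed

text \<open>If \<open>x + y = k\<close>, multiplying \<open>(x, y, 1)\<close> by \<open>(0, k, 0)\<close> makes the two entries equal.\<close>

lemma one_sum_split_iso:
  assumes D: "block_sums H = {0, k}" and k: "k \<noteq> 0" "(k, 0, 0) \<in> H" and x: "(x, y, 1) \<in> H" "x + y \<in> {0, k}"
  shows "wreath\<lparr>carrier := H\<rparr> \<cong> C2 \<times>\<times> D4"
proof -
  obtain l where l: "l \<noteq> 0" "l \<noteq> k" using exists_other by metis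
  have xx: "(x, x, 1) \<in> H"
  proof (cases "x + y = 0")
    case True
    then show ?thesis using x add_eq_0_V by metis
  next
    case False
    then have "y + k = x" using x(2) by (metis add_self_V(2) add.commute insertE singletonD)
    then show ?thesis using trans_add[OF H trans_swap_base[OF H k(2)] x(1)] by (simp add: add.commute)
  qed
  show ?thesis
  proof (rule change_basis_iso[OF H k(1) l _ _ _ std_C2_D4, where c = 0 and x = x])
    show "(x, x + combination k l 0, 1) \<in> H" using xx by simp
    fix v w :: "bit \<times> bit"
    show "(v, w, 0) \<in> {((v1, v2), (w1, w2), s). v2 = w2} \<longleftrightarrow> (combination k l v, combination k l w, 0) \<in> H"
      unfolding one_sum_base_iff[OF D k(2)] combination_simps(1)[symmetric] combination_first_axis[OF k(1) l]
      by (cases v; cases w; cases "snd v"; cases "snd w") auto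
    show "(v, w, 1) \<in> {((v1, v2), (w1, w2), s). v2 = w2} \<longleftrightarrow> (v, w + 0, 0) \<in> {((v1, v2), (w1, w2), s). v2 = w2}"
      by auto
  qed
qed

text \<open>In the remaining case the elements with \<open>s = 0\<close> form the graph of the transvection that fixes
  \<open>k\<close>: a further diagonal element \<open>(v, v, 0)\<close> would give all of them, and then \<open>(k, 0, 0)\<close>.\<close>

lemma one_sum_nonsplit_graph:
  assumes D: "block_sums H = {0, k}" and k: "k \<noteq> 0" "(k, 0, 0) \<notin> H" and vw: "(v, w, 0) \<in> H"
  shows "w = (if v \<in> {0, k} then v else v + k)"
proof -
  have k0: "(0, k, 0) \<notin> H" using trans_swap_base[OF H] k(2) by blast
  have dk: "(k, k, 0) \<in> H" using trans_diag[OF H] D by blast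
  have "v + w \<in> {0, k}" using block_sumsI[OF vw] D by blast
  then have w: "w = v \<or> w = v + k" by (metis add_self_V(2) add_eq_0_V insertE singletonD)
  show ?thesis
  proof (cases "v \<in> {0, k}")
    case True
    then show ?thesis using w vw k k0 by auto
  next
    case False
    have "w \<noteq> v"
    proof
      assume "w = v"
      then have dv: "(v, v, 0) \<in> H" using vw by simp
      have "(d, d, 0) \<in> H" for d
        using independent_span[of k v d] k(1) False dk dv trans_zero[OF H] trans_add[OF H dk dv] by auto
      then show False using one_sum_diag[of k] D k(2) by blast
    qed
    then show ?thesis using w False by auto
  qed
qed

lemma one_sum_nonsplit_iso:
  assumes D: "block_sums H = {0, k}" and k: "k \<noteq> 0" "(k, 0, 0) \<notin> H" and x: "(x, y, 1) \<in> H" "x + y \<in> {0, k}"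
  shows "wreath\<lparr>carrier := H\<rparr> \<cong> D4"
proof -
  obtain l where l: "l \<noteq> 0" "l \<noteq> k" using exists_other by metis
  let ?c = "combination k l"
  have graph: "(v, w, 0) \<in> H \<longleftrightarrow> w = (if v \<in> {0, k} then v else v + k)" for v w
    using one_sum_nonsplit_graph[OF D k, of v] trans_base[OF H, of v] by metis
  have base: "(?c v, ?c w, 0) \<in> H \<longleftrightarrow> w = (fst v + snd v, snd v)" for v w
  proof -
    have "(if ?c v \<in> {0, k} then ?c v else ?c v + k) = ?c (if snd v = 0 then v else v + (1, 0))"
      unfolding combination_first_axis[OF k(1) l] by simp
    also have "(if snd v = 0 then v else v + (1, 0)) = (fst v + snd v, snd v)"
      by (cases v; cases "snd v") auto
    finally have "(if ?c v \<in> {0, k} then ?c v else ?c v + k) = ?c (fst v + snd v, snd v)" .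
    then show ?thesis by (simp only: graph combination_eq_iff[OF k(1) l])
  qed
  have ll: "(l, l + k, 0) \<in> H" using graph l by simp
  obtain z where zz: "(z, z, 1) \<in> H"
  proof (cases "x + y = 0")
    case True
    then show ?thesis using x add_eq_0_V that by metis
  next
    case False
    then have "y = x + k" using x(2) by (metis add_self_V(2) insertE singletonD)
    then have "(l + x, l + x, 1) \<in> H" using trans_add[OF H ll x(1)] by (simp add: ac_simps)
    then show ?thesis by (rule that)
  qed
  show ?thesis
  proof (rule change_basis_iso[OF H k(1) l _ _ _ std_D4_diagonal, where c = 0 and x = z])
    show "(z, z + ?c 0, 1) \<in> H" using zz by simp
    fix v w :: "bit \<times> bit"
    show "(v, w, 0) \<in> {((v1, v2), w, s). w = (v1 + v2, v2)} \<longleftrightarrow> (?c v, ?c w, 0) \<in> H"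
      unfolding base by (cases v) auto
    show "(v, w, 1) \<in> {((v1, v2), w, s). w = (v1 + v2, v2)} \<longleftrightarrow> (v, w + 0, 0) \<in> {((v1, v2), w, s). w = (v1 + v2, v2)}"
      by auto
  qed
qed

lemma block_sums_cases:
  shows "block_sums H = {0} \<or> block_sums H = UNIV \<or> (\<exists>k. k \<noteq> 0 \<and> block_sums H = {0, k})"
proof -
  have zero: "0 \<in> block_sums H" using block_sumsI[OF trans_zero[OF H]] by simp
  have add: "d + e \<in> block_sums H" if de: "d \<in> block_sums H" "e \<in> block_sums H" for d e
  proof -
    obtain v w v' w' where "d = v + w" "(v, w, 0) \<in> H" "e = v' + w'" "(v', w', 0) \<in> H"
      using de unfolding block_sums_def by blast
    then show ?thesis using block_sumsI[OF trans_add[OF H, of v w v' w' 0]] by (simp add: ac_simps)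
  qed
  show ?thesis
  proof (cases "block_sums H \<subseteq> {0}")
    case True
    then show ?thesis using zero by blast
  next
    case False
    then obtain k where k: "k \<in> block_sums H" "k \<noteq> 0" by blast
    show ?thesis
    proof (cases "block_sums H \<subseteq> {0, k}")
      case True
      then show ?thesis using zero k by blast
    next
      case False
      then obtain l where l: "l \<in> block_sums H" "l \<noteq> 0" "l \<noteq> k" by blast
      have "v \<in> block_sums H" for v
        using independent_span[OF k(2) l(2,3), of v] zero k l add[OF k(1) l(1)] by auto
      then show ?thesis by blast
    qed
  qed
qed

lemma swap_sum_cases:
  assumes "(v, w, s) \<in> H" "(x, y, 1) \<in> H"
  shows "v + w + (if s = 0 then 0 else x + y) \<in> block_sums H"
proof (cases "s = 0")
  case True
  then show ?thesis using assms(1) block_sumsI[of v w] by simp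
next
  case False
  then have "(v + x, w + y, 0) \<in> H" using trans_coset[OF H assms(2)] assms(1) by simp
  then show ?thesis using False block_sumsI[of "v + x" "w + y"] by (simp add: ac_simps)
qed

end

text \<open>The Galois group of the quartic acts on the squares of the roots, where the sign, that is
  the first component of \<open>bit \<times> bit\<close>, is invisible.\<close>

definition forget_sign :: "(bit \<times> bit) \<times> (bit \<times> bit) \<times> bit \<Rightarrow> bit \<times> bit \<times> bit" where
  "forget_sign = (\<lambda>(v, w, s). (snd v, snd w, s))"

lemma forget_signI: "(v, w, s) \<in> H \<Longrightarrow> (snd v, snd w, s) \<in> forget_sign ` H"
  by (rule rev_image_eqI) (auto simp: forget_sign_def)

context
  fixes H :: "((bit \<times> bit) \<times> (bit \<times> bit) \<times> bit) set"
  assumes H: "transitive_subgroup H"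
begin

lemma forget_sign_mult:
  assumes "g \<in> forget_sign ` H" "h \<in> forget_sign ` H"
  shows "g \<otimes>\<^bsub>wreath\<^esub> h \<in> forget_sign ` H"
proof -
  obtain p q where pq: "p \<in> H" "g = forget_sign p" "q \<in> H" "h = forget_sign q" using assms by blast
  obtain v w s v' w' s' where "p = (v, w, s)" "q = (v', w', s')" by (metis prod_cases3)
  with pq have g: "(v, w, s) \<in> H" "g = forget_sign (v, w, s)"
    and h: "(v', w', s') \<in> H" "h = forget_sign (v', w', s')" by simp_all
  have "g \<otimes>\<^bsub>wreath\<^esub> h = forget_sign ((v, w, s) \<otimes>\<^bsub>wreath\<^esub> (v', w', s'))"
    by (cases s) (simp_all add: g h forget_sign_def)
  then show ?thesis using trans_mult[OF H g(1) h(1)] by blast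
qed

text \<open>With \<open>c = 0\<close> this is the group \<open>E\<^sub>4\<close> and with \<open>c = 1\<close> the group \<open>C\<^sub>4\<close>.\<close>

lemma forget_sign_graph:
  assumes f: "\<And>v w s. (v, w, s) \<in> H \<Longrightarrow> snd w = snd v + c * s"
  shows "forget_sign ` H = {(v, w, s). w = v + c * s}"
proof
  show "forget_sign ` H \<subseteq> {(v, w, s). w = v + c * s}" by (auto simp: forget_sign_def dest: f)
  show "{(v, w, s). w = v + c * s} \<subseteq> forget_sign ` H"
  proof (clarify)
    fix v s
    obtain w where w: "((0, v), w, 0) \<in> H" using trans_base[OF H] by blast
    show "(v, v + c * s, s) \<in> forget_sign ` H"
    proof (cases "s = 0")
      case True
      then show ?thesis using forget_signI[OF w] f[OF w] by simp
    next
      case False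
      obtain x y where xy: "(x, y, 1) \<in> H" using trans_swap[OF H] by blast
      obtain u where u: "((0, v) + x, u, 0) \<in> H" using trans_base[OF H] by blast
      have *: "((0, v), u + y, 1) \<in> H" using trans_add[OF H u xy] by (simp add: add.assoc)
      show ?thesis using forget_signI[OF *] f[OF *] False by simp
    qed
  qed
qed

lemma quartic_E4:
  assumes "\<And>v w s. (v, w, s) \<in> H \<Longrightarrow> snd w = snd v"
  shows "wreath\<lparr>carrier := forget_sign ` H\<rparr> \<cong> E4"
  using forget_sign_graph[of 0] std_E4 assms by (simp add: eq_commute)

lemma quartic_C4:
  assumes "\<And>v w s. (v, w, s) \<in> H \<Longrightarrow> snd w = snd v + s"
  shows "wreath\<lparr>carrier := forget_sign ` H\<rparr> \<cong> C4"
  using forget_sign_graph[of 1] std_C4 assms by simp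

lemma quartic_D4:
  assumes d: "d \<in> block_sums H" "snd d = 1"
  shows "wreath\<lparr>carrier := forget_sign ` H\<rparr> \<cong> D4"
proof -
  let ?K = "forget_sign ` H"
  note fs = forget_signI[of _ _ _ H]
  have "(d, d, 0) \<in> H" using trans_diag[OF H d(1)] .
  then have diag: "(v, v, 0) \<in> ?K" for v
    using fs[OF \<open>(d, d, 0) \<in> H\<close>] fs[OF trans_zero[OF H]] d(2) by (cases v) auto
  obtain v w where vw: "d = v + w" "(v, w, 0) \<in> H" using d(1) unfolding block_sums_def by blast
  have left: "(1, 0, 0) \<in> ?K"
    using forget_sign_mult[OF fs[OF vw(2)] diag[of "snd w"]] d(2) by (simp add: vw(1))
  have base: "(v, w, 0) \<in> ?K" for v w
    using diag left forget_sign_mult[OF left diag[of 1]] by (cases v; cases w) auto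
  obtain x y where xy: "(x, y, 1) \<in> H" using trans_swap[OF H] by blast
  have "(v, w, 1) \<in> ?K" for v w
    using forget_sign_mult[OF base[of "v + snd x" "w + snd y"] fs[OF xy]] by (simp add: ac_simps)
  then have "(v, w, s) \<in> ?K" for v w s using base by (cases s) auto
  then have "p \<in> ?K" for p by (metis prod_cases3)
  then have "?K = UNIV" by blast
  then show ?thesis using std_D4 by simp
qed

end

text \<open>Squares are trivial in \<open>E\<^sub>4\<close> and not in \<open>C\<^sub>4\<close>.\<close>

lemma not_iso_E4_C4: "\<not> E4 \<cong> C4"
proof
  assume "E4 \<cong> C4"
  then obtain f where f: "f \<in> hom E4 C4" "bij_betw f (carrier E4) (carrier C4)"
    unfolding is_iso_def iso_def by blast
  have "(1 :: int) \<in> carrier C4" by (simp add: carrier_C4)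
  then have "1 \<in> f ` carrier E4" using bij_betw_imp_surj_on[OF f(2)] by (simp only:)
  then obtain g where g: "g \<in> carrier E4" "f g = 1" by (metis imageE)
  have sq: "g \<otimes>\<^bsub>E4\<^esub> g = (0, 0)" using g(1) by (auto simp: E4_def carrier_C2)
  then have "f (0, 0) = 2" using Group.hom_mult[OF f(1) g(1) g(1)] g(2) by simp
  moreover have "f (0, 0) = (f (0, 0) + f (0, 0)) mod 4"
    using Group.hom_mult[OF f(1), of "(0, 0)" "(0, 0)"] by (simp add: E4_def carrier_C2)
  ultimately show False by simp
qed

lemma card_C2: "card (carrier C2) = 2" and card_C4: "card (carrier C4) = 4"
  by (simp_all add: carrier_integer_mod_group)

lemma not_iso_D4: "\<not> E4 \<cong> D4" "\<not> C4 \<cong> D4"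
  using iso_same_card[of E4 D4] iso_same_card[of C4 D4]
  by (auto simp: E4_def D4_def semidirect_def card_C2 card_C4 card_cartesian_product)

text \<open>The group-theoretic content of the theorem. If some \<open>d \<in> D\<close> is not in \<open>{0, m}\<close> with the negation
  \<open>m = (1, 0)\<close>, the quotient is \<open>D\<^sub>4\<close> and only \<open>D = 0\<close> is excluded. If not, \<open>D\<close> is \<open>0\<close> or \<open>{0, m}\<close>, and
  the second bit of \<open>x + y\<close> decides between \<open>E\<^sub>4\<close> and \<open>C\<^sub>4\<close>.\<close>

lemma transitive_subgroup_pairs:
  assumes H: "transitive_subgroup H"
  defines "W \<equiv> wreath\<lparr>carrier := H\<rparr>" and "K \<equiv> wreath\<lparr>carrier := forget_sign ` H\<rparr>"
  shows "K \<cong> E4 \<and> (W \<cong> C4 \<times>\<times> C2 \<or> W \<cong> C2 \<times>\<times> C2 \<times>\<times> C2 \<or> W \<cong> D4 \<or> W \<cong> C2 \<times>\<times> D4)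
       \<or> K \<cong> C4 \<and> (W \<cong> C4 \<times>\<times> C2 \<or> W \<cong> E4_semidirect_C4)
       \<or> K \<cong> D4 \<and> (W \<cong> D4 \<or> W \<cong> C2 \<times>\<times> D4 \<or> W \<cong> E4_semidirect_C4 \<or> W \<cong> E4_wreath_C2)"
proof -
  obtain x y where xy: "(x, y, 1) \<in> H" using trans_swap[OF H] by blast
  have one: "W \<cong> D4 \<or> W \<cong> C2 \<times>\<times> D4" if "block_sums H = {0, k}" "k \<noteq> 0" "x + y \<in> {0, k}" for k
    using one_sum_split_iso[OF H that(1,2) _ xy that(3)] one_sum_nonsplit_iso[OF H that(1,2) _ xy that(3)]
    unfolding W_def by blast
  have twisted: "W \<cong> E4_semidirect_C4" if "block_sums H = {0, k}" "k \<noteq> 0" "x + y \<notin> {0, k}" for k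
    using one_sum_twisted_iso[OF H that(1,2) xy that(3)] unfolding W_def .
  have none: "W \<cong> C4 \<times>\<times> C2 \<or> W \<cong> C2 \<times>\<times> C2 \<times>\<times> C2" if D: "block_sums H = {0}"
    using no_sums_iso[OF H D, of x] no_sums_twisted_iso[OF H D xy] xy unfolding W_def by blast
  have none_twisted: "W \<cong> C4 \<times>\<times> C2" if D: "block_sums H = {0}" and "x + y \<noteq> 0"
    using no_sums_twisted_iso[OF H D xy] that(2) add_self_V(1) unfolding W_def by blast
  have m: "(1, 0) \<noteq> (0 :: bit \<times> bit)" by (simp add: zero_prod_def)
  show ?thesis
  proof (cases "\<exists>d\<in>block_sums H. snd d = 1")
    case True
    then have "K \<cong> D4" using quartic_D4[OF H] unfolding K_def by blast
    moreover have "block_sums H \<noteq> {0}" using True by auto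
    ultimately show ?thesis
      using block_sums_cases[OF H] all_sums_iso[OF H] one twisted unfolding W_def by blast
  next
    case False
    then have D: "block_sums H = {0} \<or> block_sums H = {0, (1, 0)}"
    proof -
      have "k = (1, 0)" if "k \<noteq> 0" "snd k = 0" for k :: "bit \<times> bit"
        using that bit_pair_cases[of k] by auto
      moreover have "snd k = 0" if "k \<in> block_sums H" for k using False that by auto
      moreover have "block_sums H \<noteq> UNIV" using False by (metis UNIV_I snd_conv)
      ultimately show ?thesis using block_sums_cases[OF H] by (metis insertI1 insert_commute)
    qed
    have snd_eq: "snd w = snd v + snd (x + y) * s" if h: "(v, w, s) \<in> H" for v w s
    proof -
      have "snd (v + w + (if s = 0 then 0 else x + y)) = 0"
        using swap_sum_cases[OF H h xy] False by (meson bit_not_one_iff)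
      then show ?thesis
        by (cases s; cases "snd v"; cases "snd w"; cases "snd x"; cases "snd y") auto
    qed
    show ?thesis
    proof (cases "snd (x + y) = 0")
      case True
      then have "K \<cong> E4" using quartic_E4[OF H] snd_eq unfolding K_def by simp
      moreover have "x + y \<in> {0, (1, 0)}"
        using True bit_pair_cases[of "x + y"] by (auto simp del: snd_add)
      ultimately show ?thesis using D one[OF _ m] none by blast
    next
      case False
      then have "snd (x + y) = 1" by (simp del: snd_add)
      then have "K \<cong> C4" using quartic_C4[OF H] snd_eq unfolding K_def by simp
      moreover have "x + y \<notin> {0, (1, 0)}" using False by (auto simp del: snd_add)
      ultimately show ?thesis using D twisted[OF _ m] none_twisted by blast
    qed
  qed
qed

section \<open>The roots of the octic\<close>

text \<open>The invariant \<open>u(x)\<close> of the introduction, whose fibres are the orbits of \<open>V\<close>.\<close>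

definition pair_sum :: "complex \<Rightarrow> complex" where
  "pair_sum x = x\<^sup>2 + (inverse x)\<^sup>2"

definition sign_bit :: "bit \<Rightarrow> complex" where
  "sign_bit b = (if b = 0 then 1 else -1)"

definition V_act :: "bit \<times> bit \<Rightarrow> complex \<Rightarrow> complex" where
  "V_act v x = sign_bit (fst v) * (if snd v = 0 then x else inverse x)"

lemma sign_bit_simps [simp]: "sign_bit 0 = 1" "sign_bit 1 = -1"
  by (simp_all add: sign_bit_def)

lemma sign_bit_add: "sign_bit (a + b) = sign_bit a * sign_bit b"
  by (cases a; cases b) simp_all

lemma sign_bit_fixed: "z \<noteq> 0 \<Longrightarrow> sign_bit b * z = z \<longleftrightarrow> b = 0"
  and sign_bit_flipped: "z \<noteq> 0 \<Longrightarrow> sign_bit b * z = - z \<longleftrightarrow> b = 1"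
  by (cases b; simp)+

lemma V_act_zero [simp]: "V_act 0 x = x"
  by (simp add: V_act_def)

lemma V_act_add: "V_act (v + w) x = V_act v (V_act w x)"
  by (cases "fst v"; cases "snd v"; cases "fst w"; cases "snd w") (simp_all add: V_act_def)

lemma V_act_nonzero: "x \<noteq> 0 \<Longrightarrow> V_act v x \<noteq> 0"
  by (cases "fst v"; cases "snd v") (simp_all add: V_act_def)

lemma V_act_square: "(V_act v x)\<^sup>2 = (if snd v = 0 then x\<^sup>2 else (inverse x)\<^sup>2)"
  by (cases "fst v"; cases "snd v") (simp_all add: V_act_def)

lemma pair_sum_V_act [simp]: "pair_sum (V_act v x) = pair_sum x"
  by (cases "fst v"; cases "snd v") (simp_all add: V_act_def pair_sum_def)

lemma pair_sum_eq_iff: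
  assumes "x \<noteq> 0" "z \<noteq> 0"
  shows "pair_sum z = pair_sum x \<longleftrightarrow> (\<exists>v. z = V_act v x)"
proof
  assume "pair_sum z = pair_sum x"
  then have "(z\<^sup>2 - x\<^sup>2) * ((z * x)\<^sup>2 - 1) = 0"
    using assms unfolding pair_sum_def by (simp add: field_simps power2_eq_square)
  then have "z = x \<or> z = - x \<or> z * x = 1 \<or> z * x = -1"
    by (auto simp: power2_eq_iff power2_eq_1_iff)
  moreover have "z = inverse x" if "z * x = 1" using that by (metis inverse_unique mult.commute)
  moreover have "z = - inverse x" if "z * x = -1"
    using that assms by (simp add: field_simps)
  ultimately have "z = V_act (0, 0) x \<or> z = V_act (1, 0) x \<or> z = V_act (0, 1) x \<or> z = V_act (1, 1) x"
    by (auto simp: V_act_def)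
  then show "\<exists>v. z = V_act v x" by blast
qed auto

text \<open>A nontrivial element of \<open>V\<close> fixes \<open>x \<noteq> 0\<close> only if \<open>x\<^sup>2 = 1\<close> or \<open>x\<^sup>2 = -1\<close>.\<close>

lemma V_act_free:
  assumes "x \<noteq> 0" "pair_sum x \<noteq> 2" "pair_sum x \<noteq> -2" and eq: "V_act v x = V_act w x"
  shows "v = w"
proof -
  have "V_act (w + v) x = x" using arg_cong[OF eq, of "V_act w"] by (simp flip: V_act_add)
  moreover have "inverse x \<noteq> x"
  proof
    assume e: "inverse x = x"
    then have "x\<^sup>2 = 1" using assms(1) by (metis power2_eq_square right_inverse)
    then show False using assms(2) by (simp add: pair_sum_def e)
  qed
  moreover have "- inverse x \<noteq> x"
  proof
    assume "- inverse x = x"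
    then have e: "inverse x = - x" by (simp add: minus_equation_iff)
    then have "x * (- x) = 1" using assms(1) by (metis right_inverse)
    then have "x\<^sup>2 = -1" by (simp add: power2_eq_square minus_equation_iff)
    then show False using assms(3) by (simp add: pair_sum_def e)
  qed
  moreover have "- x \<noteq> x" using assms(1) by simp
  ultimately have "e = 0" if "V_act e x = x" for e
    using bit_pair_cases[of e] that by (auto simp: V_act_def)
  from this[OF \<open>V_act (w + v) x = x\<close>] have "w + v = 0" .
  then show ?thesis using add_eq_0_V by blast
qed

text \<open>The eigenfunctions \<open>A\<close> and \<open>B\<close> of \<open>V\<close>.\<close>

definition plus_inv :: "complex \<Rightarrow> complex" where "plus_inv x = x + inverse x"
definition minus_inv :: "complex \<Rightarrow> complex" where "minus_inv x = x - inverse x"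

lemma
  assumes "x \<noteq> 0"
  shows plus_inv_square: "(plus_inv x)\<^sup>2 = pair_sum x + 2"
    and minus_inv_square: "(minus_inv x)\<^sup>2 = pair_sum x - 2"
  using assms by (simp_all add: plus_inv_def minus_inv_def pair_sum_def power2_eq_square algebra_simps)

lemma plus_inv_V_act: "plus_inv (V_act v x) = sign_bit (fst v) * plus_inv x"
  and minus_inv_V_act: "minus_inv (V_act v x) = sign_bit (fst v + snd v) * minus_inv x"
  by (cases "fst v"; cases "snd v"; simp add: V_act_def plus_inv_def minus_inv_def)+

lemma exists_pair_sum: "\<exists>x. x \<noteq> 0 \<and> pair_sum x = u"
proof -
  define y where "y = (u + csqrt (u\<^sup>2 - 4)) / 2"
  have "(2 * y - u)\<^sup>2 = u\<^sup>2 - 4" by (simp add: y_def)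
  then have "4 * (y * y + 1) = 4 * (u * y)" by (simp add: power2_eq_square algebra_simps)
  then have y: "y * y + 1 = u * y" by (subst (asm) mult_left_cancel) simp_all
  then have "y \<noteq> 0" by auto
  then have "y + inverse y = u" using y by (simp add: field_simps)
  then have "pair_sum (csqrt y) = u" "csqrt y \<noteq> 0"
    using \<open>y \<noteq> 0\<close> by (simp_all add: pair_sum_def power_inverse)
  then show ?thesis by blast
qed

lemma poly_octic:
  "poly (map_poly of_rat (octic a b)) z = z ^ 8 + of_rat a * z ^ 6 + of_rat b * z ^ 4 + of_rat a * z\<^sup>2 + (1::complex)"
  by (simp add: octic_def map_poly_pCons eval_nat_numeral algebra_simps)

lemma poly_quartic_square:
  "poly (map_poly of_rat (quartic a b)) (z\<^sup>2) = poly (map_poly of_rat (octic a b)) (z :: complex)"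
  by (simp add: octic_def quartic_def map_poly_pCons eval_nat_numeral algebra_simps)

locale octic_roots =
  fixes a b :: rat and \<alpha> \<beta> :: complex
  assumes nonzero: "\<alpha> \<noteq> 0" "\<beta> \<noteq> 0"
    and sums: "pair_sum \<alpha> + pair_sum \<beta> = - of_rat a" "pair_sum \<alpha> * pair_sum \<beta> = of_rat b - 2"

lemma octic_roots_exist: "\<exists>\<alpha> \<beta>. octic_roots a b \<alpha> \<beta>"
proof -
  define d where "d = csqrt (of_rat a ^ 2 - 4 * (of_rat b - 2))"
  obtain \<alpha> where \<alpha>: "\<alpha> \<noteq> 0" "pair_sum \<alpha> = (- of_rat a + d) / 2" using exists_pair_sum by blast
  obtain \<beta> where \<beta>: "\<beta> \<noteq> 0" "pair_sum \<beta> = (- of_rat a - d) / 2" using exists_pair_sum by blast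
  have d: "d * d = of_rat a * of_rat a - 4 * (of_rat b - 2)"
    unfolding d_def by (simp flip: power2_eq_square)
  have "pair_sum \<alpha> * pair_sum \<beta> = (of_rat a * of_rat a - d * d) / 4"
    unfolding \<alpha>(2) \<beta>(2) by (simp add: field_simps)
  also have "\<dots> = of_rat b - 2" unfolding d by simp
  finally have "pair_sum \<alpha> * pair_sum \<beta> = of_rat b - 2" .
  moreover have "pair_sum \<alpha> + pair_sum \<beta> = - of_rat a"
    unfolding \<alpha>(2) \<beta>(2) by (simp add: field_simps)
  ultimately have "octic_roots a b \<alpha> \<beta>" using \<alpha>(1) \<beta>(1) by unfold_locales
  then show ?thesis by blast
qed

context octic_roots
begin

definition labelled_root :: "(bit \<times> bit) \<times> bit \<Rightarrow> complex" where
  "labelled_root = (\<lambda>(v, i). V_act v (if i = 0 then \<alpha> else \<beta>))"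

definition r :: complex where "r = pair_sum \<alpha> - pair_sum \<beta>"

abbreviation "k \<equiv> adjoin (insert r \<rat>)"
abbreviation "L \<equiv> root_field (octic a b)"
abbreviation "Gal \<equiv> carrier (galois_group (octic a b))"
abbreviation "H \<equiv> galois_image (octic a b) UNIV labelled_root wreath wreath_act"

lemma r_square: "r\<^sup>2 = of_rat (a\<^sup>2 - 4 * b + 8)"
proof -
  have "r\<^sup>2 = (pair_sum \<alpha> + pair_sum \<beta>)\<^sup>2 - 4 * (pair_sum \<alpha> * pair_sum \<beta>)"
    unfolding r_def by (simp add: power2_eq_square algebra_simps)
  then show ?thesis unfolding sums by (simp add: of_rat_diff of_rat_add of_rat_mult of_rat_power)
qed

lemma pair_sum_via_r: "pair_sum \<alpha> = (r - of_rat a) / 2" "pair_sum \<beta> = (- r - of_rat a) / 2"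
proof -
  have "2 * pair_sum \<alpha> = r - of_rat a" "2 * pair_sum \<beta> = - r - of_rat a"
  proof -
    have a: "of_rat a = - (pair_sum \<alpha> + pair_sum \<beta>)" unfolding sums(1) by simp
    show "2 * pair_sum \<alpha> = r - of_rat a" "2 * pair_sum \<beta> = - r - of_rat a" unfolding r_def a by simp_all
  qed
  then show "pair_sum \<alpha> = (r - of_rat a) / 2" "pair_sum \<beta> = (- r - of_rat a) / 2"
    by (metis nonzero_mult_div_cancel_left zero_neq_numeral)+
qed

lemma octic_factor:
  assumes "z \<noteq> 0"
  shows "poly (map_poly of_rat (octic a b)) z = z ^ 4 * ((pair_sum z - pair_sum \<alpha>) * (pair_sum z - pair_sum \<beta>))"
proof -
  have *: "(pair_sum z - pair_sum \<alpha>) * (pair_sum z - pair_sum \<beta>) =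
      (pair_sum z)\<^sup>2 - (pair_sum \<alpha> + pair_sum \<beta>) * pair_sum z + pair_sum \<alpha> * pair_sum \<beta>"
    by (simp add: power2_eq_square algebra_simps)
  have "z\<^sup>2 * pair_sum z = z ^ 4 + 1"
    using assms by (simp add: pair_sum_def field_simps power2_eq_square power4_eq_xxxx)
  then have "z ^ 4 * ((pair_sum z)\<^sup>2 - (pair_sum \<alpha> + pair_sum \<beta>) * pair_sum z + pair_sum \<alpha> * pair_sum \<beta>)
     = (z ^ 4 + 1)\<^sup>2 + of_rat a * z\<^sup>2 * (z ^ 4 + 1) + (of_rat b - 2) * z ^ 4"
  proof -
    have "z ^ 4 * (p\<^sup>2 - (- u) * p + w) = (z\<^sup>2 * p)\<^sup>2 + u * z\<^sup>2 * (z\<^sup>2 * p) + w * z ^ 4" for p u w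
      by (simp add: algebra_simps power2_eq_square power4_eq_xxxx)
    then show ?thesis using \<open>z\<^sup>2 * pair_sum z = z ^ 4 + 1\<close> unfolding sums by simp
  qed
  also have "\<dots> = poly (map_poly of_rat (octic a b)) z"
    unfolding poly_octic by (simp add: eval_nat_numeral algebra_simps)
  finally show ?thesis unfolding * ..
qed

lemma roots_eq_range: "complex_roots (octic a b) = range labelled_root"
proof -
  have zero: "0 \<notin> complex_roots (octic a b)" by (simp add: complex_roots_def poly_octic)
  have "z \<in> complex_roots (octic a b) \<longleftrightarrow> z \<in> range labelled_root" if z: "z \<noteq> 0" for z
  proof -
    have "z \<in> complex_roots (octic a b) \<longleftrightarrow> pair_sum z = pair_sum \<alpha> \<or> pair_sum z = pair_sum \<beta>"
      using z by (auto simp: complex_roots_def octic_factor)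
    also have "\<dots> \<longleftrightarrow> (\<exists>v. z = labelled_root (v, 0)) \<or> (\<exists>v. z = labelled_root (v, 1))"
      using pair_sum_eq_iff[OF _ z] nonzero by (simp add: labelled_root_def)
    also have "\<dots> \<longleftrightarrow> z \<in> range labelled_root" by (auto simp: image_iff) (metis bit.exhaust)
    finally show ?thesis .
  qed
  moreover have "labelled_root i \<noteq> 0" for i
    using nonzero V_act_nonzero by (cases i) (simp add: labelled_root_def)
  ultimately show ?thesis using zero by (metis rangeE subsetI subset_antisym)
qed

lemma root_in_roots: "labelled_root i \<in> complex_roots (octic a b)"
  using roots_eq_range by blast

lemma root_in_L: "labelled_root i \<in> L"
  using root_in_roots adjoin_superset by blast

lemma \<alpha>\<beta>_eq_root: "\<alpha> = labelled_root (0, 0)" "\<beta> = labelled_root (0, 1)"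
  by (simp_all add: labelled_root_def)

lemma \<alpha>\<beta>_in_L: "\<alpha> \<in> L" "\<beta> \<in> L"
  using root_in_L \<alpha>\<beta>_eq_root by metis+

lemmas L_closed = subfield_closed[OF adjoin_subfield[of "complex_roots (octic a b)"]]

lemma in_L: "r \<in> L" "plus_inv \<alpha> \<in> L" "plus_inv \<beta> \<in> L" "minus_inv \<alpha> \<in> L" "minus_inv \<beta> \<in> L"
  unfolding r_def pair_sum_def plus_inv_def minus_inv_def
  by (intro L_closed \<alpha>\<beta>_in_L)+

lemma octic_nonzero: "octic a b \<noteq> 0"
  by (simp add: octic_def)

text \<open>The roots of the octic are obtained from any subfield by adjoining \<open>r\<close> and then the values of
  \<open>A\<close> and \<open>B\<close>, all of them square roots of elements already present; note \<open>\<alpha> = (A(\<alpha>) + B(\<alpha>)) / 2\<close>.\<close>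

lemma extend_to_galois_group:
  assumes F: "complex_subfield F" and \<sigma>: "field_hom F \<sigma>"
  shows "\<exists>\<tau>\<in>Gal. \<forall>x\<in>F. x \<in> L \<longrightarrow> \<tau> x = \<sigma> x"
proof -
  have "\<forall>z\<in>set [r]. z\<^sup>2 \<in> F" using subfield_of_rat[OF F] by (simp add: r_square)
  from extend_hom_sqrts[OF F \<sigma> this] obtain \<rho> where
    \<rho>: "field_hom (adjoin (F \<union> set [r])) \<rho>" "\<forall>x\<in>F. \<rho> x = \<sigma> x" by blast
  let ?F' = "adjoin (F \<union> set [r])"
  note F' = adjoin_subfield[of "F \<union> set [r]"] note c' = subfield_closed[OF F']
  have r: "r \<in> ?F'" using adjoin_superset[of "F \<union> set [r]"] by auto
  have "pair_sum \<alpha> \<in> ?F'" "pair_sum \<beta> \<in> ?F'" unfolding pair_sum_via_r by (intro c' r)+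
  let ?zs = "[plus_inv \<alpha>, minus_inv \<alpha>, plus_inv \<beta>, minus_inv \<beta>]"
  from \<open>pair_sum \<alpha> \<in> ?F'\<close> \<open>pair_sum \<beta> \<in> ?F'\<close> have "\<forall>z\<in>set ?zs. z\<^sup>2 \<in> ?F'"
    using nonzero c'(3,7,11) by (simp add: plus_inv_square minus_inv_square)
  from extend_hom_sqrts[OF F' \<rho>(1) this] obtain \<tau> where
    \<tau>: "field_hom (adjoin (?F' \<union> set ?zs)) \<tau>" "\<forall>x\<in>?F'. \<tau> x = \<rho> x" by blast
  let ?E = "adjoin (?F' \<union> set ?zs)"
  note E = adjoin_subfield[of "?F' \<union> set ?zs"]
  note cE = subfield_closed[OF E]
  have gens: "plus_inv \<alpha> \<in> ?E" "minus_inv \<alpha> \<in> ?E" "plus_inv \<beta> \<in> ?E" "minus_inv \<beta> \<in> ?E"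
    using adjoin_superset[of "?F' \<union> set ?zs"] by auto
  have eq: "\<alpha> = (plus_inv \<alpha> + minus_inv \<alpha>) / 2" "\<beta> = (plus_inv \<beta> + minus_inv \<beta>) / 2"
    by (simp_all add: plus_inv_def minus_inv_def)
  have "(plus_inv \<alpha> + minus_inv \<alpha>) / 2 \<in> ?E" "(plus_inv \<beta> + minus_inv \<beta>) / 2 \<in> ?E"
    by (intro cE gens)+
  then have "\<alpha> \<in> ?E" "\<beta> \<in> ?E" by (simp_all only: eq[symmetric])
  then have "V_act v \<alpha> \<in> ?E" "V_act v \<beta> \<in> ?E" for v
    using cE(1,4,5,6) by (simp_all add: V_act_def sign_bit_def)
  then have "complex_roots (octic a b) \<subseteq> ?E" unfolding roots_eq_range labelled_root_def by auto
  then have LE: "L \<subseteq> ?E" using adjoin_least[OF E] by blast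
  have "restrict \<tau> L \<in> Gal" by (rule restrict_hom_in_galois_group[OF octic_nonzero E LE \<tau>(1)])
  moreover have "restrict \<tau> L x = \<sigma> x" if "x \<in> F" "x \<in> L" for x
    using that \<tau>(2) \<rho>(2) adjoin_superset[of "F \<union> set [r]"] by auto
  ultimately show ?thesis by blast
qed

lemma sign_change:
  assumes F: "complex_subfield F" and z: "z\<^sup>2 \<in> F" "z \<notin> F" "z \<in> L"
  shows "\<exists>\<tau>\<in>Gal. \<tau> z = - z \<and> (\<forall>x\<in>F. x \<in> L \<longrightarrow> \<tau> x = x)"
proof -
  obtain \<sigma> where \<sigma>: "field_hom (adjoin (insert z F)) \<sigma>" "\<And>x. x \<in> F \<Longrightarrow> \<sigma> x = x" "\<sigma> z = - z"
    using extend_hom_sqrt[OF F field_hom_id z(1), of "- z"] z(2) by auto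
  obtain \<tau> where \<tau>: "\<tau> \<in> Gal" "\<forall>x\<in>adjoin (insert z F). x \<in> L \<longrightarrow> \<tau> x = \<sigma> x"
    using extend_to_galois_group[OF adjoin_subfield \<sigma>(1)] by blast
  then show ?thesis using \<sigma>(2,3) z(3) adjoin_superset[of "insert z F"] by (intro bexI[of _ \<tau>]) auto
qed

lemma galois_V_act:
  assumes "\<sigma> \<in> Gal" "x \<in> L"
  shows "\<sigma> (V_act v x) = V_act v (\<sigma> x)" "\<sigma> (pair_sum x) = pair_sum (\<sigma> x)"
    "\<sigma> (plus_inv x) = plus_inv (\<sigma> x)" "\<sigma> (minus_inv x) = minus_inv (\<sigma> x)"
proof -
  note hs = field_hom_simps[OF adjoin_subfield galois_hom[OF assms(1)]]
  show "\<sigma> (V_act v x) = V_act v (\<sigma> x)"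
    using assms(2) L_closed(5) by (cases "fst v"; cases "snd v") (simp_all add: V_act_def hs)
  show "\<sigma> (pair_sum x) = pair_sum (\<sigma> x)"
    "\<sigma> (plus_inv x) = plus_inv (\<sigma> x)" "\<sigma> (minus_inv x) = minus_inv (\<sigma> x)"
    using assms(2) L_closed(5,9) by (simp_all add: pair_sum_def plus_inv_def minus_inv_def hs)
qed

definition realises :: "(complex \<Rightarrow> complex) \<Rightarrow> (bit \<times> bit) \<times> (bit \<times> bit) \<times> bit \<Rightarrow> bool" where
  "realises \<sigma> h \<longleftrightarrow> \<sigma> \<in> Gal \<and> (\<forall>i. \<sigma> (labelled_root i) = labelled_root (wreath_act h i))"

lemma H_iff: "h \<in> H \<longleftrightarrow> (\<exists>\<sigma>. realises \<sigma> h)"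
  by (auto simp: galois_image_def realises_def)

lemma realises_values:
  assumes "realises \<sigma> (v, w, s)"
  shows "\<sigma> \<alpha> = (if s = 0 then V_act v \<alpha> else V_act w \<beta>)" "\<sigma> \<beta> = (if s = 0 then V_act w \<beta> else V_act v \<alpha>)"
proof -
  have "\<sigma> \<alpha> = labelled_root (wreath_act (v, w, s) (0, 0))" "\<sigma> \<beta> = labelled_root (wreath_act (v, w, s) (0, 1))"
    using assms \<alpha>\<beta>_eq_root unfolding realises_def by metis+
  then show "\<sigma> \<alpha> = (if s = 0 then V_act v \<alpha> else V_act w \<beta>)" "\<sigma> \<beta> = (if s = 0 then V_act w \<beta> else V_act v \<alpha>)"
    by (cases s; simp add: wreath_act_def labelled_root_def)+
qed

lemma realises_signs:
  assumes R: "realises \<sigma> (v, w, s)"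
  shows "\<sigma> r = sign_bit s * r"
    and "\<sigma> (plus_inv \<alpha> * plus_inv \<beta>) = sign_bit (fst v + fst w) * (plus_inv \<alpha> * plus_inv \<beta>)"
    and "\<sigma> (minus_inv \<alpha> * minus_inv \<beta>) = sign_bit (fst v + snd v + (fst w + snd w)) * (minus_inv \<alpha> * minus_inv \<beta>)"
    and "s = 0 \<Longrightarrow> \<sigma> (plus_inv \<alpha>) = sign_bit (fst v) * plus_inv \<alpha>"
    and "s = 0 \<Longrightarrow> \<sigma> (plus_inv \<beta>) = sign_bit (fst w) * plus_inv \<beta>"
    and "s = 0 \<Longrightarrow> \<sigma> (minus_inv \<alpha>) = sign_bit (fst v + snd v) * minus_inv \<alpha>"
    and "s = 0 \<Longrightarrow> \<sigma> (minus_inv \<beta>) = sign_bit (fst w + snd w) * minus_inv \<beta>"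
proof -
  have G: "\<sigma> \<in> Gal" using R by (simp add: realises_def)
  note hs = field_hom_simps[OF adjoin_subfield galois_hom[OF G]]
  note g = galois_V_act[OF G] realises_values[OF R] plus_inv_V_act minus_inv_V_act \<alpha>\<beta>_in_L
  have in': "pair_sum \<alpha> \<in> L" "pair_sum \<beta> \<in> L" unfolding pair_sum_def by (intro L_closed \<alpha>\<beta>_in_L)+
  show "\<sigma> r = sign_bit s * r"
    unfolding r_def by (cases s) (simp_all add: hs(6) in' g)
  show "\<sigma> (plus_inv \<alpha> * plus_inv \<beta>) = sign_bit (fst v + fst w) * (plus_inv \<alpha> * plus_inv \<beta>)"
    by (cases s) (simp_all add: hs(3) in_L g sign_bit_add)
  show "\<sigma> (minus_inv \<alpha> * minus_inv \<beta>) = sign_bit (fst v + snd v + (fst w + snd w)) * (minus_inv \<alpha> * minus_inv \<beta>)"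
    by (cases s) (simp_all add: hs(3) in_L g sign_bit_add)
qed (simp_all add: galois_V_act realises_values[OF R] plus_inv_V_act minus_inv_V_act \<alpha>\<beta>_in_L
      R[unfolded realises_def, THEN conjunct1])

end

section \<open>Irreducibility and the Galois group\<close>

abbreviation eval_rat :: "rat poly \<Rightarrow> complex \<Rightarrow> complex" where
  "eval_rat p z \<equiv> poly (map_poly of_rat p) z"

lemma eval_rat_add: "eval_rat (p + q) z = eval_rat p z + eval_rat q z"
proof -
  have "map_poly of_rat (p + q) = map_poly of_rat p + (map_poly of_rat q :: complex poly)"
    by (rule poly_eqI) (simp add: coeff_map_poly of_rat_add)
  then show ?thesis by simp
qed

lemma eval_rat_mult: "eval_rat (p * q) z = eval_rat p z * eval_rat q z"
proof (induction p)
  case (pCons c p)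
  have "map_poly of_rat (smult c q) = smult (of_rat c) (map_poly of_rat q :: complex poly)"
    by (rule poly_eqI) (simp add: coeff_map_poly of_rat_mult)
  then show ?case using pCons.IH by (simp add: eval_rat_add map_poly_pCons algebra_simps)
qed simp

lemma square_relation:
  fixes x :: complex
  assumes "x = t * u * y" "u * u = d"
  shows "x * x - d * t * t * (y * y) = 0"
  unfolding assms(1) assms(2)[symmetric] by (simp add: algebra_simps)

context octic_roots
begin

text \<open>These conditions say that \<open>\<alpha>\<close> has degree 8, since \<open>\<rat>(\<alpha>)\<close> is obtained from \<open>k = \<rat>(r)\<close> by
  adjoining \<open>A(\<alpha>)\<close> and \<open>B(\<alpha>)\<close>. They are equivalent to irreducibility of the octic.\<close>

definition nondegenerate :: bool where
  "nondegenerate \<longleftrightarrow> r \<notin> \<rat> \<and> plus_inv \<alpha> \<notin> k \<and> minus_inv \<alpha> \<notin> k \<and> plus_inv \<alpha> * minus_inv \<alpha> \<notin> k"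

lemma rat_subfield: "complex_subfield \<rat>"
  using rational_subfield by (simp add: Rats_def)

lemma k_subfield: "complex_subfield k"
  by (rule adjoin_subfield)

lemma r_in_k: "r \<in> k" and of_rat_in_k: "of_rat q \<in> k"
  using adjoin_superset[of "insert r \<rat>"] by auto

lemma k_coordinates:
  assumes "r \<notin> \<rat>" "z \<in> k"
  obtains s t where "z = of_rat s + of_rat t * r"
proof -
  have "r\<^sup>2 \<in> \<rat>" by (simp add: r_square)
  then have "k = {x + y * r |x y. x \<in> \<rat> \<and> y \<in> \<rat>}" using adjoin_sqrt[OF rat_subfield] assms(1) by blast
  then obtain x y where "z = x + y * r" "x \<in> \<rat>" "y \<in> \<rat>" using assms(2) by blast
  then show ?thesis using that by (auto elim!: Rats_cases)
qed

lemma pair_sum_in_k: "pair_sum \<alpha> \<in> k" "pair_sum \<beta> \<in> k"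
  unfolding pair_sum_via_r by (intro subfield_closed[OF k_subfield] r_in_k of_rat_in_k)+

lemma pair_sum_not_rational:
  assumes "r \<notin> \<rat>"
  shows "pair_sum \<alpha> \<notin> \<rat>" "pair_sum \<beta> \<notin> \<rat>"
proof -
  have "r = 2 * pair_sum \<alpha> + of_rat a" "r = - (2 * pair_sum \<beta> + of_rat a)"
    unfolding pair_sum_via_r by simp_all
  then show "pair_sum \<alpha> \<notin> \<rat>" "pair_sum \<beta> \<notin> \<rat>"
    using assms by (metis Rats_add Rats_minus_iff Rats_mult Rats_number_of Rats_of_rat)+
qed

lemma inj_root:
  assumes "r \<notin> \<rat>"
  shows "inj labelled_root"
proof (rule injI)
  fix x y assume eq: "labelled_root x = labelled_root y"
  obtain v i w j where xy: "x = (v, i)" "y = (w, j)" by (metis surj_pair)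
  let ?c = "\<lambda>i :: bit. if i = 0 then \<alpha> else \<beta>"
  have "r \<noteq> 0" using assms by auto
  have "pair_sum (?c i) = pair_sum (?c j)"
    using arg_cong[OF eq, of pair_sum] by (simp add: xy labelled_root_def)
  then have ij: "i = j" using \<open>r \<noteq> 0\<close> unfolding r_def by (cases i; cases j) auto
  have "pair_sum (?c i) \<notin> \<rat>" using pair_sum_not_rational[OF assms] by simp
  then have "pair_sum (?c i) \<noteq> 2" "pair_sum (?c i) \<noteq> -2" by (metis Rats_number_of, metis Rats_number_of Rats_minus_iff)
  moreover have "?c i \<noteq> 0" using nonzero by simp
  ultimately have "v = w" using V_act_free[of "?c i" v w] eq by (simp add: xy labelled_root_def ij)
  then show "x = y" by (simp add: xy ij)
qed

lemma bij_root: "r \<notin> \<rat> \<Longrightarrow> bij_betw labelled_root UNIV (complex_roots (octic a b))"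
  using inj_root roots_eq_range by (simp add: bij_betw_def)

lemma card_roots:
  assumes "r \<notin> \<rat>"
  shows "card (complex_roots (octic a b)) = 8"
proof -
  have bits: "(UNIV :: bit set) = {0, 1}" using bit.exhaust by auto
  then have "card (UNIV :: bit set) = 2" by (metis card_2_iff zero_neq_one)
  then have "card (UNIV :: ((bit \<times> bit) \<times> bit) set) = 8"
    by (simp add: card_cartesian_product flip: UNIV_Times_UNIV)
  then show ?thesis using bij_betw_same_card[OF bij_root[OF assms]] by simp
qed

text \<open>The orbits cannot be merged: \<open>\<sigma>\<close> is injective, so it keeps \<open>u(\<alpha>)\<close> and \<open>u(\<beta>)\<close> apart.\<close>

lemma exists_realised:
  assumes r: "r \<notin> \<rat>" and \<sigma>: "\<sigma> \<in> Gal"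
  obtains v w s where "realises \<sigma> (v, w, s)" "(v, w, s) \<in> H"
proof -
  note g = galois_V_act[OF \<sigma>]
  have inj: "inj_on \<sigma> L" by (rule field_hom_inj[OF adjoin_subfield galois_hom[OF \<sigma>]])
  have rt: "\<exists>v i. \<sigma> (labelled_root x) = labelled_root (v, i)" for x
    using galois_root[OF \<sigma> root_in_roots[of x]] roots_eq_range by (auto simp: image_iff)
  obtain v i where v: "\<sigma> \<alpha> = labelled_root (v, i)" using rt[of "(0, 0)"] \<alpha>\<beta>_eq_root by metis
  obtain w j where w: "\<sigma> \<beta> = labelled_root (w, j)" using rt[of "(0, 1)"] \<alpha>\<beta>_eq_root by metis
  have "i \<noteq> j"
  proof
    assume "i = j"
    then have "pair_sum (\<sigma> \<alpha>) = pair_sum (\<sigma> \<beta>)" by (simp add: v w labelled_root_def)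
    then have "\<sigma> (pair_sum \<alpha>) = \<sigma> (pair_sum \<beta>)" using g(2) \<alpha>\<beta>_in_L by simp
    moreover have "pair_sum \<alpha> \<in> L" "pair_sum \<beta> \<in> L" unfolding pair_sum_def by (intro L_closed \<alpha>\<beta>_in_L)+
    ultimately have "pair_sum \<alpha> = pair_sum \<beta>" using inj by (auto dest: inj_onD)
    then show False using r by (simp add: r_def)
  qed
  define h where "h = (if i = 0 then (v, w, 0) else (w, v, 1 :: bit))"
  have "\<sigma> (labelled_root x) = labelled_root (wreath_act h x)" for x
  proof -
    obtain u l where x: "x = (u, l)" by (metis surj_pair)
    have "\<sigma> (labelled_root x) = V_act u (if l = 0 then \<sigma> \<alpha> else \<sigma> \<beta>)"
      using g(1) \<alpha>\<beta>_in_L by (simp add: x labelled_root_def)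
    then show ?thesis
      using \<open>i \<noteq> j\<close> by (cases i; cases j; cases l) (simp_all add: x v w h_def wreath_act_def labelled_root_def V_act_add)
  qed
  then have "realises \<sigma> h" using \<sigma> by (simp add: realises_def)
  then show ?thesis using that H_iff by (metis prod_cases3)
qed

lemma
  assumes r: "r \<notin> \<rat>"
  shows H_subgroup: "subgroup H wreath"
    and galois_group_iso: "galois_group (octic a b) \<cong> wreath\<lparr>carrier := H\<rparr>"
proof -
  have real: "\<exists>h\<in>carrier wreath. \<forall>i\<in>UNIV. \<sigma> (labelled_root i) = labelled_root (wreath_act h i)" if g: "\<sigma> \<in> Gal" for \<sigma>
  proof -
    obtain v w s where "realises \<sigma> (v, w, s)" using exists_realised[OF r g] by blast
    then show ?thesis by (intro bexI[of _ "(v, w, s)"]) (simp_all add: realises_def)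
  qed
  have faithful: "\<And>g h. (\<And>i. i \<in> UNIV \<Longrightarrow> wreath_act g i = wreath_act h i) \<Longrightarrow> g = h"
    by (rule wreath_act_faithful) simp
  show "subgroup H wreath"
    by (rule galois_image_subgroup[OF group_wreath bij_root[OF r] _ wreath_act_mult faithful real]) auto
  show "galois_group (octic a b) \<cong> wreath\<lparr>carrier := H\<rparr>"
    by (rule galois_image_iso[OF group_wreath bij_root[OF r] _ wreath_act_mult faithful real]) auto
qed

text \<open>The automorphism fixes \<open>r\<close>, and so does not exchange the orbits.\<close>

lemma sign_change_over_k:
  assumes r: "r \<notin> \<rat>" and z: "z\<^sup>2 \<in> k" "z \<notin> k" "z \<in> L"
  obtains v w \<sigma> where "realises \<sigma> (v, w, 0)" "(v, w, 0) \<in> H" "\<sigma> z = - z"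
proof -
  obtain \<sigma> where \<sigma>: "\<sigma> \<in> Gal" "\<sigma> z = - z" "\<sigma> r = r"
    using sign_change[OF k_subfield z] r_in_k in_L(1) by blast
  obtain v w s where R: "realises \<sigma> (v, w, s)" "(v, w, s) \<in> H" using exists_realised[OF r \<sigma>(1)] .
  have "r \<noteq> 0" using r by auto
  then have "s = 0" using realises_signs(1)[OF R(1)] \<sigma>(3) sign_bit_fixed[of r s] by simp
  then show ?thesis using that R \<sigma>(2) by blast
qed

lemma swap_exists:
  assumes r: "r \<notin> \<rat>"
  obtains x y where "(x, y, 1) \<in> H"
proof -
  have "r\<^sup>2 \<in> \<rat>" by (simp add: r_square)
  then obtain \<sigma> where \<sigma>: "\<sigma> \<in> Gal" "\<sigma> r = - r" using sign_change[OF rat_subfield _ r in_L(1)] by blast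
  obtain v w s where R: "realises \<sigma> (v, w, s)" "(v, w, s) \<in> H" using exists_realised[OF r \<sigma>(1)] .
  have "r \<noteq> 0" using r by auto
  then have "s = 1" using realises_signs(1)[OF R(1)] \<sigma>(2) sign_bit_flipped[of r s] by simp
  then show ?thesis using that R by blast
qed

lemma plus_minus_nonzero:
  assumes "r \<notin> \<rat>"
  shows "plus_inv \<alpha> \<noteq> 0" "plus_inv \<beta> \<noteq> 0" "minus_inv \<alpha> \<noteq> 0" "minus_inv \<beta> \<noteq> 0"
proof -
  have *: "pair_sum x \<notin> \<rat> \<Longrightarrow> x \<noteq> 0 \<Longrightarrow> plus_inv x \<noteq> 0 \<and> minus_inv x \<noteq> 0" for x
  proof -
    assume x: "pair_sum x \<notin> \<rat>" "x \<noteq> 0"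
    then have "pair_sum x \<noteq> -2" "pair_sum x \<noteq> 2" by (metis Rats_number_of Rats_minus_iff, metis Rats_number_of)
    then show ?thesis using plus_inv_square[OF x(2)] minus_inv_square[OF x(2)] by (auto simp: eq_neg_iff_add_eq_0)
  qed
  show "plus_inv \<alpha> \<noteq> 0" "plus_inv \<beta> \<noteq> 0" "minus_inv \<alpha> \<noteq> 0" "minus_inv \<beta> \<noteq> 0"
    using *[OF pair_sum_not_rational(1)[OF assms] nonzero(1)] *[OF pair_sum_not_rational(2)[OF assms] nonzero(2)] by auto
qed

lemma squares_in_k: "(plus_inv \<alpha>)\<^sup>2 \<in> k" "(plus_inv \<beta>)\<^sup>2 \<in> k" "(minus_inv \<alpha>)\<^sup>2 \<in> k" "(minus_inv \<beta>)\<^sup>2 \<in> k"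
  using pair_sum_in_k subfield_closed(3,7,11)[OF k_subfield] nonzero
  by (simp_all add: plus_inv_square minus_inv_square)

text \<open>Negating \<open>A(\<alpha>)\<close>, \<open>B(\<alpha>)\<close> and \<open>A(\<alpha>) B(\<alpha>)\<close> over \<open>k\<close> shows that the elements of \<open>V\<close> realised on the
  first orbit do not all lie in one of the three subgroups of index 2; so every element of \<open>V\<close> is
  realised. An automorphism that negates \<open>r\<close> reaches the second orbit.\<close>

lemma transitive_H:
  assumes nd: nondegenerate
  shows "transitive_subgroup H"
proof -
  have r: "r \<notin> \<rat>" using nd by (simp add: nondegenerate_def)
  note sub = H_subgroup[OF r]
  interpret W: group "wreath :: ((bit \<times> bit) \<times> (bit \<times> bit) \<times> bit) monoid" by (rule group_wreath)
  note nz = plus_minus_nonzero[OF r]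
  have add: "(v + v', w + w', 0) \<in> H" if "(v, w, 0) \<in> H" "(v', w', 0) \<in> H" for v w v' w'
    using subgroup.m_closed[OF sub that] by simp
  obtain v1 w1 where 1: "(v1, w1, 0) \<in> H" "fst v1 = 1"
  proof -
    obtain v w \<sigma> where "realises \<sigma> (v, w, 0)" "(v, w, 0) \<in> H" "\<sigma> (plus_inv \<alpha>) = - plus_inv \<alpha>"
      using sign_change_over_k[OF r squares_in_k(1) _ in_L(2)] nd unfolding nondegenerate_def by blast
    then show ?thesis using that realises_signs(4)[of \<sigma> v w 0] sign_bit_flipped[OF nz(1)] by simp
  qed
  obtain v2 w2 where 2: "(v2, w2, 0) \<in> H" "fst v2 + snd v2 = 1"
  proof -
    obtain v w \<sigma> where "realises \<sigma> (v, w, 0)" "(v, w, 0) \<in> H" "\<sigma> (minus_inv \<alpha>) = - minus_inv \<alpha>"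
      using sign_change_over_k[OF r squares_in_k(3) _ in_L(4)] nd unfolding nondegenerate_def by blast
    then show ?thesis using that realises_signs(6)[of \<sigma> v w 0] sign_bit_flipped[OF nz(3)] by simp
  qed
  obtain v3 w3 where 3: "(v3, w3, 0) \<in> H" "snd v3 = 1"
  proof -
    let ?z = "plus_inv \<alpha> * minus_inv \<alpha>"
    have "?z\<^sup>2 \<in> k" unfolding power_mult_distrib by (intro subfield_mult[OF k_subfield] squares_in_k)
    moreover have "?z \<in> L" by (intro L_closed in_L)
    ultimately obtain v w \<sigma> where R: "realises \<sigma> (v, w, 0)" "(v, w, 0) \<in> H" "\<sigma> ?z = - ?z"
      using sign_change_over_k[OF r] nd unfolding nondegenerate_def by blast
    then have "\<sigma> \<in> Gal" by (simp add: realises_def)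
    then have "\<sigma> ?z = sign_bit (fst v + (fst v + snd v)) * ?z"
      using realises_signs(4,6)[OF R(1)] field_hom_mult[OF adjoin_subfield galois_hom[OF \<open>\<sigma> \<in> Gal\<close>] in_L(2,4)]
      by (cases "fst v") (simp_all add: sign_bit_add)
    then have "snd v = 1" using R(3) nz sign_bit_flipped[of ?z "snd v"] by simp
    then show ?thesis using that R(2) by blast
  qed
  have zero: "(0, 0, 0) \<in> H" using subgroup.one_closed[OF sub] by simp
  have base: "\<exists>w. (v, w, 0) \<in> H" for v
  proof -
    have "\<exists>k l w w'. (k, w, 0) \<in> H \<and> (l, w', 0) \<in> H \<and> k \<noteq> 0 \<and> l \<noteq> 0 \<and> l \<noteq> k"
      using 1 2 3 bit_pair_cases[of v1] bit_pair_cases[of v2] bit_pair_cases[of v3] by fastforce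
    then obtain k l w w' where kl: "(k, w, 0) \<in> H" "(l, w', 0) \<in> H" "k \<noteq> 0" "l \<noteq> 0" "l \<noteq> k" by blast
    then show ?thesis
      using independent_span[OF kl(3-5), of v] zero add[OF kl(1,2)] by blast
  qed
  obtain x y where xy: "(x, y, 1) \<in> H" using swap_exists[OF r] .
  have reach: "\<exists>h\<in>H. wreath_act h (0, 0) = j" for j
  proof -
    obtain u i where j: "j = (u, i)" by (metis surj_pair)
    show ?thesis
    proof (cases "i = 0")
      case True
      obtain w where "(u, w, 0) \<in> H" using base by blast
      then show ?thesis using True by (intro bexI[of _ "(u, w, 0)"]) (simp_all add: j wreath_act_def)
    next
      case False
      obtain w where "(u + y, w, 0) \<in> H" using base by blast
      from subgroup.m_closed[OF sub xy this] have "(x + w, y + (u + y), 1) \<in> H" by simp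
      then show ?thesis using False
        by (intro bexI[of _ "(x + w, y + (u + y), 1)"]) (simp_all add: j wreath_act_def ac_simps)
    qed
  qed
  have "\<exists>h\<in>H. wreath_act h i = j" for i j
  proof -
    obtain g h where g: "g \<in> H" "wreath_act g (0, 0) = i" and h: "h \<in> H" "wreath_act h (0, 0) = j"
      using reach by blast
    let ?h = "h \<otimes>\<^bsub>wreath\<^esub> inv\<^bsub>wreath\<^esub> g"
    have "wreath_act ?h i = wreath_act (?h \<otimes>\<^bsub>wreath\<^esub> g) (0, 0)" by (simp add: wreath_act_mult g(2))
    also have "?h \<otimes>\<^bsub>wreath\<^esub> g = h" using W.inv_solve_right' by (simp add: W.m_assoc)
    finally show ?thesis
      using subgroup.m_closed[OF sub h(1) subgroup.m_inv_closed[OF sub g(1)]] h(2) by (intro bexI[of _ ?h]) auto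
  qed
  then show ?thesis unfolding transitive_subgroup_def using sub by blast
qed

lemma galois_transitive:
  assumes nd: nondegenerate and x: "x \<in> complex_roots (octic a b)" "y \<in> complex_roots (octic a b)"
  shows "\<exists>\<sigma>\<in>Gal. \<sigma> x = y"
proof -
  obtain i j where ij: "x = labelled_root i" "y = labelled_root j" using x roots_eq_range by blast
  obtain h where "h \<in> H" "wreath_act h i = j"
    using transitive_H[OF nd] unfolding transitive_subgroup_def by blast
  then show ?thesis unfolding H_iff realises_def ij by metis
qed

lemma degree_octic: "degree (octic a b) = 8"
  by (simp add: octic_def)

text \<open>A rational factor vanishing at \<open>\<alpha>\<close> vanishes at all eight conjugates of \<open>\<alpha>\<close>.\<close>

lemma octic_irreducible:
  assumes nd: nondegenerate
  shows "Factorial_Ring.irreducible (octic a b)"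
proof (rule Factorial_Ring.irreducibleI)
  show "octic a b \<noteq> 0" by (rule octic_nonzero)
  show "\<not> octic a b dvd 1" by (auto simp: degree_octic dest: dvd_imp_degree_le)
  have r: "r \<notin> \<rat>" using nd by (simp add: nondegenerate_def)
  have unit: "q dvd 1" if pq: "octic a b = p * q" and \<alpha>_root: "\<alpha> \<in> complex_roots p" for p q
  proof -
    have nz: "p \<noteq> 0" "q \<noteq> 0" using pq octic_nonzero by auto
    have "complex_roots (octic a b) \<subseteq> complex_roots p"
    proof
      fix y assume y: "y \<in> complex_roots (octic a b)"
      have "\<alpha> \<in> complex_roots (octic a b)" using root_in_roots \<alpha>\<beta>_eq_root by metis
      then obtain \<sigma> where \<sigma>: "\<sigma> \<in> Gal" "\<sigma> \<alpha> = y" using galois_transitive[OF nd _ y] by blast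
      then show "y \<in> complex_roots p"
        using hom_maps_roots[OF adjoin_subfield galois_hom[OF \<sigma>(1)] \<alpha>\<beta>_in_L(1) \<alpha>_root] by simp
    qed
    then have "8 \<le> card (complex_roots p)"
      using card_mono[OF complex_roots_finite[OF nz(1)]] card_roots[OF r] by metis
    also have "\<dots> \<le> degree (map_poly of_rat p :: complex poly)"
      unfolding complex_roots_def by (rule card_poly_roots_bound) (simp add: map_poly_eq_0_iff nz)
    also have "\<dots> = degree p" by (simp add: degree_map_poly)
    finally have "degree q = 0" using degree_mult_eq[OF nz] degree_octic by (simp flip: pq)
    then show ?thesis using nz(2) by (simp add: is_unit_iff_degree)
  qed
  fix p q assume pq: "octic a b = p * q"
  have "\<alpha> \<in> complex_roots (octic a b)" using root_in_roots \<alpha>\<beta>_eq_root by metis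
  then have "\<alpha> \<in> complex_roots p \<or> \<alpha> \<in> complex_roots q"
    unfolding complex_roots_def pq by (simp add: eval_rat_mult)
  then show "p dvd 1 \<or> q dvd 1" using unit[of p q] unit[of q p] pq by (auto simp: mult.commute)
qed

lemma root_degree_ge_8:
  assumes irr: "Factorial_Ring.irreducible (octic a b)" and p: "p \<noteq> 0" "eval_rat p \<alpha> = 0"
  shows "8 \<le> degree p"
proof -
  have \<alpha>: "eval_rat (octic a b) \<alpha> = 0"
    using root_in_roots \<alpha>\<beta>_eq_root unfolding complex_roots_def by (metis mem_Collect_eq)
  have "\<not> coprime (octic a b) p"
  proof
    assume "coprime (octic a b) p"
    then obtain u v where "u * octic a b + v * p = 1"
      by (metis bezout_coefficients_fst_snd coprime_iff_gcd_eq_1)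
    then have "eval_rat (u * octic a b + v * p) \<alpha> = 1" by simp
    then show False using p(2) \<alpha> by (simp add: eval_rat_add eval_rat_mult)
  qed
  then have "octic a b dvd p"
    using irr by (metis irreducible_imp_prime_elem prime_elem_imp_coprime)
  then show ?thesis using dvd_imp_degree_le[OF _ p(1)] degree_octic by metis
qed

text \<open>If a condition fails, \<open>\<alpha>\<close> is a root of a quartic over \<open>\<rat>\<close>: an equation
  \<open>X = (s + t r) Y\<close> gives \<open>(X - s Y)\<^sup>2 = t\<^sup>2 r\<^sup>2 Y\<^sup>2\<close>, in which \<open>r\<close> no longer occurs.\<close>

lemma nondegenerate_if_irreducible:
  assumes irr: "Factorial_Ring.irreducible (octic a b)"
  shows nondegenerate
proof -
  have no_root: False if "eval_rat [:c0, c1, c2, c3, 1:] \<alpha> = 0" for c0 c1 c2 c3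
    using root_degree_ge_8[OF irr, of "[:c0, c1, c2, c3, 1:]"] that by simp
  have eval: "eval_rat [:c0, c1, c2, c3, 1:] x = of_rat c0 + of_rat c1 * x + of_rat c2 * x\<^sup>2 + of_rat c3 * x ^ 3 + x ^ 4"
    for c0 c1 c2 c3 x by (simp add: map_poly_pCons eval_nat_numeral algebra_simps)
  define d where "d = a\<^sup>2 - 4 * b + 8"
  have d: "r * r = of_rat d" using r_square by (simp add: d_def power2_eq_square)
  have inv: "inverse \<alpha> * \<alpha> = 1" using nonzero by simp
  have r: "r \<notin> \<rat>"
  proof
    assume "r \<in> \<rat>"
    then obtain q where "r = of_rat q" by (auto elim: Rats_cases)
    then have ps: "pair_sum \<alpha> = of_rat ((q - a) / 2)"
      using pair_sum_via_r(1) by (simp add: of_rat_diff of_rat_divide)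
    have "\<alpha>\<^sup>2 * pair_sum \<alpha> = \<alpha> ^ 4 + 1"
      using nonzero(1) by (simp add: pair_sum_def field_simps power2_eq_square power4_eq_xxxx)
    then have "eval_rat [:1, 0, - ((q - a) / 2), 0, 1:] \<alpha> = 0"
      unfolding eval ps by (simp add: of_rat_minus algebra_simps)
    then show False by (rule no_root)
  qed
  moreover have "plus_inv \<alpha> \<notin> k"
  proof
    assume "plus_inv \<alpha> \<in> k"
    then obtain s t where st: "plus_inv \<alpha> = of_rat s + of_rat t * r" using k_coordinates[OF r] by blast
    then have "(\<alpha> + inverse \<alpha>) * \<alpha> = (of_rat s + of_rat t * r) * \<alpha>" by (simp add: plus_inv_def)
    then have "\<alpha> * \<alpha> + 1 - of_rat s * \<alpha> = of_rat t * r * \<alpha>"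
      using inv by (simp add: distrib_right left_diff_distrib algebra_simps)
    from square_relation[OF this d] have "eval_rat [:1, - 2 * s, 2 + s * s - d * t * t, - 2 * s, 1:] \<alpha> = 0"
      unfolding eval by (simp add: of_rat_minus of_rat_mult of_rat_add of_rat_diff eval_nat_numeral algebra_simps)
    then show False by (rule no_root)
  qed
  moreover have "minus_inv \<alpha> \<notin> k"
  proof
    assume "minus_inv \<alpha> \<in> k"
    then obtain s t where st: "minus_inv \<alpha> = of_rat s + of_rat t * r" using k_coordinates[OF r] by blast
    then have "(\<alpha> - inverse \<alpha>) * \<alpha> = (of_rat s + of_rat t * r) * \<alpha>" by (simp add: minus_inv_def)
    then have "\<alpha> * \<alpha> - 1 - of_rat s * \<alpha> = of_rat t * r * \<alpha>"
      using inv by (simp add: distrib_right left_diff_distrib algebra_simps)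
    from square_relation[OF this d] have "eval_rat [:1, 2 * s, s * s - d * t * t - 2, - 2 * s, 1:] \<alpha> = 0"
      unfolding eval by (simp add: of_rat_minus of_rat_mult of_rat_add of_rat_diff eval_nat_numeral algebra_simps)
    then show False by (rule no_root)
  qed
  moreover have "plus_inv \<alpha> * minus_inv \<alpha> \<notin> k"
  proof
    assume "plus_inv \<alpha> * minus_inv \<alpha> \<in> k"
    then have "(plus_inv \<alpha> * minus_inv \<alpha> + pair_sum \<alpha>) / 2 \<in> k"
      using subfield_add[OF k_subfield _ pair_sum_in_k(1)]
        subfield_divide[OF k_subfield _ subfield_numeral[OF k_subfield]] by blast
    moreover have "(plus_inv \<alpha> * minus_inv \<alpha> + pair_sum \<alpha>) / 2 = \<alpha>\<^sup>2"
      by (simp add: plus_inv_def minus_inv_def pair_sum_def power2_eq_square algebra_simps)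
    ultimately obtain s t where "\<alpha>\<^sup>2 = of_rat s + of_rat t * r" using k_coordinates[OF r] by metis
    then have "\<alpha> * \<alpha> - of_rat s = of_rat t * r * 1" by (simp add: power2_eq_square)
    from square_relation[OF this d] have "eval_rat [:s * s - d * t * t, 0, - 2 * s, 0, 1:] \<alpha> = 0"
      unfolding eval by (simp add: of_rat_minus of_rat_mult of_rat_add of_rat_diff eval_nat_numeral algebra_simps)
    then show False by (rule no_root)
  qed
  ultimately show ?thesis by (simp add: nondegenerate_def)
qed

text \<open>The roots of the quartic are the squares of those of the octic, and an automorphism of its
  splitting field extends to the splitting field of the octic. So its group is the image of \<open>H\<close>.\<close>

definition labelled_square :: "bit \<times> bit \<Rightarrow> complex" where
  "labelled_square = (\<lambda>(v, i). (labelled_root ((0, v), i))\<^sup>2)"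

abbreviation "K \<equiv> galois_image (quartic a b) UNIV labelled_square wreath wreath_act"

lemma root_square: "(labelled_root (u, i))\<^sup>2 = labelled_square (snd u, i)"
  by (simp add: labelled_root_def labelled_square_def V_act_square)

lemma quartic_roots: "complex_roots (quartic a b) = range labelled_square"
proof -
  have "y \<in> complex_roots (quartic a b) \<longleftrightarrow> (\<exists>z\<in>complex_roots (octic a b). y = z\<^sup>2)" for y
  proof -
    have "csqrt y ^ 2 = y" by simp
    then show ?thesis unfolding complex_roots_def by (metis mem_Collect_eq poly_quartic_square)
  qed
  then have "complex_roots (quartic a b) = (\<lambda>z. z\<^sup>2) ` range labelled_root"
    unfolding roots_eq_range by blast
  also have "\<dots> = range labelled_square"
  proof
    show "(\<lambda>z. z\<^sup>2) ` range labelled_root \<subseteq> range labelled_square"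
      by (auto simp: root_square)
    show "range labelled_square \<subseteq> (\<lambda>z. z\<^sup>2) ` range labelled_root"
      by (auto simp: labelled_square_def)
  qed
  finally show ?thesis .
qed

lemma bij_labelled_square:
  assumes r: "r \<notin> \<rat>"
  shows "bij_betw labelled_square UNIV (complex_roots (quartic a b))"
proof -
  have "inj labelled_square"
  proof (rule injI)
    fix x y assume eq: "labelled_square x = labelled_square y"
    obtain v i w j where xy: "x = (v, i)" "y = (w, j)" by (metis surj_pair)
    have "(labelled_root ((0, v), i))\<^sup>2 = (labelled_root ((0, w), j))\<^sup>2" using eq by (simp add: xy labelled_square_def)
    then have "labelled_root ((0, v), i) = labelled_root ((0, w), j) \<or> labelled_root ((0, v), i) = - labelled_root ((0, w), j)"
      by (simp add: power2_eq_iff)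
    moreover have "- labelled_root ((0, w), j) = labelled_root ((1, w), j)" by (simp add: labelled_root_def V_act_def)
    ultimately show "x = y" using inj_root[OF r] by (auto simp: xy dest: injD)
  qed
  then show ?thesis using quartic_roots by (simp add: bij_betw_def)
qed

lemma quartic_nonzero: "quartic a b \<noteq> 0"
  by (simp add: quartic_def)

lemma quartic_field_in_L: "root_field (quartic a b) \<subseteq> L"
proof (rule adjoin_least[OF adjoin_subfield])
  show "complex_roots (quartic a b) \<subseteq> L"
    unfolding quartic_roots labelled_square_def using subfield_power[OF adjoin_subfield root_in_L] by auto
qed

lemma realises_square:
  assumes R: "realises \<sigma> h" and eq: "\<And>i. \<rho> (labelled_square i) = \<sigma> (labelled_square i)"
  shows "\<rho> (labelled_square i) = labelled_square (wreath_act (forget_sign h) i)"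
proof -
  obtain v j where i: "i = (v, j)" by (metis surj_pair)
  obtain x y s where h: "h = (x, y, s)" by (metis prod_cases3)
  have G: "\<sigma> \<in> Gal" using R by (simp add: realises_def)
  have "\<rho> (labelled_square i) = (\<sigma> (labelled_root ((0, v), j)))\<^sup>2"
    using eq[of i] field_hom_power[OF adjoin_subfield galois_hom[OF G] root_in_L] by (simp add: i labelled_square_def)
  also have "\<dots> = (labelled_root (wreath_act h ((0, v), j)))\<^sup>2" using R by (simp add: realises_def)
  also have "\<dots> = labelled_square (wreath_act (forget_sign h) i)"
    by (cases "j + s = 0") (simp_all add: h i wreath_act_def forget_sign_def root_square)
  finally show ?thesis .
qed

lemma quartic_group_iso:
  assumes r: "r \<notin> \<rat>"
  shows "galois_group (quartic a b) \<cong> wreath\<lparr>carrier := forget_sign ` H\<rparr>"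
proof -
  let ?M = "root_field (quartic a b)" and ?G = "carrier (galois_group (quartic a b))"
  have in_M: "labelled_square i \<in> ?M" for i using quartic_roots adjoin_superset by blast
  have lift: "\<exists>h\<in>H. \<forall>i. \<rho> (labelled_square i) = labelled_square (wreath_act (forget_sign h) i)" if \<rho>: "\<rho> \<in> ?G" for \<rho>
  proof -
    obtain \<sigma> where \<sigma>: "\<sigma> \<in> Gal" "\<forall>x\<in>?M. x \<in> L \<longrightarrow> \<sigma> x = \<rho> x"
      using extend_to_galois_group[OF adjoin_subfield galois_hom[OF \<rho>]] by blast
    obtain v w s where R: "realises \<sigma> (v, w, s)" "(v, w, s) \<in> H" using exists_realised[OF r \<sigma>(1)] .
    have "\<rho> (labelled_square i) = \<sigma> (labelled_square i)" for i
      using \<sigma>(2) in_M quartic_field_in_L by (metis subsetD)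
    then show ?thesis using realises_square[OF R(1)] R(2) by blast
  qed
  have "K = forget_sign ` H"
  proof
    show "K \<subseteq> forget_sign ` H"
    proof
      fix g assume "g \<in> K"
      then obtain \<rho> where \<rho>: "\<rho> \<in> ?G" "\<forall>i. \<rho> (labelled_square i) = labelled_square (wreath_act g i)"
        unfolding galois_image_def by blast
      obtain h where h: "h \<in> H" "\<forall>i. \<rho> (labelled_square i) = labelled_square (wreath_act (forget_sign h) i)"
        using lift[OF \<rho>(1)] by blast
      have "wreath_act g i = wreath_act (forget_sign h) i" for i
        using \<rho>(2) h(2) bij_betw_imp_inj_on[OF bij_labelled_square[OF r]] by (metis injD)
      then have "g = forget_sign h" by (rule wreath_act_faithful)
      then show "g \<in> forget_sign ` H" using h(1) by blast
    qed
    show "forget_sign ` H \<subseteq> K"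
    proof
      fix g assume "g \<in> forget_sign ` H"
      then obtain h where h: "h \<in> H" "g = forget_sign h" by blast
      then obtain \<sigma> where R: "realises \<sigma> h" using H_iff by blast
      then have "\<sigma> \<in> Gal" by (simp add: realises_def)
      then have "restrict \<sigma> ?M \<in> ?G"
        by (intro restrict_hom_in_galois_group[OF quartic_nonzero adjoin_subfield quartic_field_in_L galois_hom])
      moreover have "restrict \<sigma> ?M (labelled_square i) = labelled_square (wreath_act g i)" for i
        unfolding h(2) by (rule realises_square[OF R]) (simp add: in_M)
      ultimately show "g \<in> K" unfolding galois_image_def wreath_simps by blast
    qed
  qed
  moreover have real: "\<exists>g\<in>carrier wreath. \<forall>i\<in>UNIV. \<rho> (labelled_square i) = labelled_square (wreath_act g i)" if \<rho>: "\<rho> \<in> ?G" for \<rho>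
  proof -
    obtain h where "\<forall>i. \<rho> (labelled_square i) = labelled_square (wreath_act (forget_sign h) i)" using lift[OF \<rho>] by blast
    then show ?thesis by (intro bexI[of _ "forget_sign h"]) (blast, simp)
  qed
  have faithful: "\<And>g h. (\<And>i. i \<in> UNIV \<Longrightarrow> wreath_act g i = wreath_act h i) \<Longrightarrow> g = h"
    by (rule wreath_act_faithful) simp
  have "galois_group (quartic a b) \<cong> wreath\<lparr>carrier := K\<rparr>"
    by (rule galois_image_iso[OF group_wreath bij_labelled_square[OF r] _ wreath_act_mult faithful real]) auto
  ultimately show ?thesis by simp
qed

lemma octic_type:
  assumes nd: nondegenerate and iso: "wreath\<lparr>carrier := H\<rparr> \<cong> G"
  shows "galois_type (octic a b) 8 (transitive_class 8 G)"
proof -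
  have r: "r \<notin> \<rat>" using nd by (simp add: nondegenerate_def)
  show ?thesis
    by (rule galois_typeI[OF octic_nonzero card_roots[OF r] galois_transitive[OF nd]
          iso_trans[OF galois_group_iso[OF r] iso]])
qed

end

theorem galois_types_of_irreducible_octic:
  assumes irr: "Factorial_Ring.irreducible (octic a b)"
  defines "Q \<equiv> galois_group (quartic a b)" and "type \<equiv> galois_type (octic a b) 8"
  shows "Q \<cong> E4 \<Longrightarrow> type T8_2 \<or> type T8_3 \<or> type T8_4 \<or> type T8_9"
    and "Q \<cong> C4 \<Longrightarrow> type T8_2 \<or> type T8_10"
    and "Q \<cong> D4 \<Longrightarrow> type T8_4 \<or> type T8_9 \<or> type T8_10 \<or> type T8_18"
proof -
  obtain \<alpha> \<beta> where "octic_roots a b \<alpha> \<beta>" using octic_roots_exist by blast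
  then interpret octic_roots a b \<alpha> \<beta> .
  have nd: nondegenerate by (rule nondegenerate_if_irreducible[OF irr])
  then have r: "r \<notin> \<rat>" by (simp add: nondegenerate_def)
  let ?K = "wreath\<lparr>carrier := forget_sign ` H\<rparr>" and ?W = "wreath\<lparr>carrier := H\<rparr>"
  note type = octic_type[OF nd, folded type_def]
  note sym = group.iso_sym[OF group_galois_group[of "quartic a b"], folded Q_def]
  note K = quartic_group_iso[OF r, folded Q_def]
  note pairs = transitive_subgroup_pairs[OF transitive_H[OF nd]]
  note types = T8_2_def T8_3_def T8_4_def T8_9_def T8_10_def T8_18_def
  have W: "?W \<cong> C4 \<times>\<times> C2 \<Longrightarrow> type T8_2" "?W \<cong> C2 \<times>\<times> C2 \<times>\<times> C2 \<Longrightarrow> type T8_3" "?W \<cong> D4 \<Longrightarrow> type T8_4"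
    "?W \<cong> C2 \<times>\<times> D4 \<Longrightarrow> type T8_9" "?W \<cong> E4_semidirect_C4 \<Longrightarrow> type T8_10" "?W \<cong> E4_wreath_C2 \<Longrightarrow> type T8_18"
    unfolding types by (rule type, assumption)+
  have "type T8_2 \<or> type T8_3 \<or> type T8_4 \<or> type T8_9" if "\<not> ?K \<cong> C4" "\<not> ?K \<cong> D4"
    using pairs that W by satx
  moreover have "type T8_2 \<or> type T8_10" if "\<not> ?K \<cong> E4" "\<not> ?K \<cong> D4"
    using pairs that W by satx
  moreover have "type T8_4 \<or> type T8_9 \<or> type T8_10 \<or> type T8_18" if "\<not> ?K \<cong> E4" "\<not> ?K \<cong> C4"
    using pairs that W by satx
  moreover have "\<not> ?K \<cong> C4" "\<not> ?K \<cong> D4" if "Q \<cong> E4"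
    using iso_trans[OF sym[OF that] iso_trans[OF K]] not_iso_E4_C4 not_iso_D4(1) by blast+
  moreover have "\<not> ?K \<cong> E4" if "Q \<cong> C4"
    using iso_trans[OF sym[OF iso_trans[OF K]] that] not_iso_E4_C4 by blast
  moreover have "\<not> ?K \<cong> D4" if "Q \<cong> C4"
    using iso_trans[OF sym[OF that] iso_trans[OF K]] not_iso_D4(2) by blast
  moreover have "\<not> ?K \<cong> E4" "\<not> ?K \<cong> C4" if "Q \<cong> D4"
    using iso_trans[OF sym[OF iso_trans[OF K]] that] not_iso_D4 by blast+
  ultimately show "Q \<cong> E4 \<Longrightarrow> type T8_2 \<or> type T8_3 \<or> type T8_4 \<or> type T8_9"
    and "Q \<cong> C4 \<Longrightarrow> type T8_2 \<or> type T8_10"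
    and "Q \<cong> D4 \<Longrightarrow> type T8_4 \<or> type T8_9 \<or> type T8_10 \<or> type T8_18"
    by blast+
qed

section \<open>Reading off the groups from squares\<close>

definition is_sq :: "rat \<Rightarrow> bool" where
  "is_sq x \<longleftrightarrow> (\<exists>y. y\<^sup>2 = x)"

text \<open>The square of \<open>r\<close>, and the values of the quartic at \<open>-1\<close> and \<open>1\<close>.\<close>

definition disc :: "rat \<Rightarrow> rat \<Rightarrow> rat" where "disc a b = a\<^sup>2 - 4 * b + 8"
definition at_minus_one :: "rat \<Rightarrow> rat \<Rightarrow> rat" where "at_minus_one a b = b + 2 - 2 * a"
definition at_one :: "rat \<Rightarrow> rat \<Rightarrow> rat" where "at_one a b = b + 2 + 2 * a"

text \<open>A criterion for \<open>x + y \<surd>d\<close> not to be a square in \<open>\<rat>(\<surd>d)\<close>: if it is the square of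
  \<open>s + t \<surd>d\<close>, its norm \<open>x\<^sup>2 - d y\<^sup>2\<close> is the square of \<open>n = s\<^sup>2 - d t\<^sup>2\<close>, and \<open>(x + n) / 2 = s\<^sup>2\<close>.\<close>

definition no_root_in_k :: "rat \<Rightarrow> rat \<Rightarrow> rat \<Rightarrow> bool" where
  "no_root_in_k d x y \<longleftrightarrow> (\<forall>n. n\<^sup>2 = x\<^sup>2 - d * y\<^sup>2 \<longrightarrow> \<not> is_sq ((x + n) / 2))"

text \<open>The conditions on \<open>r\<close>, \<open>A(\<alpha>)\<^sup>2\<close>, \<open>B(\<alpha>)\<^sup>2\<close> and \<open>(A(\<alpha>) B(\<alpha>))\<^sup>2\<close> in terms of rational numbers.\<close>

definition regular :: "rat \<Rightarrow> rat \<Rightarrow> bool" where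
  "regular a b \<longleftrightarrow> \<not> is_sq (disc a b) \<and> no_root_in_k (disc a b) (2 - a / 2) (1 / 2)
     \<and> no_root_in_k (disc a b) (- 2 - a / 2) (1 / 2) \<and> no_root_in_k (disc a b) (a\<^sup>2 / 2 - b - 2) (- a / 2)"

lemma not_sq_negative: "x < 0 \<Longrightarrow> \<not> is_sq x"
  unfolding is_sq_def by (metis not_less zero_le_power2)

lemma rat_square_int:
  assumes "(y :: rat)\<^sup>2 = of_int n"
  shows "\<exists>m. n = m\<^sup>2"
proof -
  obtain p q where pq: "quotient_of y = (p, q)" by fastforce
  have y: "y = of_int p / of_int q" using quotient_of_div[OF pq] .
  have q: "q > 0" "coprime p q" using quotient_of_denom_pos[OF pq] quotient_of_coprime[OF pq] by auto
  have "of_int (p\<^sup>2) = (of_int (n * q\<^sup>2) :: rat)"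
    using assms q(1) by (simp add: y power_divide field_simps)
  then have eq: "p\<^sup>2 = n * q\<^sup>2" by (simp only: of_int_eq_iff)
  have "coprime (p\<^sup>2) (q\<^sup>2)" using q(2) by simp
  then have "q\<^sup>2 dvd 1" using eq by (metis coprime_common_divisor dvd_refl dvd_triv_right)
  then have "q\<^sup>2 = 1" by simp
  then show ?thesis using eq by auto
qed

text \<open>The factor \<open>c\<close> clears denominators: \<open>n\<close> lies strictly between two consecutive squares.\<close>

lemma not_sq_between:
  assumes "x * (of_int c)\<^sup>2 = of_int n" "0 \<le> m" "m\<^sup>2 < n" "n < (m + 1)\<^sup>2"
  shows "\<not> is_sq x"
proof
  assume "is_sq x"
  then obtain y where "y\<^sup>2 = x" unfolding is_sq_def by blast
  then have "(y * of_int c)\<^sup>2 = of_int n" using assms(1) by (simp add: power_mult_distrib)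
  then obtain l where l: "n = l\<^sup>2" using rat_square_int by blast
  then have less: "m\<^sup>2 < \<bar>l\<bar>\<^sup>2" "\<bar>l\<bar>\<^sup>2 < (m + 1)\<^sup>2" using assms(3,4) by simp_all
  have "m < \<bar>l\<bar>" by (rule power_less_imp_less_base[OF less(1)]) simp
  moreover have "\<bar>l\<bar> < m + 1" by (rule power_less_imp_less_base[OF less(2)]) (use assms(2) in simp)
  ultimately show False by simp
qed

lemma is_sqI: "y * y = x \<Longrightarrow> is_sq x"
  unfolding is_sq_def by (metis power2_eq_square)

lemma no_root_norm: "\<not> is_sq (x\<^sup>2 - d * y\<^sup>2) \<Longrightarrow> no_root_in_k d x y"
  unfolding no_root_in_k_def is_sq_def by metis

lemma no_root_halves:
  assumes "x\<^sup>2 - d * y\<^sup>2 = n\<^sup>2" "\<not> is_sq ((x + n) / 2)" "\<not> is_sq ((x - n) / 2)"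
  shows "no_root_in_k d x y"
  unfolding no_root_in_k_def
proof (intro allI impI)
  fix n' assume "n'\<^sup>2 = x\<^sup>2 - d * y\<^sup>2"
  then have "n' = n \<or> n' = - n" using assms(1) power2_eq_iff by metis
  then show "\<not> is_sq ((x + n') / 2)" using assms(2,3) by auto
qed

context
  fixes H :: "((bit \<times> bit) \<times> (bit \<times> bit) \<times> bit) set"
  assumes H: "transitive_subgroup H"
begin

lemma block_sums_zeroI:
  assumes "\<And>v w. (v, w, 0) \<in> H \<Longrightarrow> w = v"
  shows "block_sums H = {0}"
proof -
  have "d = 0" if d: "d \<in> block_sums H" for d
  proof -
    obtain v w where "d = v + w" "(v, w, 0) \<in> H" using d unfolding block_sums_def by blast
    then show ?thesis using assms[of v w] by simp
  qed
  moreover have "0 \<in> block_sums H" using block_sumsI[OF trans_zero[OF H]] by simp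
  ultimately show ?thesis by blast
qed

lemma block_sums_oneI:
  assumes "\<And>v w. (v, w, 0) \<in> H \<Longrightarrow> v + w \<in> {0, k}" "(v, w, 0) \<in> H" "w \<noteq> v"
  shows "block_sums H = {0, k}"
proof -
  have "d \<in> {0, k}" if d: "d \<in> block_sums H" for d
  proof -
    obtain v w where "d = v + w" "(v, w, 0) \<in> H" using d unfolding block_sums_def by blast
    then show ?thesis using assms(1)[of v w] by simp
  qed
  moreover have "0 \<in> block_sums H" using block_sumsI[OF trans_zero[OF H]] by simp
  moreover have "v + w \<in> block_sums H" by (rule block_sumsI[OF assms(2)])
  moreover have "v + w \<noteq> 0" using assms(3) add_eq_0_V by metis
  ultimately show ?thesis by blast
qed

end

context octic_roots
begin

lemma r_square_disc: "r * r = of_rat (disc a b)"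
  using r_square by (simp add: disc_def power2_eq_square)

lemma r_rational_iff: "r \<in> \<rat> \<longleftrightarrow> is_sq (disc a b)"
proof
  assume "r \<in> \<rat>"
  then obtain q where "r = of_rat q" by (auto elim: Rats_cases)
  then have "(of_rat (q * q) :: complex) = of_rat (disc a b)" using r_square_disc by (simp only: of_rat_mult)
  then have "q\<^sup>2 = disc a b" by (simp only: of_rat_eq_iff power2_eq_square)
  then show "is_sq (disc a b)" unfolding is_sq_def by blast
next
  assume "is_sq (disc a b)"
  then obtain q where "q\<^sup>2 = disc a b" unfolding is_sq_def by blast
  then have "r\<^sup>2 = (of_rat q)\<^sup>2" using r_square_disc by (simp add: power2_eq_square flip: of_rat_mult)
  then have "r = of_rat q \<or> r = - of_rat q" by (rule power2_eq_iff[THEN iffD1])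
  then show "r \<in> \<rat>" by auto
qed

lemma coordinates_unique:
  assumes "r \<notin> \<rat>" "of_rat s + of_rat t * r = of_rat x + of_rat y * r"
  shows "s = x \<and> t = y"
proof -
  have "r\<^sup>2 \<in> \<rat>" by (simp add: r_square)
  then show ?thesis
    using sqrt_coordinates[OF rat_subfield _ assms(1), of "of_rat s" "of_rat t" "of_rat x" "of_rat y"] assms(2) by simp
qed

lemma not_in_k:
  assumes r: "r \<notin> \<rat>" and z: "z\<^sup>2 = of_rat x + of_rat y * r" and no: "no_root_in_k (disc a b) x y"
  shows "z \<notin> k"
proof
  assume "z \<in> k"
  then obtain s t where st: "z = of_rat s + of_rat t * r" using k_coordinates[OF r] by blast
  have "z\<^sup>2 = of_rat s * of_rat s + of_rat t * of_rat t * (r * r) + 2 * of_rat s * of_rat t * r"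
    unfolding st by (simp add: power2_eq_square algebra_simps)
  then have "of_rat (s\<^sup>2 + disc a b * t\<^sup>2) + of_rat (2 * s * t) * r = of_rat x + of_rat y * r"
    unfolding z r_square_disc by (simp add: of_rat_add of_rat_mult power2_eq_square algebra_simps)
  then have xy: "x = s\<^sup>2 + disc a b * t\<^sup>2" "y = 2 * s * t" using coordinates_unique[OF r] by auto
  let ?n = "s\<^sup>2 - disc a b * t\<^sup>2"
  have "?n\<^sup>2 = x\<^sup>2 - disc a b * y\<^sup>2" unfolding xy by (simp add: power2_eq_square algebra_simps)
  moreover have "is_sq ((x + ?n) / 2)" unfolding is_sq_def xy by (intro exI[of _ s]) simp
  ultimately show False using no unfolding no_root_in_k_def by blast
qed

lemma in_k:
  assumes "z\<^sup>2 = of_rat x + of_rat y * r" "s\<^sup>2 + disc a b * t\<^sup>2 = x" "2 * s * t = y"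
  shows "z \<in> k"
proof -
  have "z\<^sup>2 = (of_rat s + of_rat t * r)\<^sup>2"
    unfolding assms(1) assms(2,3)[symmetric] using r_square_disc
    by (simp add: of_rat_add of_rat_mult power2_eq_square algebra_simps)
  then have "z = of_rat s + of_rat t * r \<or> z = - (of_rat s + of_rat t * r)" by (rule power2_eq_iff[THEN iffD1])
  moreover have "of_rat s + of_rat t * r \<in> k"
    using subfield_closed(4,7)[OF k_subfield] of_rat_in_k r_in_k by blast
  moreover from this have "- (of_rat s + of_rat t * r) \<in> k" by (rule subfield_uminus[OF k_subfield])
  ultimately show ?thesis by metis
qed

lemma pair_sum_shift: "pair_sum \<alpha> + of_rat c = of_rat (c - a / 2) + of_rat (1 / 2) * r"
    "pair_sum \<beta> + of_rat c = of_rat (c - a / 2) + of_rat (- 1 / 2) * r"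
  unfolding pair_sum_via_r by (simp_all add: of_rat_diff of_rat_divide of_rat_minus of_rat_mult field_simps)

lemma squares:
  "(plus_inv \<alpha>)\<^sup>2 = of_rat (2 - a / 2) + of_rat (1 / 2) * r"
  "(plus_inv \<beta>)\<^sup>2 = of_rat (2 - a / 2) + of_rat (- 1 / 2) * r"
  "(minus_inv \<alpha>)\<^sup>2 = of_rat (- 2 - a / 2) + of_rat (1 / 2) * r"
  "(minus_inv \<beta>)\<^sup>2 = of_rat (- 2 - a / 2) + of_rat (- 1 / 2) * r"
  using pair_sum_shift[of 2] pair_sum_shift[of "- 2"] nonzero
  by (simp_all add: plus_inv_square minus_inv_square of_rat_minus)

lemma k_mult:
  assumes "z = of_rat x + of_rat y * r" "w = of_rat x' + of_rat y' * r"
  shows "z * w = of_rat (x * x' + disc a b * y * y') + of_rat (x * y' + y * x') * r"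
proof -
  have "z * w = of_rat x * of_rat x' + of_rat y * of_rat y' * (r * r) + (of_rat x * of_rat y' + of_rat y * of_rat x') * r"
    unfolding assms by (simp add: algebra_simps)
  then show ?thesis unfolding r_square_disc by (simp add: of_rat_add of_rat_mult algebra_simps)
qed

lemma product_squares:
  "(plus_inv \<alpha> * plus_inv \<beta>)\<^sup>2 = of_rat (at_minus_one a b)"
  "(minus_inv \<alpha> * minus_inv \<beta>)\<^sup>2 = of_rat (at_one a b)"
  "(plus_inv \<alpha> * minus_inv \<alpha>)\<^sup>2 = of_rat (a\<^sup>2 / 2 - b - 2) + of_rat (- a / 2) * r"
  "(plus_inv \<beta> * minus_inv \<beta>)\<^sup>2 = of_rat (a\<^sup>2 / 2 - b - 2) + of_rat (a / 2) * r"
  "(plus_inv \<alpha> * minus_inv \<beta>)\<^sup>2 = of_rat (b - 6) + of_rat (- 2) * r"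
  unfolding power_mult_distrib k_mult[OF squares(1,2)] k_mult[OF squares(3,4)] k_mult[OF squares(1,3)]
    k_mult[OF squares(2,4)] k_mult[OF squares(1,4)]
  by (simp_all add: disc_def at_minus_one_def at_one_def power2_eq_square field_simps)

lemma nondegenerate_if_regular: "regular a b \<Longrightarrow> nondegenerate"
  unfolding regular_def nondegenerate_def r_rational_iff[symmetric]
  using not_in_k squares(1,3) product_squares(3) by metis

text \<open>An element \<open>z\<close> on which automorphisms act by signs given by \<open>\<chi>\<close>. In a base character this is only
  required of the automorphisms that do not exchange the orbits. If \<open>z\<close> lies in the base field,
  \<open>\<chi>\<close> vanishes; if only its square does, \<open>\<chi>\<close> takes the value 1 somewhere. This is how squares
  turn into statements about \<open>H\<close>.\<close>

definition base_character :: "complex \<Rightarrow> (bit \<times> bit \<Rightarrow> bit \<times> bit \<Rightarrow> bit) \<Rightarrow> bool" where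
  "base_character z \<chi> \<longleftrightarrow> z \<in> L \<and> z \<noteq> 0 \<and>
     (\<forall>\<sigma> v w. realises \<sigma> (v, w, 0) \<longrightarrow> \<sigma> z = sign_bit (\<chi> v w) * z)"

definition character :: "complex \<Rightarrow> (bit \<times> bit \<Rightarrow> bit \<times> bit \<Rightarrow> bit) \<Rightarrow> bool" where
  "character z \<chi> \<longleftrightarrow> z \<in> L \<and> z \<noteq> 0 \<and>
     (\<forall>\<sigma> v w s. realises \<sigma> (v, w, s) \<longrightarrow> \<sigma> z = sign_bit (\<chi> v w) * z)"

lemma character_mult:
  assumes "character z \<chi>" "character z' \<chi>'"
  shows "character (z * z') (\<lambda>v w. \<chi> v w + \<chi>' v w)"
  unfolding character_def
proof (intro conjI allI impI)
  show "z * z' \<in> L" "z * z' \<noteq> 0" using assms L_closed(4) by (auto simp: character_def)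
  fix \<sigma> v w s assume R: "realises \<sigma> (v, w, s)"
  then have G: "\<sigma> \<in> Gal" by (simp add: realises_def)
  have "z \<in> L" "z' \<in> L" "\<sigma> z = sign_bit (\<chi> v w) * z" "\<sigma> z' = sign_bit (\<chi>' v w) * z'"
    using assms R unfolding character_def by blast+
  then show "\<sigma> (z * z') = sign_bit (\<chi> v w + \<chi>' v w) * (z * z')"
    using field_hom_mult[OF adjoin_subfield galois_hom[OF G]] by (simp add: sign_bit_add)
qed

lemma base_character_mult:
  assumes "base_character z \<chi>" "base_character z' \<chi>'"
  shows "base_character (z * z') (\<lambda>v w. \<chi> v w + \<chi>' v w)"
  unfolding base_character_def
proof (intro conjI allI impI)
  show "z * z' \<in> L" "z * z' \<noteq> 0" using assms L_closed(4) by (auto simp: base_character_def)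
  fix \<sigma> v w assume R: "realises \<sigma> (v, w, 0)"
  then have G: "\<sigma> \<in> Gal" by (simp add: realises_def)
  have "z \<in> L" "z' \<in> L" "\<sigma> z = sign_bit (\<chi> v w) * z" "\<sigma> z' = sign_bit (\<chi>' v w) * z'"
    using assms R unfolding base_character_def by blast+
  then show "\<sigma> (z * z') = sign_bit (\<chi> v w + \<chi>' v w) * (z * z')"
    using field_hom_mult[OF adjoin_subfield galois_hom[OF G]] by (simp add: sign_bit_add)
qed

lemma
  assumes "r \<notin> \<rat>"
  shows character_plus: "character (plus_inv \<alpha> * plus_inv \<beta>) (\<lambda>v w. fst v + fst w)"
    and character_minus: "character (minus_inv \<alpha> * minus_inv \<beta>) (\<lambda>v w. fst v + snd v + (fst w + snd w))"
    and base_plus: "base_character (plus_inv \<alpha>) (\<lambda>v w. fst v)"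
    and base_minus: "base_character (minus_inv \<alpha>) (\<lambda>v w. fst v + snd v)"
    and base_plus': "base_character (plus_inv \<beta>) (\<lambda>v w. fst w)"
    and base_minus': "base_character (minus_inv \<beta>) (\<lambda>v w. fst w + snd w)"
  unfolding character_def base_character_def
  using in_L L_closed(4) plus_minus_nonzero[OF assms] realises_signs by auto

lemma base_character_trivial:
  assumes z: "base_character z \<chi>" "z \<in> k" and h: "(v, w, 0) \<in> H" and r: "r \<notin> \<rat>"
  shows "\<chi> v w = 0"
proof -
  obtain \<sigma> where R: "realises \<sigma> (v, w, 0)" using h H_iff by blast
  then have G: "\<sigma> \<in> Gal" by (simp add: realises_def)
  obtain s t where st: "z = of_rat s + of_rat t * r" using k_coordinates[OF r z(2)] .
  have "\<sigma> r = r" using realises_signs(1)[OF R] by simp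
  then have "\<sigma> z = z"
    unfolding st using field_hom_simps(2,3,10)[OF adjoin_subfield galois_hom[OF G]] L_closed(4,10) in_L(1) by simp
  then show ?thesis using z(1) R sign_bit_fixed[of z] unfolding base_character_def by metis
qed

lemma base_character_nontrivial:
  assumes z: "base_character z \<chi>" "z\<^sup>2 \<in> k" "z \<notin> k" and r: "r \<notin> \<rat>"
  shows "\<exists>v w. (v, w, 0) \<in> H \<and> \<chi> v w = 1"
proof -
  have zL: "z \<in> L" "z \<noteq> 0" using z(1) by (auto simp: base_character_def)
  obtain v w \<sigma> where R: "realises \<sigma> (v, w, 0)" "(v, w, 0) \<in> H" "\<sigma> z = - z"
    using sign_change_over_k[OF r z(2,3) zL(1)] .
  then have "\<chi> v w = 1" using z(1) sign_bit_flipped[OF zL(2)] unfolding base_character_def by metis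
  then show ?thesis using R(2) by blast
qed

lemma rational_root:
  assumes "z\<^sup>2 = of_rat p" "is_sq p"
  shows "z \<in> \<rat>"
proof -
  obtain q where "q\<^sup>2 = p" using assms(2) unfolding is_sq_def by blast
  then have "z\<^sup>2 = (of_rat q)\<^sup>2" using assms(1) by (simp flip: of_rat_power)
  then have "z = of_rat q \<or> z = - of_rat q" by (rule power2_eq_iff[THEN iffD1])
  then show ?thesis by auto
qed

lemma galois_fixes_rational: "\<sigma> \<in> Gal \<Longrightarrow> z \<in> \<rat> \<Longrightarrow> \<sigma> z = z"
  using field_hom_of_rat[OF adjoin_subfield galois_hom] by (auto elim!: Rats_cases)

lemma character_square:
  assumes z: "character z \<chi>" "z\<^sup>2 = of_rat p" and p: "is_sq p" and h: "(v, w, s) \<in> H"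
  shows "\<chi> v w = 0"
proof -
  obtain \<sigma> where R: "realises \<sigma> (v, w, s)" using h H_iff by blast
  then have "\<sigma> z = z" using galois_fixes_rational rational_root[OF z(2) p] by (simp add: realises_def)
  then show ?thesis using z(1) R sign_bit_fixed[of z] unfolding character_def by metis
qed

lemma character_twisted_square:
  assumes z: "character z \<chi>" "z\<^sup>2 = of_rat p" and p: "is_sq (p * disc a b)" and h: "(v, w, s) \<in> H" and r: "r \<notin> \<rat>"
  shows "\<chi> v w = s"
proof -
  obtain \<sigma> where R: "realises \<sigma> (v, w, s)" using h H_iff by blast
  then have G: "\<sigma> \<in> Gal" by (simp add: realises_def)
  have zL: "z \<in> L" "z \<noteq> 0" using z(1) by (auto simp: character_def)
  have "(z * r)\<^sup>2 = of_rat (p * disc a b)"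
    unfolding power_mult_distrib z(2) of_rat_mult r_square_disc[symmetric] by (simp add: power2_eq_square)
  then have "\<sigma> (z * r) = z * r" using galois_fixes_rational[OF G] rational_root p by blast
  moreover have "\<sigma> (z * r) = sign_bit (\<chi> v w + s) * (z * r)"
  proof -
    have "\<sigma> z = sign_bit (\<chi> v w) * z" using z(1) R unfolding character_def by blast
    then show ?thesis
      using realises_signs(1)[OF R] field_hom_mult[OF adjoin_subfield galois_hom[OF G] zL(1) in_L(1)]
      by (simp add: sign_bit_add)
  qed
  moreover have "r \<noteq> 0" using r by auto
  ultimately have "\<chi> v w + s = 0" using sign_bit_fixed[of "z * r" "\<chi> v w + s"] zL(2) by simp
  then show ?thesis by (cases "\<chi> v w"; cases s) simp_all
qed

text \<open>A square root in \<open>k\<close> of a rational number \<open>p\<close> is \<open>s\<close> or \<open>t r\<close> with rational \<open>s, t\<close>.\<close>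

lemma character_generic:
  assumes z: "character z \<chi>" "z\<^sup>2 = of_rat p" and p: "\<not> is_sq p" "\<not> is_sq (p * disc a b)" and r: "r \<notin> \<rat>"
  shows "\<exists>v w. (v, w, 0) \<in> H \<and> \<chi> v w = 1"
proof (rule base_character_nontrivial[OF _ _ _ r])
  show "base_character z \<chi>" using z(1) unfolding character_def base_character_def by blast
  show "z\<^sup>2 \<in> k" unfolding z(2) by (rule of_rat_in_k)
  show "z \<notin> k"
  proof
    assume "z \<in> k"
    then obtain s t where st: "z = of_rat s + of_rat t * r" using k_coordinates[OF r] by blast
    have "z\<^sup>2 = of_rat (s * s + disc a b * t * t) + of_rat (s * t + t * s) * r"
      unfolding power2_eq_square by (rule k_mult[OF st st])
    then have eq: "p = s * s + disc a b * t * t" "s * t + t * s = 0"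
      using coordinates_unique[OF r, of p 0] z(2) by auto
    then have "s = 0 \<or> t = 0" by auto
    then show False
    proof
      assume "s = 0"
      then have "(disc a b * t)\<^sup>2 = p * disc a b" using eq(1) by (simp add: power2_eq_square)
      then show False using p(2) unfolding is_sq_def by blast
    next
      assume "t = 0"
      then have "s\<^sup>2 = p" using eq(1) by (simp add: power2_eq_square)
      then show False using p(1) unfolding is_sq_def by blast
    qed
  qed
qed

end

definition realises_pair ::
  "rat \<Rightarrow> rat \<Rightarrow> ('x, 'y) monoid_scheme \<Rightarrow> (nat \<Rightarrow> nat) set set \<Rightarrow> bool" where
  "realises_pair a b Q T \<longleftrightarrow> Factorial_Ring.irreducible (octic a b) \<and>
     galois_group (quartic a b) \<cong> Q \<and> galois_type (octic a b) 8 T"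

lemma bit_sum_eq: "(x :: bit) + y = z \<longleftrightarrow> y = x + z"
  by (cases x; cases y; cases z) simp_all

text \<open>In the following locale \<open>P\<close> and \<open>N\<close> are the values of the quartic at \<open>-1\<close> and \<open>1\<close>. If one of
  \<open>P, N, P N\<close> is a square, one linear relation holds between the sums \<open>v + w\<close>; if it is
  \<open>D = r\<^sup>2\<close> times a square, the relation involves \<open>s\<close>; if it is neither, some element of \<open>H\<close> with
  \<open>s = 0\<close> violates the relation.\<close>

locale regular_octic = octic_roots +
  assumes regular: "regular a b"
begin

lemma nd: nondegenerate
  by (rule nondegenerate_if_regular[OF regular])

lemma r_irrational: "r \<notin> \<rat>"
  using nd by (simp add: nondegenerate_def)

lemmas transitive = transitive_H[OF nd]

lemma realises_pairI:
  assumes "wreath\<lparr>carrier := forget_sign ` H\<rparr> \<cong> Q" "wreath\<lparr>carrier := H\<rparr> \<cong> G"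
  shows "realises_pair a b Q (transitive_class 8 G)"
  unfolding realises_pair_def
  using octic_irreducible[OF nd] iso_trans[OF quartic_group_iso[OF r_irrational] assms(1)] octic_type[OF nd assms(2)]
  by blast

abbreviation "P \<equiv> at_minus_one a b"
abbreviation "N \<equiv> at_one a b"
abbreviation "D \<equiv> disc a b"

lemma character_product:
  "character (plus_inv \<alpha> * plus_inv \<beta> * (minus_inv \<alpha> * minus_inv \<beta>)) (\<lambda>v w. snd v + snd w)"
  using character_mult[OF character_plus[OF r_irrational] character_minus[OF r_irrational]] by (simp add: ac_simps)

lemma product_square:
  "(plus_inv \<alpha> * plus_inv \<beta> * (minus_inv \<alpha> * minus_inv \<beta>))\<^sup>2 = of_rat (P * N)"
  unfolding power_mult_distrib[of "plus_inv \<alpha> * plus_inv \<beta>"] product_squares of_rat_mult ..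

lemma square_relations:
  assumes h: "(v, w, s) \<in> H"
  shows "is_sq P \<Longrightarrow> fst w = fst v"
    and "is_sq N \<Longrightarrow> fst w + snd w = fst v + snd v"
    and "is_sq (P * N) \<Longrightarrow> snd w = snd v"
    and "is_sq (P * D) \<Longrightarrow> fst w = fst v + s"
    and "is_sq (N * D) \<Longrightarrow> fst w + snd w = fst v + snd v + s"
    and "is_sq (P * N * D) \<Longrightarrow> snd w = snd v + s"
  using character_square[OF character_plus[OF r_irrational] product_squares(1) _ h]
    character_square[OF character_minus[OF r_irrational] product_squares(2) _ h]
    character_square[OF character_product product_square _ h]
    character_twisted_square[OF character_plus[OF r_irrational] product_squares(1) _ h r_irrational]
    character_twisted_square[OF character_minus[OF r_irrational] product_squares(2) _ h r_irrational]
    character_twisted_square[OF character_product product_square _ h r_irrational]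
  by (simp_all add: bit_sum_eq)

lemmas nonsquare_witnesses =
  character_generic[OF character_plus[OF r_irrational] product_squares(1) _ _ r_irrational]
  character_generic[OF character_minus[OF r_irrational] product_squares(2) _ _ r_irrational]
  character_generic[OF character_product product_square _ _ r_irrational]

lemma bit_cancel: "(x :: bit) + y = x + z \<longleftrightarrow> y = z" "(x + s) + y = x + z + s \<longleftrightarrow> y = z"
    "x + y = x + z + s \<longleftrightarrow> y = z + s" "(x + s) + y = x + z \<longleftrightarrow> y = z + s"
  by (cases x; cases y; cases z; cases s; simp)+

lemma E4_8T2:
  assumes "is_sq (P * D)" "is_sq (N * D)"
  shows "realises_pair a b E4 T8_2"
proof -
  have fw: "fst w = fst v + s" and sw: "snd w = snd v" if h: "(v, w, s) \<in> H" for v w s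
  proof -
    show "fst w = fst v + s" by (rule square_relations(4)[OF h assms(1)])
    then show "snd w = snd v" using square_relations(5)[OF h assms(2)] by (simp add: bit_cancel)
  qed
  obtain x y where xy: "(x, y, 1) \<in> H" using swap_exists[OF r_irrational] .
  have "x \<noteq> y" using fw[OF xy] by (cases "fst x") auto
  moreover have "block_sums H = {0}"
    using fw sw by (intro block_sums_zeroI[OF transitive] prod_eqI) fastforce+
  ultimately have "wreath\<lparr>carrier := H\<rparr> \<cong> C4 \<times>\<times> C2" using no_sums_twisted_iso[OF transitive _ xy] by blast
  then show ?thesis
    unfolding T8_2_def using sw by (intro realises_pairI quartic_E4[OF transitive])
qed

lemma E4_8T3:
  assumes "is_sq P" "is_sq N"
  shows "realises_pair a b E4 T8_3"
proof -
  have fw: "fst w = fst v" and sw: "snd w = snd v" if h: "(v, w, s) \<in> H" for v w s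
  proof -
    show "fst w = fst v" by (rule square_relations(1)[OF h assms(1)])
    then show "snd w = snd v" using square_relations(2)[OF h assms(2)] by (simp add: bit_cancel)
  qed
  obtain x y where xy: "(x, y, 1) \<in> H" using swap_exists[OF r_irrational] .
  have "y = x" using fw[OF xy] sw[OF xy] by (rule prod_eqI)
  moreover have D0: "block_sums H = {0}"
    using fw sw by (intro block_sums_zeroI[OF transitive] prod_eqI) blast+
  ultimately have "wreath\<lparr>carrier := H\<rparr> \<cong> C2 \<times>\<times> C2 \<times>\<times> C2" using no_sums_iso[OF transitive D0] xy by blast
  then show ?thesis
    unfolding T8_3_def using sw by (intro realises_pairI quartic_E4[OF transitive])
qed

lemma C4_8T2:
  assumes "is_sq (P * D)" "is_sq N"
  shows "realises_pair a b C4 T8_2"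
proof -
  have fw: "fst w = fst v + s" and sw: "snd w = snd v + s" if h: "(v, w, s) \<in> H" for v w s
  proof -
    show "fst w = fst v + s" by (rule square_relations(4)[OF h assms(1)])
    then show "snd w = snd v + s" using square_relations(2)[OF h assms(2)] by (simp add: bit_cancel)
  qed
  obtain x y where xy: "(x, y, 1) \<in> H" using swap_exists[OF r_irrational] .
  have "x \<noteq> y" using fw[OF xy] by (cases "fst x") auto
  moreover have "block_sums H = {0}"
    using fw sw by (intro block_sums_zeroI[OF transitive] prod_eqI) fastforce+
  ultimately have "wreath\<lparr>carrier := H\<rparr> \<cong> C4 \<times>\<times> C2" using no_sums_twisted_iso[OF transitive _ xy] by blast
  then show ?thesis
    unfolding T8_2_def using sw by (intro realises_pairI quartic_C4[OF transitive])
qed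

lemma sums_sign:
  assumes "\<And>v w. (v, w, 0) \<in> H \<Longrightarrow> snd w = snd v" "\<not> is_sq P" "\<not> is_sq (P * D)"
  shows "block_sums H = {0, (1, 0)}"
proof -
  obtain v w where vw: "(v, w, 0) \<in> H" "fst v + fst w = 1" using nonsquare_witnesses(1) assms(2,3) by blast
  have "v + w \<in> {0, (1, 0)}" if "(v, w, 0) \<in> H" for v w
    using assms(1)[OF that] by (cases v; cases w; cases "fst v"; cases "fst w") (auto simp: zero_prod_def)
  moreover have "w \<noteq> v" using vw(2) by auto
  ultimately show ?thesis using block_sums_oneI[OF transitive _ vw(1)] by blast
qed

lemma sums_inversion:
  assumes "\<And>v w. (v, w, 0) \<in> H \<Longrightarrow> fst w = fst v" "\<not> is_sq N" "\<not> is_sq (N * D)"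
  shows "block_sums H = {0, (0, 1)}"
proof -
  obtain v w where vw: "(v, w, 0) \<in> H" "fst v + snd v + (fst w + snd w) = 1"
    using nonsquare_witnesses(2) assms(2,3) by blast
  have "v + w \<in> {0, (0, 1)}" if "(v, w, 0) \<in> H" for v w
    using assms(1)[OF that] by (cases v; cases w; cases "snd v"; cases "snd w") (auto simp: zero_prod_def)
  moreover have "w \<noteq> v" using vw(2) by auto
  ultimately show ?thesis using block_sums_oneI[OF transitive _ vw(1)] by blast
qed

lemma axes_nonzero: "(1, 0) \<noteq> (0 :: bit \<times> bit)" "(0, 1) \<noteq> (0 :: bit \<times> bit)"
  by (simp_all add: zero_prod_def)

lemma quartic_D4_inversion: "block_sums H = {0, (0, 1)} \<Longrightarrow> wreath\<lparr>carrier := forget_sign ` H\<rparr> \<cong> D4"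
  by (rule quartic_D4[OF transitive, of "(0, 1)"]) simp_all

text \<open>The two characters that tell 8T4 from 8T9. Each of them vanishes on the graph that
  \<open>one_sum_nonsplit_graph\<close> describes for \<open>k = (1, 0)\<close> and \<open>k = (0, 1)\<close>, respectively, but not at
  \<open>(k, 0, 0)\<close>.\<close>

lemma base_plus_minus: "base_character (plus_inv \<alpha> * minus_inv \<beta>) (\<lambda>v w. fst v + (fst w + snd w))"
  by (rule base_character_mult[OF base_plus[OF r_irrational] base_minus'[OF r_irrational]])

lemma base_minus_product:
  "base_character (minus_inv \<alpha> * (plus_inv \<beta> * minus_inv \<beta>)) (\<lambda>v w. fst v + snd v + snd w)"
  using base_character_mult[OF base_minus[OF r_irrational]
      base_character_mult[OF base_plus'[OF r_irrational] base_minus'[OF r_irrational]]] by simp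

lemma minus_product_square:
  "(minus_inv \<alpha> * (plus_inv \<beta> * minus_inv \<beta>))\<^sup>2 =
     of_rat ((- 2 - a / 2) * (a\<^sup>2 / 2 - b - 2) + D * (1 / 2) * (a / 2)) +
     of_rat ((- 2 - a / 2) * (a / 2) + 1 / 2 * (a\<^sup>2 / 2 - b - 2)) * r"
  unfolding power_mult_distrib[of "minus_inv \<alpha>"] by (rule k_mult[OF squares(3) product_squares(4)])

context
  assumes PN: "is_sq (P * N)" and generic: "\<not> is_sq P" "\<not> is_sq (P * D)"
begin

lemma E4_sums: "block_sums H = {0, (1, 0)}" "(v, w, s) \<in> H \<Longrightarrow> snd w = snd v"
  using sums_sign square_relations(3) PN generic by blast+

lemma E4_swap_sum: "(x, y, 1) \<in> H \<Longrightarrow> x + y \<in> {0, (1, 0)}"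
  using E4_sums(2)[of x y 1] by (cases x; cases y; cases "fst x"; cases "fst y") (auto simp: zero_prod_def)

text \<open>The hypothesis says that \<open>s + t r\<close> is a square root of \<open>(A(\<alpha>) B(\<beta>))\<^sup>2 = b - 6 - 2 r\<close>.\<close>

lemma E4_8T4:
  assumes "s\<^sup>2 + D * t\<^sup>2 = b - 6" "2 * s * t = - 2"
  shows "realises_pair a b E4 T8_4"
proof -
  obtain x y where xy: "(x, y, 1) \<in> H" using swap_exists[OF r_irrational] .
  have "plus_inv \<alpha> * minus_inv \<beta> \<in> k" by (rule in_k[OF product_squares(5) assms])
  then have "((1, 0), 0, 0) \<notin> H"
    using base_character_trivial[OF base_plus_minus _ _ r_irrational, of "(1, 0)" 0] by auto
  then have "wreath\<lparr>carrier := H\<rparr> \<cong> D4"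
    using one_sum_nonsplit_iso[OF transitive E4_sums(1) axes_nonzero(1) _ xy E4_swap_sum[OF xy]] by blast
  then show ?thesis
    unfolding T8_4_def using E4_sums(2) by (intro realises_pairI quartic_E4[OF transitive])
qed

lemma E4_8T9:
  assumes "no_root_in_k D (b - 6) (- 2)"
  shows "realises_pair a b E4 T8_9"
proof -
  let ?z = "plus_inv \<alpha> * minus_inv \<beta>"
  obtain x y where xy: "(x, y, 1) \<in> H" using swap_exists[OF r_irrational] .
  have "?z \<notin> k" by (rule not_in_k[OF r_irrational product_squares(5) assms])
  moreover have "?z\<^sup>2 \<in> k"
    unfolding power_mult_distrib by (intro subfield_mult[OF k_subfield] squares_in_k)
  ultimately obtain v w where vw: "(v, w, 0) \<in> H" "fst v + (fst w + snd w) = 1"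
    using base_character_nontrivial[OF base_plus_minus _ _ r_irrational] by blast
  have "((1, 0), 0, 0) \<in> H"
  proof (rule ccontr)
    assume "((1, 0), 0, 0) \<notin> H"
    from one_sum_nonsplit_graph[OF transitive E4_sums(1) axes_nonzero(1) this vw(1)] show False
      using vw(2) by (cases v; cases "fst v"; cases "snd v") (auto simp: zero_prod_def split: if_splits)
  qed
  then have "wreath\<lparr>carrier := H\<rparr> \<cong> C2 \<times>\<times> D4"
    using one_sum_split_iso[OF transitive E4_sums(1) axes_nonzero(1) _ xy E4_swap_sum[OF xy]] by blast
  then show ?thesis
    unfolding T8_9_def using E4_sums(2) by (intro realises_pairI quartic_E4[OF transitive])
qed

end

lemma C4_8T10:
  assumes "is_sq (P * N * D)" "\<not> is_sq P" "\<not> is_sq (P * D)"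
  shows "realises_pair a b C4 T8_10"
proof -
  have w: "snd w = snd v + s" if h: "(v, w, s) \<in> H" for v w s
    using square_relations(6)[OF h] assms by blast
  obtain x y where xy: "(x, y, 1) \<in> H" using swap_exists[OF r_irrational] .
  have D1: "block_sums H = {0, (1, 0)}" using sums_sign w assms by simp
  have "x + y \<notin> {0, (1, 0)}" using w[OF xy] by (cases x; cases y; cases "snd x") (auto simp: zero_prod_def)
  then have "wreath\<lparr>carrier := H\<rparr> \<cong> E4_semidirect_C4"
    by (rule one_sum_twisted_iso[OF transitive D1 axes_nonzero(1) xy])
  then show ?thesis
    unfolding T8_10_def using w by (intro realises_pairI quartic_C4[OF transitive])
qed

context
  assumes P: "is_sq P" and generic: "\<not> is_sq N" "\<not> is_sq (N * D)"
begin

lemma D4_sums: "block_sums H = {0, (0, 1)}"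
  using sums_inversion square_relations(1) P generic by blast

lemma D4_swap_sum: "(x, y, 1) \<in> H \<Longrightarrow> x + y \<in> {0, (0, 1)}"
  using square_relations(1)[of x y 1] P by (cases x; cases y; cases "snd x"; cases "snd y") (auto simp: zero_prod_def)

text \<open>Here \<open>s + t r\<close> is a square root of \<open>(B(\<alpha>) A(\<beta>) B(\<beta>))\<^sup>2\<close>.\<close>

lemma D4_8T4:
  assumes "s\<^sup>2 + D * t\<^sup>2 = (- 2 - a / 2) * (a\<^sup>2 / 2 - b - 2) + D * (1 / 2) * (a / 2)"
    "2 * s * t = (- 2 - a / 2) * (a / 2) + 1 / 2 * (a\<^sup>2 / 2 - b - 2)"
  shows "realises_pair a b D4 T8_4"
proof -
  obtain x y where xy: "(x, y, 1) \<in> H" using swap_exists[OF r_irrational] .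
  have "minus_inv \<alpha> * (plus_inv \<beta> * minus_inv \<beta>) \<in> k" by (rule in_k[OF minus_product_square assms])
  then have "((0, 1), 0, 0) \<notin> H"
    using base_character_trivial[OF base_minus_product _ _ r_irrational, of "(0, 1)" 0] by auto
  then have "wreath\<lparr>carrier := H\<rparr> \<cong> D4"
    using one_sum_nonsplit_iso[OF transitive D4_sums axes_nonzero(2) _ xy D4_swap_sum[OF xy]] by blast
  then show ?thesis
    unfolding T8_4_def using quartic_D4_inversion[OF D4_sums] by (intro realises_pairI)
qed

lemma D4_8T9:
  assumes "no_root_in_k D ((- 2 - a / 2) * (a\<^sup>2 / 2 - b - 2) + D * (1 / 2) * (a / 2))
    ((- 2 - a / 2) * (a / 2) + 1 / 2 * (a\<^sup>2 / 2 - b - 2))"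
  shows "realises_pair a b D4 T8_9"
proof -
  let ?z = "minus_inv \<alpha> * (plus_inv \<beta> * minus_inv \<beta>)"
  obtain x y where xy: "(x, y, 1) \<in> H" using swap_exists[OF r_irrational] .
  have "?z \<notin> k" by (rule not_in_k[OF r_irrational minus_product_square assms])
  moreover have "?z\<^sup>2 \<in> k"
    unfolding power_mult_distrib by (intro subfield_mult[OF k_subfield] squares_in_k)
  ultimately obtain v w where vw: "(v, w, 0) \<in> H" "fst v + snd v + snd w = 1"
    using base_character_nontrivial[OF base_minus_product _ _ r_irrational] by blast
  have "((0, 1), 0, 0) \<in> H"
  proof (rule ccontr)
    assume "((0, 1), 0, 0) \<notin> H"
    from one_sum_nonsplit_graph[OF transitive D4_sums axes_nonzero(2) this vw(1)] show False
      using vw(2) by (cases v; cases "fst v"; cases "snd v") (auto simp: zero_prod_def split: if_splits)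
  qed
  then have "wreath\<lparr>carrier := H\<rparr> \<cong> C2 \<times>\<times> D4"
    using one_sum_split_iso[OF transitive D4_sums axes_nonzero(2) _ xy D4_swap_sum[OF xy]] by blast
  then show ?thesis
    unfolding T8_9_def using quartic_D4_inversion[OF D4_sums] by (intro realises_pairI)
qed

end

lemma D4_8T10:
  assumes "is_sq (P * D)" "\<not> is_sq N" "\<not> is_sq (N * D)"
  shows "realises_pair a b D4 T8_10"
proof -
  have w: "fst w = fst v + s" if h: "(v, w, s) \<in> H" for v w s
    using square_relations(4)[OF h] assms by blast
  obtain x y where xy: "(x, y, 1) \<in> H" using swap_exists[OF r_irrational] .
  have D1: "block_sums H = {0, (0, 1)}" using sums_inversion w assms by simp
  have "x + y \<notin> {0, (0, 1)}" using w[OF xy] by (cases x; cases y; cases "fst x") (auto simp: zero_prod_def)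
  then have "wreath\<lparr>carrier := H\<rparr> \<cong> E4_semidirect_C4"
    by (rule one_sum_twisted_iso[OF transitive D1 axes_nonzero(2) xy])
  then show ?thesis
    unfolding T8_10_def using quartic_D4_inversion[OF D1] by (intro realises_pairI)
qed

lemma D4_8T18:
  assumes "\<not> is_sq P" "\<not> is_sq (P * D)" "\<not> is_sq N" "\<not> is_sq (N * D)" "\<not> is_sq (P * N)" "\<not> is_sq (P * N * D)"
  shows "realises_pair a b D4 T8_18"
proof -
  obtain d where d: "d \<in> block_sums H" "fst d = 1"
    using nonsquare_witnesses(1) assms(1,2) block_sumsI by fastforce
  obtain e where e: "e \<in> block_sums H" "fst e + snd e = 1"
    using nonsquare_witnesses(2) assms(3,4) block_sumsI by (fastforce simp: ac_simps)
  obtain f where f: "f \<in> block_sums H" "snd f = 1"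
    using nonsquare_witnesses(3) assms(5,6) block_sumsI by fastforce
  have "block_sums H \<noteq> {0}" using d by auto
  moreover have "block_sums H \<noteq> {0, k}" for k
    using d e f by (cases k) auto
  ultimately have "block_sums H = UNIV" using block_sums_cases[OF transitive] by blast
  then show ?thesis
    unfolding T8_18_def using all_sums_iso[OF transitive] quartic_D4[OF transitive f] by (intro realises_pairI)
qed

end

lemma regular_octic_exists: "regular a b \<Longrightarrow> \<exists>\<alpha> \<beta>. regular_octic a b \<alpha> \<beta>"
  using octic_roots_exist by (auto simp: regular_octic_def regular_octic_axioms_def)

section \<open>One polynomial for each pair\<close>

text \<open>Each pair of integers \<open>a, b\<close> puts \<open>P\<close>, \<open>N\<close> and \<open>P N\<close> into the square classes of one of the ten cases.
  Norms reduce all conditions to the recognition of rational squares: a square root is supplied where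
  the number is a square, and where it is not, it is negative or in the following list.\<close>

lemmas value_simps = at_minus_one_def at_one_def disc_def power2_eq_square

lemma nonsquares:
  "\<not> is_sq (3 / 4)" "\<not> is_sq (5 / 4)" "\<not> is_sq (7 / 4)" "\<not> is_sq 2" "\<not> is_sq 3"
  "\<not> is_sq (15 / 4)" "\<not> is_sq 5" "\<not> is_sq 8" "\<not> is_sq 13" "\<not> is_sq 18"
  "\<not> is_sq 21" "\<not> is_sq 32" "\<not> is_sq 39" "\<not> is_sq 40" "\<not> is_sq 45"
  "\<not> is_sq 98" "\<not> is_sq 112" "\<not> is_sq 126" "\<not> is_sq 392" "\<not> is_sq 512"
  by (fact not_sq_between[of "3 / 4" 4 12 3, simplified]
    not_sq_between[of "5 / 4" 4 20 4, simplified]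
    not_sq_between[of "7 / 4" 4 28 5, simplified]
    not_sq_between[of 2 1 2 1, simplified]
    not_sq_between[of 3 1 3 1, simplified]
    not_sq_between[of "15 / 4" 4 60 7, simplified]
    not_sq_between[of 5 1 5 2, simplified]
    not_sq_between[of 8 1 8 2, simplified]
    not_sq_between[of 13 1 13 3, simplified]
    not_sq_between[of 18 1 18 4, simplified]
    not_sq_between[of 21 1 21 4, simplified]
    not_sq_between[of 32 1 32 5, simplified]
    not_sq_between[of 39 1 39 6, simplified]
    not_sq_between[of 40 1 40 6, simplified]
    not_sq_between[of 45 1 45 6, simplified]
    not_sq_between[of 98 1 98 9, simplified]
    not_sq_between[of 112 1 112 10, simplified]
    not_sq_between[of 126 1 126 11, simplified]
    not_sq_between[of 392 1 392 19, simplified]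
    not_sq_between[of 512 1 512 22, simplified])+

lemmas square_simps = value_simps nonsquares not_sq_negative no_root_norm

lemma example_E4_8T2: "realises_pair (- 24) 48 E4 T8_2"
proof -
  have "regular (- 24) 48"
    by (simp add: regular_def square_simps no_root_halves[where n = 14])
  then obtain \<alpha> \<beta> where "regular_octic (- 24) 48 \<alpha> \<beta>" using regular_octic_exists by blast
  then show ?thesis
    by (rule regular_octic.E4_8T2) (simp_all add: square_simps is_sqI[of 196] is_sqI[of 28])
qed

lemma example_E4_8T3: "realises_pair (- 3) 8 E4 T8_3"
proof -
  have "regular (- 3) 8"
    by (simp add: regular_def square_simps no_root_halves[where n = 2] no_root_halves[where n = 4] no_root_halves[where n = 8])
  then obtain \<alpha> \<beta> where "regular_octic (- 3) 8 \<alpha> \<beta>" using regular_octic_exists by blast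
  then show ?thesis
    by (rule regular_octic.E4_8T3) (simp_all add: square_simps is_sqI[of 4] is_sqI[of 2])
qed

lemma example_E4_8T4: "realises_pair (- 4) 8 E4 T8_4"
proof -
  have "regular (- 4) 8"
    by (simp add: regular_def square_simps no_root_halves[where n = 6])
  then obtain \<alpha> \<beta> where "regular_octic (- 4) 8 \<alpha> \<beta>" using regular_octic_exists by blast
  then show ?thesis
    by (rule regular_octic.E4_8T4[where s = 2 and t = "- 1 / 2"]) (simp_all add: square_simps is_sqI[of 6])
qed

lemma example_E4_8T9: "realises_pair (- 2) (- 7) E4 T8_9"
proof -
  have "regular (- 2) (- 7)"
    by (simp add: regular_def square_simps no_root_halves[where n = 3])
  then obtain \<alpha> \<beta> where "regular_octic (- 2) (- 7) \<alpha> \<beta>" using regular_octic_exists by blast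
  then show ?thesis
    by (rule regular_octic.E4_8T9) (simp_all add: square_simps is_sqI[of 3] no_root_halves[where n = 3])
qed

lemma example_C4_8T2: "realises_pair (- 1) 1 C4 T8_2"
proof -
  have "regular (- 1) 1"
    by (simp add: regular_def square_simps no_root_halves[where n = 1])
  then obtain \<alpha> \<beta> where "regular_octic (- 1) 1 \<alpha> \<beta>" using regular_octic_exists by blast
  then show ?thesis
    by (rule regular_octic.C4_8T2) (simp_all add: square_simps is_sqI[of 5] is_sqI[of 1])
qed

lemma example_C4_8T10: "realises_pair (- 1) (- 9) C4 T8_10"
proof -
  have "regular (- 1) (- 9)"
    by (simp add: regular_def square_simps)
  then obtain \<alpha> \<beta> where "regular_octic (- 1) (- 9) \<alpha> \<beta>" using regular_octic_exists by blast
  then show ?thesis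
    by (rule regular_octic.C4_8T10) (simp_all add: square_simps is_sqI[of 45])
qed

lemma example_D4_8T4: "realises_pair 4 22 D4 T8_4"
proof -
  have "regular 4 22"
    by (simp add: regular_def square_simps no_root_halves[where n = 4])
  then obtain \<alpha> \<beta> where "regular_octic 4 22 \<alpha> \<beta>" using regular_octic_exists by blast
  then show ?thesis
    by (rule regular_octic.D4_8T4[where s = 8 and t = "- 1"]) (simp_all add: square_simps is_sqI[of 4])
qed

lemma example_D4_8T9: "realises_pair (- 1) (- 3) D4 T8_9"
proof -
  have "regular (- 1) (- 3)"
    by (simp add: regular_def square_simps no_root_halves[where n = 1])
  then obtain \<alpha> \<beta> where "regular_octic (- 1) (- 3) \<alpha> \<beta>" using regular_octic_exists by blast
  then show ?thesis
    by (rule regular_octic.D4_8T9) (simp_all add: square_simps is_sqI[of 1] no_root_halves[where n = 3])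
qed

lemma example_D4_8T10: "realises_pair (- 4) (- 2) D4 T8_10"
proof -
  have "regular (- 4) (- 2)"
    by (simp add: regular_def square_simps)
  then obtain \<alpha> \<beta> where "regular_octic (- 4) (- 2) \<alpha> \<beta>" using regular_octic_exists by blast
  then show ?thesis
    by (rule regular_octic.D4_8T10) (simp_all add: square_simps is_sqI[of 16])
qed

lemma example_D4_8T18: "realises_pair 1 (- 1) D4 T8_18"
proof -
  have "regular 1 (- 1)"
    by (simp add: regular_def square_simps)
  then obtain \<alpha> \<beta> where "regular_octic 1 (- 1) \<alpha> \<beta>" using regular_octic_exists by blast
  then show ?thesis
    by (rule regular_octic.D4_8T18) (simp_all add: square_simps)
qed

theorem proposition4p3:
  shows
    "(\<forall>a b :: rat. a \<noteq> 0 \<and> Factorial_Ring.irreducible (octic a b) \<longrightarrow>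
        (galois_group (quartic a b) \<cong> E4 \<longrightarrow>
           (\<exists>T \<in> {T8_2, T8_3, T8_4, T8_9}. galois_type (octic a b) 8 T)) \<and>
        (galois_group (quartic a b) \<cong> C4 \<longrightarrow>
           (\<exists>T \<in> {T8_2, T8_10}. galois_type (octic a b) 8 T)) \<and>
        (galois_group (quartic a b) \<cong> D4 \<longrightarrow>
           (\<exists>T \<in> {T8_4, T8_9, T8_10, T8_18}. galois_type (octic a b) 8 T)))
     \<and> (\<forall>T \<in> {T8_2, T8_3, T8_4, T8_9}.
          \<exists>a b :: rat. a \<noteq> 0 \<and> Factorial_Ring.irreducible (octic a b) \<and>
            galois_group (quartic a b) \<cong> E4 \<and> galois_type (octic a b) 8 T)
     \<and> (\<forall>T \<in> {T8_2, T8_10}.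
          \<exists>a b :: rat. a \<noteq> 0 \<and> Factorial_Ring.irreducible (octic a b) \<and>
            galois_group (quartic a b) \<cong> C4 \<and> galois_type (octic a b) 8 T)
     \<and> (\<forall>T \<in> {T8_4, T8_9, T8_10, T8_18}.
          \<exists>a b :: rat. a \<noteq> 0 \<and> Factorial_Ring.irreducible (octic a b) \<and>
            galois_group (quartic a b) \<cong> D4 \<and> galois_type (octic a b) 8 T)"
proof (intro conjI)
  show "\<forall>a b :: rat. a \<noteq> 0 \<and> Factorial_Ring.irreducible (octic a b) \<longrightarrow>
        (galois_group (quartic a b) \<cong> E4 \<longrightarrow>
           (\<exists>T \<in> {T8_2, T8_3, T8_4, T8_9}. galois_type (octic a b) 8 T)) \<and>
        (galois_group (quartic a b) \<cong> C4 \<longrightarrow>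
           (\<exists>T \<in> {T8_2, T8_10}. galois_type (octic a b) 8 T)) \<and>
        (galois_group (quartic a b) \<cong> D4 \<longrightarrow>
           (\<exists>T \<in> {T8_4, T8_9, T8_10, T8_18}. galois_type (octic a b) 8 T))"
    using galois_types_of_irreducible_octic by simp
  have pair: "\<exists>a b :: rat. a \<noteq> 0 \<and> Factorial_Ring.irreducible (octic a b) \<and>
      galois_group (quartic a b) \<cong> Q \<and> galois_type (octic a b) 8 T"
    if "realises_pair a b Q T" "a \<noteq> 0" for a b T and Q :: "(int \<times> int) monoid"
    using that unfolding realises_pair_def by blast
  have pair_C4: "\<exists>a b :: rat. a \<noteq> 0 \<and> Factorial_Ring.irreducible (octic a b) \<and>
      galois_group (quartic a b) \<cong> C4 \<and> galois_type (octic a b) 8 T"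
    if "realises_pair a b C4 T" "a \<noteq> 0" for a b T
    using that unfolding realises_pair_def by blast
  show "\<forall>T \<in> {T8_2, T8_3, T8_4, T8_9}. \<exists>a b :: rat. a \<noteq> 0 \<and> Factorial_Ring.irreducible (octic a b) \<and>
      galois_group (quartic a b) \<cong> E4 \<and> galois_type (octic a b) 8 T"
    using pair[OF example_E4_8T2] pair[OF example_E4_8T3] pair[OF example_E4_8T4] pair[OF example_E4_8T9] by simp
  show "\<forall>T \<in> {T8_2, T8_10}. \<exists>a b :: rat. a \<noteq> 0 \<and> Factorial_Ring.irreducible (octic a b) \<and>
      galois_group (quartic a b) \<cong> C4 \<and> galois_type (octic a b) 8 T"
    using pair_C4[OF example_C4_8T2] pair_C4[OF example_C4_8T10] by simp
  show "\<forall>T \<in> {T8_4, T8_9, T8_10, T8_18}. \<exists>a b :: rat. a \<noteq> 0 \<and> Factorial_Ring.irreducible (octic a b) \<and>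
      galois_group (quartic a b) \<cong> D4 \<and> galois_type (octic a b) 8 T"
    using pair[OF example_D4_8T4] pair[OF example_D4_8T9] pair[OF example_D4_8T10] pair[OF example_D4_8T18] by simp
qed

end
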